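(* Let $d\ge 2$, $2<p\le\infty$ and $1/p<r<1/2$ (with $1/p:=0$ if $p=\infty$). There is a constant $C=C(p,d,r)>0$ such that for all integers $m\ge 2$ $$ d_m(\mathbf H^r_p,L_\infty)\le C\,m^{-r}(\log m)^{d-1+r}. $$
   Context: All functions are $2\pi$-periodic in each of $d$ variables, i.e. defined on $\mathbb T^d$; $L_p=L_p(\mathbb T^d)$ with norm $\|\cdot\|_p$ (normalized Lebesgue measure). Kolmogorov widths: for a subset $\mathbf F$ of a Banach space $X$ and $m\ge1$, $$d_m(\mathbf F,X):=\inf_{\{u_i\}_{i=1}^m\subset X}\ \sup_{f\in\mathbf F}\ \inf_{c_1,\dots,c_m}\Big\|f-\sum_{i=1}^m c_iu_i\Big\|_X ,$$ where the $c_i$ are scalars. The class $\mathbf H^r_p$: for $\mathbf t=(t_1,\dots,t_d)$ let $\Delta^l_{t_j,j}$ denote the $l$-th difference operator with step $t_j$ in the variable $x_j$, and for $e\subset\{1,\dots,d\}$ let $\Delta^l_{\mathbf t}(e):=\prod_{j\in e}\Delta^l_{t_j,j}$, with $\Delta^l_{\mathbf t}(\varnothing)=I$ the identity. Fix $l=[r]+1$, where $[\cdot]$ is the integer part. Then $\mathbf H^r_p$ is the set of $f\in L_p$ such that for every $e\subset\{1,\dots,d\}$ and every $\mathbf t$ $$\|\Delta^l_{\mathbf t}(e)f\|_p\le\prod_{j\in e}|t_j|^r$$ (the empty product being $1$). *)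

theory Defs
  imports "HOL-Probability.Essential_Supremum"
begin

text \<open>
  Functions on the torus of dimension \<open>CARD('n)\<close> are functions on \<open>real ^ 'n\<close> that are
  \<open>2 * pi\<close>-periodic in each coordinate; the scalars are complex. Elements of \<open>L\<^sub>p\<close> are given by
  periodic Borel representatives, which every class of Lebesgue measurable periodic functions
  modulo null sets contains.
\<close>

definition torus_measure :: "(real ^ 'n) measure" where
  "torus_measure = uniform_measure lborel (cbox 0 (\<chi> j. 2 * pi))"

definition torus_periodic :: "(real ^ 'n \<Rightarrow> complex) \<Rightarrow> bool" where
  "torus_periodic f \<longleftrightarrow> (\<forall>x j. f (x + axis j (2 * pi)) = f x)"

text \<open>
  The norm takes the value \<open>\<infinity>\<close> outside the space; \<open>enn2real\<close> maps \<open>\<infinity>\<close> to 0, so that case is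
  split off before the root is taken.
\<close>

definition Lp_norm :: "ereal \<Rightarrow> (real ^ 'n \<Rightarrow> complex) \<Rightarrow> ennreal" where
  "Lp_norm p f =
    (if p = \<infinity> then esssup torus_measure (\<lambda>x. ennreal (norm (f x)))
     else let I = \<integral>\<^sup>+x. ennreal (norm (f x) powr real_of_ereal p) \<partial>torus_measure
          in if I = \<infinity> then \<infinity> else ennreal (enn2real I powr (1 / real_of_ereal p)))"

definition Lp_space :: "ereal \<Rightarrow> (real ^ 'n \<Rightarrow> complex) set" where
  "Lp_space p = {f \<in> borel_measurable borel. torus_periodic f \<and> Lp_norm p f < \<infinity>}"

definition difference :: "real \<Rightarrow> 'n \<Rightarrow> (real ^ 'n \<Rightarrow> complex) \<Rightarrow> real ^ 'n \<Rightarrow> complex" where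
  "difference h j f = (\<lambda>x. f (x + axis j h) - f x)"

text \<open>
  The operators being composed commute (see below), so \<^const>\<open>Finite_Set.fold\<close> does not depend
  on the order in which the coordinates in \<open>e\<close> are processed.
\<close>

definition mixed_difference ::
    "nat \<Rightarrow> real ^ 'n \<Rightarrow> 'n set \<Rightarrow> (real ^ 'n \<Rightarrow> complex) \<Rightarrow> real ^ 'n \<Rightarrow> complex" where
  "mixed_difference l t e f = Finite_Set.fold (\<lambda>j. difference (t $ j) j ^^ l) f e"

lemma difference_commute:
  "difference h i (difference k j f) = difference k j (difference h i f)"
  by (simp add: difference_def fun_eq_iff algebra_simps)

lemma difference_pow_commute:
  "(difference h i ^^ l) ((difference k j ^^ m) f) = (difference k j ^^ m) ((difference h i ^^ l) f)"
proof -
  have one: "difference h i ((difference k j ^^ m) g) = (difference k j ^^ m) (difference h i g)" for g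
    by (induction m) (simp_all add: difference_commute[of h i k j])
  show ?thesis
    by (induction l) (simp_all add: one)
qed

lemma mixed_difference_empty: "mixed_difference l t {} f = f"
  by (simp add: mixed_difference_def)

lemma mixed_difference_insert:
  fixes e :: "'n::finite set"
  assumes "j \<notin> e"
  shows "mixed_difference l t (insert j e) f = (difference (t $ j) j ^^ l) (mixed_difference l t e f)"
proof -
  interpret comp_fun_commute "\<lambda>j. difference (t $ j) j ^^ l"
    by standard (simp add: fun_eq_iff difference_pow_commute)
  show ?thesis
    unfolding mixed_difference_def using assms by (intro fold_insert) simp_all
qed

definition class_H :: "real \<Rightarrow> ereal \<Rightarrow> (real ^ 'n \<Rightarrow> complex) set" where
  "class_H r p = {f \<in> Lp_space p. \<forall>e t.
     Lp_norm p (mixed_difference (nat \<lfloor>r\<rfloor> + 1) t e f) \<le> ennreal (\<Prod>j\<in>e. \<bar>t $ j\<bar> powr r)}"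

text \<open>
  Kolmogorov width in a space \<open>X\<close> of functions with norm \<open>N\<close>. Its values are extended
  non-negative reals: a bound on the width of \<open>F\<close> by a finite number forces every \<open>f \<in> F\<close> to have
  finite distance to \<open>X\<close>.
\<close>

definition kolmogorov_width ::
    "('a \<Rightarrow> complex) set \<Rightarrow> (('a \<Rightarrow> complex) \<Rightarrow> ennreal) \<Rightarrow> nat \<Rightarrow> ('a \<Rightarrow> complex) set \<Rightarrow> ennreal" where
  "kolmogorov_width X N m F =
    (INF u \<in> {u :: nat \<Rightarrow> 'a \<Rightarrow> complex. \<forall>i<m. u i \<in> X}.
       SUP f\<in>F. INF c :: nat \<Rightarrow> complex. N (\<lambda>x. f x - (\<Sum>i<m. c i * u i x)))"

end

(*
  Piecewise constant approximation on dyadic cells. Write f as the sum of its dyadic blocks f_s,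
  s in N^d; the value of f_s on a cell is the average over the cell of a mixed difference of f with
  steps of the size of the cell, so ||f_s||_p <= B 2^(-r|s|). For the layer n = |s| drop the values
  of modulus at most eta of each block: this costs eta times the number of blocks (of order
  n^(d-1)) in the uniform norm. The remaining values, taken together over the layer, lie in a
  Euclidean ball of radius about n^((d-1)/2) eta^(1-p/2) 2^(-rpn/2), and every point evaluation has
  norm at most n^((d-1)/2) 2^(n/2) as a functional. For such a class with K evaluation points a
  random m-dimensional subspace has uniform error (radius) * (norm) * sqrt(log K / m), up to a
  constant: by duality this is a bound for the diameter of a random section of the absolutely
  convex hull of the evaluation functionals. Balancing eta gives, with m_n functions,
    n^(d-1) 2^(-rn) (2^n n / m_n)^(1/p),
  and the same with p replaced by 2. With n0 such that 2^n0 n0 is about m and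
  m_n = c m 2^(-e|n-n0|), the exponent 1/2 > r makes the sum over n <= n0 geometric and the exponent
  1/p < r the sum over n >= n0. The total is n0^(d-1) 2^(-r n0), which is the claimed bound.
*)

theory Submission
  imports Defs "HOL-Probability.Probability_Measure"
begin

section \<open>Averages over random signs\<close>

text \<open>The Euclidean estimate alone fails above n0: with exponent 1/2 the layer error grows
  there, since r < 1/2. The cut at eta brings in the stronger integrability, because squares of
  values above eta are controlled by their P-th powers. Below n0 the exponent 1/p < r fails in turn,
  so one lemma serves two exponents P.

  The random vectors have entries 1 and -1. Their averages are finite nested means, and the signs
  are fixed one vector at a time without exceeding the mean. If v is orthogonal to all k sign
  vectors g, nothing is subtracted from k times the mean of |<g, v>|; the uniform deviation bound
  then limits this mean, and Khinchine's inequality turns it into the length of v.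

  Since r < 1, only first differences occur and piecewise constant blocks suffice: a layer takes
  finitely many values and log K is of order n. This n is the source of the power r in the exponent
  d - 1 + r of the logarithm.\<close>

primrec sign_mean :: "'i list \<Rightarrow> (('i \<Rightarrow> real) \<Rightarrow> real) \<Rightarrow> real" where
  "sign_mean [] F = F (\<lambda>_. 0)"
| "sign_mean (i # xs) F =
    (sign_mean xs (\<lambda>g. F (g(i := 1))) + sign_mean xs (\<lambda>g. F (g(i := -1)))) / 2"

text \<open>The recursion starts from the zero function and only writes 1 or -1, so no argument with
  an entry outside [-1, 1] ever occurs.\<close>

lemma sign_mean_mono:
  assumes "\<And>g. (\<And>i. \<bar>g i\<bar> \<le> 1) \<Longrightarrow> F g \<le> G g"
  shows "sign_mean xs F \<le> sign_mean xs G"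
  using assms
proof (induction xs arbitrary: F G)
  case (Cons i xs)
  have "sign_mean xs (\<lambda>g. F (g(i := 1))) \<le> sign_mean xs (\<lambda>g. G (g(i := 1)))"
    "sign_mean xs (\<lambda>g. F (g(i := -1))) \<le> sign_mean xs (\<lambda>g. G (g(i := -1)))"
    by (intro Cons.IH Cons.prems, auto)+
  then show ?case by simp
qed simp

lemma sign_mean_add: "sign_mean xs (\<lambda>g. F g + G g) = sign_mean xs F + sign_mean xs G"
  by (induction xs arbitrary: F G) (simp_all add: field_simps)

lemma sign_mean_cmult: "sign_mean xs (\<lambda>g. c * F g) = c * sign_mean xs F"
  by (induction xs arbitrary: F) (simp_all add: field_simps)

lemma sign_mean_Cons:
  "sign_mean (i # xs) F = sign_mean xs (\<lambda>g. 1/2 * (F (g(i := 1)) + F (g(i := -1))))"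
  by (simp only: sign_mean_cmult sign_mean_add sign_mean.simps)

lemma sign_mean_const [simp]: "sign_mean xs (\<lambda>_. c) = c"
  by (induction xs) simp_all

lemma sign_mean_uminus: "sign_mean xs (\<lambda>g. F (\<lambda>i. - g i)) = sign_mean xs F"
proof (induction xs arbitrary: F)
  case (Cons i xs)
  have eq: "(\<lambda>k. - (g(i := c)) k) = (\<lambda>k. - g k)(i := -c)" for g :: "'a \<Rightarrow> real" and c
    by auto
  show ?case
    using Cons.IH[of "\<lambda>g. F (g(i := 1))"] Cons.IH[of "\<lambda>g. F (g(i := -1))"]
    unfolding sign_mean.simps eq by simp
qed simp

lemma sign_mean_swap:
  "sign_mean xs (\<lambda>g. sign_mean js (\<lambda>h. F g h)) = sign_mean js (\<lambda>h. sign_mean xs (\<lambda>g. F g h))"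
proof (induction xs arbitrary: F)
  case (Cons i xs)
  show ?case
    unfolding sign_mean_Cons Cons.IH[symmetric]
    by (simp only: sign_mean_add sign_mean_cmult Cons.IH)
qed simp

text \<open>One of the two halves of the mean is at most the whole. This turns estimates in the mean
  into choices of signs.\<close>

lemma sign_mean_ex: "\<exists>g. F g \<le> sign_mean xs F"
proof (induction xs arbitrary: F)
  case (Cons i xs)
  obtain g1 g2 where "F (g1(i := 1)) \<le> sign_mean xs (\<lambda>g. F (g(i := 1)))"
    "F (g2(i := -1)) \<le> sign_mean xs (\<lambda>g. F (g(i := -1)))"
    using Cons.IH[of "\<lambda>g. F (g(i := 1))"] Cons.IH[of "\<lambda>g. F (g(i := -1))"] by blast
  then have "F (g1(i := 1)) \<le> sign_mean (i # xs) F \<or> F (g2(i := -1)) \<le> sign_mean (i # xs) F"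
    by simp linarith
  then show ?case by blast
qed auto

section \<open>Moments of signed sums and Khinchine's inequality\<close>

abbreviation pairing :: "'i list \<Rightarrow> ('i \<Rightarrow> real) \<Rightarrow> ('i \<Rightarrow> real) \<Rightarrow> real" where
  "pairing xs g v \<equiv> (\<Sum>i\<in>set xs. g i * v i)"

lemma pairing_Cons:
  assumes "distinct (i # xs)"
  shows "pairing (i # xs) (g(i := c)) v = c * v i + pairing xs g v"
proof -
  have "pairing xs (g(i := c)) v = pairing xs g v"
    using assms by (intro sum.cong) auto
  then show ?thesis using assms by simp
qed

lemma sign_mean_square:
  "distinct xs \<Longrightarrow> sign_mean xs (\<lambda>g. (pairing xs g v)\<^sup>2) = (\<Sum>i\<in>set xs. (v i)\<^sup>2)"
proof (induction xs)
  case (Cons i xs)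
  have "sign_mean (i # xs) (\<lambda>g. (pairing (i # xs) g v)\<^sup>2) =
    sign_mean xs (\<lambda>g. ((1 * v i + pairing xs g v)\<^sup>2 + (-1 * v i + pairing xs g v)\<^sup>2) / 2)"
    unfolding sign_mean_Cons pairing_Cons[OF Cons.prems] by simp
  also have "\<dots> = sign_mean xs (\<lambda>g. (v i)\<^sup>2 + (pairing xs g v)\<^sup>2)"
    by (intro arg_cong[of _ _ "sign_mean xs"] ext) (simp add: power2_eq_square field_simps)
  also have "\<dots> = (\<Sum>i\<in>set (i # xs). (v i)\<^sup>2)"
    using Cons by (simp add: sign_mean_add)
  finally show ?case .
qed simp

text \<open>Odd powers cancel between the two signs, and the cross term of weight 6 is exactly the
  one in the expansion of three times a square. Hence the constant 3 survives the induction.\<close>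

lemma sign_mean_fourth:
  "distinct xs \<Longrightarrow> sign_mean xs (\<lambda>g. (pairing xs g v) ^ 4) \<le> 3 * (\<Sum>i\<in>set xs. (v i)\<^sup>2)\<^sup>2"
proof (induction xs)
  case (Cons i xs)
  let ?s = "\<Sum>i\<in>set xs. (v i)\<^sup>2"
  have "sign_mean (i # xs) (\<lambda>g. (pairing (i # xs) g v) ^ 4) =
    sign_mean xs (\<lambda>g. ((1 * v i + pairing xs g v) ^ 4 + (-1 * v i + pairing xs g v) ^ 4) / 2)"
    unfolding sign_mean_Cons pairing_Cons[OF Cons.prems] by simp
  also have "\<dots> = sign_mean xs (\<lambda>g. (v i) ^ 4 + (6 * (v i)\<^sup>2 * (pairing xs g v)\<^sup>2 + (pairing xs g v) ^ 4))"
    by (intro arg_cong[of _ _ "sign_mean xs"] ext) (simp add: power2_eq_square power4_eq_xxxx algebra_simps)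
  also have "\<dots> \<le> (v i) ^ 4 + (6 * (v i)\<^sup>2 * ?s + 3 * ?s\<^sup>2)"
    using Cons by (simp add: sign_mean_add sign_mean_cmult sign_mean_square)
  also have "\<dots> \<le> 3 * ((v i)\<^sup>2 + ?s)\<^sup>2"
    using zero_le_power2[of "v i * v i"] by (simp add: power2_eq_square power4_eq_xxxx algebra_simps)
  finally show ?case using Cons.prems by simp
qed simp

text \<open>The fourth moment limits how much of the second moment can come from large values of the
  sum; the rest comes from moderate values and is controlled by the first moment.\<close>

lemma khinchine:
  assumes "distinct xs"
  shows "sqrt (\<Sum>i\<in>set xs. (v i)\<^sup>2) \<le> 5 * sign_mean xs (\<lambda>g. \<bar>pairing xs g v\<bar>)"
proof -
  define s where "s = (\<Sum>i\<in>set xs. (v i)\<^sup>2)"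
  define h where "h = sign_mean xs (\<lambda>g. \<bar>pairing xs g v\<bar>)"
  have s0: "s \<ge> 0" by (simp add: s_def sum_nonneg)
  show ?thesis
  proof (cases "s = 0")
    case True
    have "0 \<le> h" using sign_mean_mono[of "\<lambda>_. 0" "\<lambda>g. \<bar>pairing xs g v\<bar>" xs] by (simp add: h_def)
    then show ?thesis using True by (simp add: s_def[symmetric] h_def[symmetric])
  next
    case False
    then have s: "s > 0" using s0 by simp
    \<comment> \<open>With this choice the fourth-moment term is at most 3 s^2 / (6 s) = s / 2 and
      is absorbed on the left. What remains is sqrt s \<le> 2 sqrt 6 h, and 2 sqrt 6 \<le>
      5.\<close>
    define K where "K = sqrt (6 * s)"
    have K: "K > 0" "K\<^sup>2 = 6 * s" using s by (auto simp: K_def)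
    have pt: "t\<^sup>2 \<le> K * \<bar>t\<bar> + (1 / K\<^sup>2) * t ^ 4" for t :: real
    proof (cases "\<bar>t\<bar> \<le> K")
      case True
      have "t\<^sup>2 = \<bar>t\<bar> * \<bar>t\<bar>" by (simp add: power2_eq_square)
      also have "\<dots> \<le> K * \<bar>t\<bar>" using True by (intro mult_right_mono) auto
      finally show ?thesis by (simp add: add_increasing2)
    next
      case False
      then have "K\<^sup>2 \<le> t\<^sup>2" using K(1) by (simp add: abs_le_square_iff[symmetric])
      then have "K\<^sup>2 * t\<^sup>2 \<le> t\<^sup>2 * t\<^sup>2" by (intro mult_right_mono) auto
      then have "t\<^sup>2 \<le> (1 / K\<^sup>2) * t ^ 4" using K(1) by (simp add: field_simps power4_eq_xxxx power2_eq_square)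
      then show ?thesis using K(1) by (simp add: add_increasing)
    qed
    have "s \<le> K * h + (1 / K\<^sup>2) * sign_mean xs (\<lambda>g. (pairing xs g v) ^ 4)"
      using sign_mean_mono[OF pt, of xs "\<lambda>g. pairing xs g v"]
      by (simp only: sign_mean_add sign_mean_cmult sign_mean_square[OF assms] s_def[symmetric] h_def[symmetric])
    also have "\<dots> \<le> K * h + (1 / K\<^sup>2) * (3 * s\<^sup>2)"
      using sign_mean_fourth[OF assms, of v] by (intro add_left_mono mult_left_mono) (auto simp: s_def)
    also have "\<dots> = K * h + s / 2" using s unfolding K(2) by (simp add: power2_eq_square)
    finally have "s \<le> 2 * K * h" by simp
    then have "sqrt s * sqrt s \<le> (2 * sqrt 6 * h) * sqrt s" using s by (simp add: K_def real_sqrt_mult algebra_simps)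
    then have le: "sqrt s \<le> 2 * sqrt 6 * h" by (rule mult_right_le_imp_le) (use s in simp)
    have "0 \<le> sqrt s" using s by simp
    then have h0: "0 \<le> h" using le by (smt (verit) mult_neg_pos mult_pos_neg real_sqrt_gt_0_iff)
    have "sqrt 6 \<le> sqrt ((5/2)\<^sup>2)" by (intro real_sqrt_le_mono) (simp add: power2_eq_square)
    then have "sqrt 6 \<le> 5/2" by simp
    then have "2 * sqrt 6 * h \<le> 5 * h" using h0 by (intro mult_right_mono) auto
    then show ?thesis using le by (simp add: s_def[symmetric] h_def[symmetric])
  qed
qed

text \<open>
  Symmetrization and contraction for a single random vector: the mean \<open>h z\<close> is replaced by an
  independent copy, and then \<open>\<bar>s\<bar> - \<bar>t\<bar> \<le> \<bar>s - t\<bar>\<close> removes the absolute values.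
\<close>

lemma contraction_step:
  fixes W :: "'z \<Rightarrow> real" and L :: "'z \<Rightarrow> 'i \<Rightarrow> real" and xs :: "'i list"
  assumes T: "T \<noteq> {}" and W: "bdd_above (W ` T)" and L: "\<And>z i. z \<in> T \<Longrightarrow> \<bar>L z i\<bar> \<le> B"
  defines "h \<equiv> \<lambda>z. sign_mean xs (\<lambda>g. \<bar>pairing xs g (L z)\<bar>)"
  shows "sign_mean xs (\<lambda>g. SUP z\<in>T. W z + h z - \<bar>pairing xs g (L z)\<bar>)
    \<le> sign_mean xs (\<lambda>g. SUP z\<in>T. W z + 2 * pairing xs g (L z))"
proof -
  obtain w where w: "\<And>z. z \<in> T \<Longrightarrow> W z \<le> w" using W by (auto simp: bdd_above_def)
  have pb: "\<bar>pairing xs g (L z)\<bar> \<le> (\<Sum>i\<in>set xs. \<bar>g i\<bar> * B)" if "z \<in> T" for g z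
  proof -
    have "\<bar>pairing xs g (L z)\<bar> \<le> (\<Sum>i\<in>set xs. \<bar>g i * L z i\<bar>)" by (rule sum_abs)
    also have "\<dots> \<le> (\<Sum>i\<in>set xs. \<bar>g i\<bar> * B)"
      using L[OF that] by (intro sum_mono) (auto simp: abs_mult intro: mult_left_mono)
    finally show ?thesis .
  qed
  define P where "P g = (SUP z\<in>T. W z + 2 * \<bar>pairing xs g (L z)\<bar>)" for g
  define N where "N g = (SUP z\<in>T. W z - 2 * \<bar>pairing xs g (L z)\<bar>)" for g
  define Q where "Q g = (SUP z\<in>T. W z + 2 * pairing xs g (L z))" for g
  have bP: "bdd_above ((\<lambda>z. W z + 2 * \<bar>pairing xs g (L z)\<bar>) ` T)" for g
    by (rule bdd_aboveI2[of _ _ "w + 2 * (\<Sum>i\<in>set xs. \<bar>g i\<bar> * B)"]) (use w pb[of _ g] in \<open>force intro: add_mono\<close>)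
  have bN: "bdd_above ((\<lambda>z. W z - 2 * \<bar>pairing xs g (L z)\<bar>) ` T)" for g
    by (rule bdd_aboveI2[of _ _ w]) (use w in \<open>force\<close>)
  have bQ: "bdd_above ((\<lambda>z. W z + 2 * pairing xs g (L z)) ` T)" for g
    by (rule bdd_aboveI2[of _ _ "w + 2 * (\<Sum>i\<in>set xs. \<bar>g i\<bar> * B)"])
      (use w pb[of _ g] in \<open>smt (verit)\<close>)
  \<comment> \<open>Use the sign of \<open>g\<close> that makes the pairing with \<open>L z\<close>
    nonnegative for \<open>z\<close>, and the opposite sign for \<open>y\<close>: minus a modulus is
    below either signed value. One point is charged to \<open>Q g\<close>, the other to
    \<open>Q\<close> at \<open>- g\<close>.\<close>
  have PN: "P g + N g \<le> Q g + Q (\<lambda>i. - g i)" for g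
  proof -
    have key: "(W z + 2 * \<bar>pairing xs g (L z)\<bar>) + (W y - 2 * \<bar>pairing xs g (L y)\<bar>) \<le> Q g + Q (\<lambda>i. - g i)"
      if "z \<in> T" "y \<in> T" for z y
    proof -
      have 1: "W z + 2 * pairing xs g (L z) \<le> Q g" "W y + 2 * pairing xs g (L y) \<le> Q g"
        unfolding Q_def using that by (auto intro: cSUP_upper[OF _ bQ])
      have "W z + 2 * pairing xs (\<lambda>i. - g i) (L z) \<le> Q (\<lambda>i. - g i)"
        "W y + 2 * pairing xs (\<lambda>i. - g i) (L y) \<le> Q (\<lambda>i. - g i)"
        unfolding Q_def by (rule cSUP_upper[OF that(1) bQ], rule cSUP_upper[OF that(2) bQ])
      then have 2: "W z - 2 * pairing xs g (L z) \<le> Q (\<lambda>i. - g i)"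
        "W y - 2 * pairing xs g (L y) \<le> Q (\<lambda>i. - g i)"
        by (simp_all add: sum_negf)
      show ?thesis using 1 2 by (smt (verit))
    qed
    have "P g \<le> Q g + Q (\<lambda>i. - g i) - N g"
      unfolding P_def
    proof (rule cSUP_least[OF T])
      fix z assume z: "z \<in> T"
      have "N g \<le> Q g + Q (\<lambda>i. - g i) - (W z + 2 * \<bar>pairing xs g (L z)\<bar>)"
        unfolding N_def by (rule cSUP_least[OF T]) (use key z in force)
      then show "W z + 2 * \<bar>pairing xs g (L z)\<bar> \<le> Q g + Q (\<lambda>i. - g i) - N g" by simp
    qed
    then show ?thesis by simp
  qed
  \<comment> \<open>\<open>h z\<close> becomes a mean over an independent copy \<open>g'\<close>.
    Splitting \<open>W z\<close> into two halves separates the copies: one half goes with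
    \<open>g'\<close> into \<open>P\<close>, the other with \<open>g\<close> into
    \<open>N\<close>.\<close>
  have "(SUP z\<in>T. W z + h z - \<bar>pairing xs g (L z)\<bar>) \<le> 1/2 * sign_mean xs P + 1/2 * N g" for g
  proof (rule cSUP_least[OF T])
    fix z assume z: "z \<in> T"
    have "W z + h z - \<bar>pairing xs g (L z)\<bar> = sign_mean xs (\<lambda>g'. (W z - \<bar>pairing xs g (L z)\<bar>) + \<bar>pairing xs g' (L z)\<bar>)"
      by (simp add: sign_mean_add h_def)
    also have "\<dots> \<le> sign_mean xs (\<lambda>g'. 1/2 * P g' + 1/2 * N g)"
    proof (rule sign_mean_mono)
      fix g'
      have "W z + 2 * \<bar>pairing xs g' (L z)\<bar> \<le> P g'" "W z - 2 * \<bar>pairing xs g (L z)\<bar> \<le> N g"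
        unfolding P_def N_def using z by (auto intro: cSUP_upper[OF _ bP] cSUP_upper[OF _ bN])
      then show "(W z - \<bar>pairing xs g (L z)\<bar>) + \<bar>pairing xs g' (L z)\<bar> \<le> 1/2 * P g' + 1/2 * N g" by linarith
    qed
    also have "\<dots> = 1/2 * sign_mean xs P + 1/2 * N g"
      by (subst sign_mean_add, subst sign_mean_cmult) simp
    finally show "W z + h z - \<bar>pairing xs g (L z)\<bar> \<le> 1/2 * sign_mean xs P + 1/2 * N g" .
  qed
  then have "sign_mean xs (\<lambda>g. SUP z\<in>T. W z + h z - \<bar>pairing xs g (L z)\<bar>)
     \<le> sign_mean xs (\<lambda>g. 1/2 * sign_mean xs P + 1/2 * N g)"
    by (intro sign_mean_mono)
  also have "\<dots> = 1/2 * sign_mean xs (\<lambda>g. P g + N g)"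
    by (subst sign_mean_add, subst sign_mean_cmult) (simp add: sign_mean_add)
  also have "\<dots> \<le> 1/2 * sign_mean xs (\<lambda>g. Q g + Q (\<lambda>i. - g i))"
    by (intro mult_left_mono sign_mean_mono PN) auto
  also have "\<dots> = sign_mean xs Q"
    by (simp add: sign_mean_add sign_mean_uminus)
  finally show ?thesis unfolding Q_def .
qed

section \<open>Sums of independent sign vectors and uniform deviation from the mean\<close>

primrec sign_sum_mean :: "'i list \<Rightarrow> nat \<Rightarrow> (('i \<Rightarrow> real) \<Rightarrow> real) \<Rightarrow> real" where
  "sign_sum_mean xs 0 F = F (\<lambda>_. 0)"
| "sign_sum_mean xs (Suc k) F = sign_mean xs (\<lambda>g. sign_sum_mean xs k (\<lambda>S. F (\<lambda>i. S i + g i)))"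

lemma sign_sum_mean_mono: "(\<And>S. F S \<le> G S) \<Longrightarrow> sign_sum_mean xs k F \<le> sign_sum_mean xs k G"
  by (induction k arbitrary: F G) (auto intro!: sign_mean_mono)

lemma sign_sum_mean_add: "sign_sum_mean xs k (\<lambda>S. F S + G S) = sign_sum_mean xs k F + sign_sum_mean xs k G"
  by (induction k arbitrary: F G) (simp_all add: sign_mean_add)

lemma sign_sum_mean_cmult: "sign_sum_mean xs k (\<lambda>S. c * F S) = c * sign_sum_mean xs k F"
  by (induction k arbitrary: F) (simp_all add: sign_mean_cmult)

lemma sign_sum_mean_const [simp]: "sign_sum_mean xs k (\<lambda>_. c) = c"
  by (induction k) simp_all

lemma sign_sum_mean_sum: "finite X \<Longrightarrow> sign_sum_mean xs k (\<lambda>S. \<Sum>x\<in>X. F x S) = (\<Sum>x\<in>X. sign_sum_mean xs k (F x))"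
  by (induction X rule: finite_induct) (simp_all add: sign_sum_mean_add)

lemma sign_mean_sign_sum_mean_swap:
  "sign_mean xs (\<lambda>g. sign_sum_mean xs k (\<lambda>S. F g S)) = sign_sum_mean xs k (\<lambda>S. sign_mean xs (\<lambda>g. F g S))"
proof (induction k arbitrary: F)
  case (Suc k)
  show ?case
    by (simp, subst sign_mean_swap) (simp add: Suc.IH)
qed simp

text \<open>\<open>W\<close> is general because it carries the induction: vectors already chosen
  enter it as fixed deviations, those still random as twice a pairing. Each vector is chosen no
  worse than the mean, and then it is part of the new \<open>W\<close>.\<close>

lemma ex_signs_deviation:
  fixes W :: "'z \<Rightarrow> real" and L :: "'z \<Rightarrow> 'i \<Rightarrow> real" and xs :: "'i list"
  assumes T: "T \<noteq> {}" and W: "bdd_above (W ` T)" and L: "\<And>z i. z \<in> T \<Longrightarrow> \<bar>L z i\<bar> \<le> B"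
  defines "h \<equiv> \<lambda>z. sign_mean xs (\<lambda>g. \<bar>pairing xs g (L z)\<bar>)"
  shows "\<exists>G :: nat \<Rightarrow> 'i \<Rightarrow> real. \<forall>z\<in>T. W z + (\<Sum>i<k. h z - \<bar>pairing xs (G i) (L z)\<bar>)
    \<le> sign_sum_mean xs k (\<lambda>S. SUP z\<in>T. W z + 2 * pairing xs S (L z))"
  using W
proof (induction k arbitrary: W)
  case 0
  then show ?case by (auto intro: cSUP_upper)
next
  case (Suc k)
  have h: "h z \<le> (\<Sum>i\<in>set xs. B)" if "z \<in> T" for z
  proof -
    have "h z \<le> sign_mean xs (\<lambda>g. \<Sum>i\<in>set xs. B)"
      unfolding h_def
    proof (rule sign_mean_mono)
      fix g :: "'i \<Rightarrow> real" assume g: "\<And>i. \<bar>g i\<bar> \<le> 1"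
      have "\<bar>pairing xs g (L z)\<bar> \<le> (\<Sum>i\<in>set xs. \<bar>g i * L z i\<bar>)" by (rule sum_abs)
      also have "\<dots> \<le> (\<Sum>i\<in>set xs. B)"
      proof (rule sum_mono)
        fix i
        have "\<bar>g i\<bar> * \<bar>L z i\<bar> \<le> 1 * B" using g[of i] L[OF that, of i] by (intro mult_mono) auto
        then show "\<bar>g i * L z i\<bar> \<le> B" by (simp add: abs_mult)
      qed
      finally show "\<bar>pairing xs g (L z)\<bar> \<le> (\<Sum>i\<in>set xs. B)" .
    qed
    then show ?thesis by simp
  qed
  obtain w where w: "\<And>z. z \<in> T \<Longrightarrow> W z \<le> w" using Suc.prems by (auto simp: bdd_above_def)
  have bS: "bdd_above ((\<lambda>z. W z + 2 * pairing xs S (L z)) ` T)" for S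
  proof (rule bdd_aboveI2)
    fix z assume z: "z \<in> T"
    have "pairing xs S (L z) \<le> (\<Sum>i\<in>set xs. \<bar>S i\<bar> * B)"
    proof (rule sum_mono)
      fix i
      have "S i * L z i \<le> \<bar>S i\<bar> * \<bar>L z i\<bar>" by (simp add: abs_mult[symmetric])
      also have "\<dots> \<le> \<bar>S i\<bar> * B" using L[OF z] by (intro mult_left_mono) auto
      finally show "S i * L z i \<le> \<bar>S i\<bar> * B" .
    qed
    then show "W z + 2 * pairing xs S (L z) \<le> w + 2 * (\<Sum>i\<in>set xs. \<bar>S i\<bar> * B)"
      using w[OF z] by linarith
  qed
  define W' where "W' g z = W z + h z - \<bar>pairing xs g (L z)\<bar>" for g z
  define F where "F g = sign_sum_mean xs k (\<lambda>S. SUP z\<in>T. W' g z + 2 * pairing xs S (L z))" for g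
  have bW': "bdd_above (W' g ` T)" for g
    by (rule bdd_aboveI2[of _ _ "w + (\<Sum>i\<in>set xs. B)"]) (use w h in \<open>smt (verit) W'_def\<close>)
  obtain g where g: "F g \<le> sign_mean xs F" using sign_mean_ex by blast
  obtain G where G: "\<forall>z\<in>T. W' g z + (\<Sum>i<k. h z - \<bar>pairing xs (G i) (L z)\<bar>) \<le> F g"
    using Suc.IH[OF bW'[of g]] unfolding F_def by blast
  have "sign_mean xs F = sign_sum_mean xs k (\<lambda>S. sign_mean xs (\<lambda>g. SUP z\<in>T. W' g z + 2 * pairing xs S (L z)))"
    unfolding F_def by (rule sign_mean_sign_sum_mean_swap)
  \<comment> \<open>The means were swapped so that \<open>S\<close> can be frozen:
    \<open>contraction_step\<close> then exchanges the deviation of \<open>g\<close> for twice its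
    pairing, with the contribution of \<open>S\<close> counted in \<open>W\<close>.\<close>
  also have "\<dots> \<le> sign_sum_mean xs k (\<lambda>S. sign_mean xs (\<lambda>g. SUP z\<in>T. (W z + 2 * pairing xs S (L z)) + 2 * pairing xs g (L z)))"
  proof (rule sign_sum_mean_mono)
    fix S
    show "sign_mean xs (\<lambda>g. SUP z\<in>T. W' g z + 2 * pairing xs S (L z))
      \<le> sign_mean xs (\<lambda>g. SUP z\<in>T. (W z + 2 * pairing xs S (L z)) + 2 * pairing xs g (L z))"
      using contraction_step[where T = T and W = "\<lambda>z. W z + 2 * pairing xs S (L z)" and L = L and B = B
          and xs = xs, OF T bS L]
      by (simp add: W'_def h_def algebra_simps)
  qed
  also have "\<dots> = sign_sum_mean xs (Suc k) (\<lambda>S. SUP z\<in>T. W z + 2 * pairing xs S (L z))"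
    by (simp add: sign_mean_sign_sum_mean_swap algebra_simps sum.distrib sum_distrib_left)
  finally have fin: "sign_mean xs F \<le> sign_sum_mean xs (Suc k) (\<lambda>S. SUP z\<in>T. W z + 2 * pairing xs S (L z))" .
  show ?case
  proof (intro exI[of _ "\<lambda>i. case i of 0 \<Rightarrow> g | Suc j \<Rightarrow> G j"] ballI)
    fix z assume z: "z \<in> T"
    have "W z + (\<Sum>i<Suc k. h z - \<bar>pairing xs (case i of 0 \<Rightarrow> g | Suc j \<Rightarrow> G j) (L z)\<bar>)
       = W' g z + (\<Sum>i<k. h z - \<bar>pairing xs (G i) (L z)\<bar>)"
      by (subst sum.lessThan_Suc_shift) (simp add: W'_def)
    also have "\<dots> \<le> F g" using G z by blast
    finally show "W z + (\<Sum>i<Suc k. h z - \<bar>pairing xs (case i of 0 \<Rightarrow> g | Suc j \<Rightarrow> G j) (L z)\<bar>)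
      \<le> sign_sum_mean xs (Suc k) (\<lambda>S. SUP z\<in>T. W z + 2 * pairing xs S (L z))"
      using g fin by linarith
  qed
qed

section \<open>Exponential moments and suprema over an l1 ball\<close>

lemma cosh_le_exp_half_square: "(exp x + exp (- x)) / 2 \<le> exp (x\<^sup>2 / 2)" for x :: real
proof -
  have e: "(\<lambda>n. x ^ n / fact n) sums exp x" for x :: real
    using exp_converges[of x] unfolding real_scaleR_def by (simp only: divide_inverse_commute)
  have 1: "(\<lambda>n. (x ^ n / fact n + (- x) ^ n / fact n) / 2) sums ((exp x + exp (- x)) / 2)"
    by (intro sums_divide sums_add e)
  have 2: "(x ^ n / fact n + (- x) ^ n / fact n) / 2 = 0" if "n \<notin> range (\<lambda>n. 2 * n)" for n
  proof -
    have "odd n" using that by (auto elim!: evenE)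
    then show ?thesis by simp
  qed
  have "strict_mono (\<lambda>n::nat. 2 * n)" by (simp add: strict_mono_def)
  from sums_mono_reindex[where f = "\<lambda>n. (x ^ n / fact n + (- x) ^ n / fact n) / 2", OF this 2] 1
  have "(\<lambda>n. x ^ (2 * n) / fact (2 * n)) sums ((exp x + exp (- x)) / 2)"
    by simp
  moreover note e[of "x\<^sup>2 / 2"]
  moreover have "x ^ (2 * n) / fact (2 * n) \<le> (x\<^sup>2 / 2) ^ n / fact n" for n
  proof -
    \<comment> \<open>Both sides of the claim are power series in x^2; this inequality compares
      their coefficients.\<close>
    have f: "2 ^ n * fact n \<le> (fact (2 * n) :: real)"
    proof (induction n)
      case (Suc n)
      have "2 ^ Suc n * fact (Suc n) = (2 * real (Suc n)) * (2 ^ n * fact n)" by simp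
      also have "\<dots> \<le> (real (2 * n + 2) * real (2 * n + 1)) * fact (2 * n)"
        using Suc by (intro mult_mono) auto
      also have "\<dots> = fact (2 * Suc n)" by (simp add: algebra_simps)
      finally show ?case .
    qed simp
    have "x ^ (2 * n) / fact (2 * n) \<le> x ^ (2 * n) / (2 ^ n * fact n)"
      by (intro divide_left_mono f) (auto simp: power_mult)
    then show ?thesis by (simp add: power_mult power_divide)
  qed
  ultimately show ?thesis by (rule sums_le[rotated])
qed

lemma sign_mean_exp:
  "distinct xs \<Longrightarrow> sign_mean xs (\<lambda>g. exp (pairing xs g v)) \<le> exp ((\<Sum>i\<in>set xs. (v i)\<^sup>2) / 2)"
proof (induction xs)
  case (Cons i xs)
  have "sign_mean (i # xs) (\<lambda>g. exp (pairing (i # xs) g v)) =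
    sign_mean xs (\<lambda>g. (exp (v i) + exp (- v i)) / 2 * exp (pairing xs g v))"
    unfolding sign_mean_Cons pairing_Cons[OF Cons.prems] exp_add
    by (intro arg_cong[of _ _ "sign_mean xs"] ext) (simp add: field_simps)
  also have "\<dots> = (exp (v i) + exp (- v i)) / 2 * sign_mean xs (\<lambda>g. exp (pairing xs g v))"
    by (rule sign_mean_cmult)
  also have "\<dots> \<le> exp ((v i)\<^sup>2 / 2) * exp ((\<Sum>i\<in>set xs. (v i)\<^sup>2) / 2)"
    using Cons sign_mean_mono[of "\<lambda>_. 0" "\<lambda>g. exp (pairing xs g v)" xs]
    by (intro mult_mono cosh_le_exp_half_square) auto
  also have "\<dots> = exp ((\<Sum>i\<in>set (i # xs). (v i)\<^sup>2) / 2)"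
    using Cons.prems by (simp add: exp_add[symmetric] add_divide_distrib)
  finally show ?case .
qed simp

lemma sign_sum_mean_exp:
  assumes "distinct xs"
  shows "sign_sum_mean xs k (\<lambda>S. exp (pairing xs S v)) \<le> exp (real k * (\<Sum>i\<in>set xs. (v i)\<^sup>2) / 2)"
proof (induction k)
  case (Suc k)
  let ?s = "\<Sum>i\<in>set xs. (v i)\<^sup>2"
  have "sign_sum_mean xs (Suc k) (\<lambda>S. exp (pairing xs S v)) =
     sign_mean xs (\<lambda>g. sign_sum_mean xs k (\<lambda>S. exp (pairing xs g v) * exp (pairing xs S v)))"
    by (simp add: sum.distrib distrib_right exp_add[symmetric] add.commute)
  also have "\<dots> = sign_mean xs (\<lambda>g. sign_sum_mean xs k (\<lambda>S. exp (pairing xs S v)) * exp (pairing xs g v))"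
    by (simp add: sign_sum_mean_cmult mult.commute)
  also have "\<dots> = sign_sum_mean xs k (\<lambda>S. exp (pairing xs S v)) * sign_mean xs (\<lambda>g. exp (pairing xs g v))"
    by (rule sign_mean_cmult)
  also have "\<dots> \<le> exp (real k * ?s / 2) * exp (?s / 2)"
    using Suc sign_mean_exp[OF assms, of v] sign_mean_mono[of "\<lambda>_. 0" "\<lambda>g. exp (pairing xs g v)" xs]
    by (intro mult_mono) auto
  also have "\<dots> = exp (real (Suc k) * ?s / 2)"
    by (simp add: exp_add[symmetric] field_simps)
  finally show ?case .
qed simp

text \<open>On the l1 ball a linear form is at most its largest modulus over the points
  \<open>a x\<close>. Twice \<open>card X\<close> exponentials majorize that maximum, and their
  sub-Gaussian means give the square root of a logarithm.\<close>

lemma sign_sum_mean_SUP_le: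
  fixes a :: "'x \<Rightarrow> 'i \<Rightarrow> real"
  assumes xs: "distinct xs" and X: "finite X" "X \<noteq> {}" and M: "M > 0" and k: "k > 0"
    and a: "\<And>x. x \<in> X \<Longrightarrow> (\<Sum>i\<in>set xs. (a x i)\<^sup>2) \<le> M"
  shows "sign_sum_mean xs k (\<lambda>S. SUP z\<in>{z. (\<Sum>x\<in>X. \<bar>z x\<bar>) \<le> 1}. 2 * pairing xs S (\<lambda>i. \<Sum>x\<in>X. z x * a x i))
    \<le> 2 * sqrt (2 * real k * M * ln (2 * real (card X)))"
proof -
  define K where "K = 2 * real (card X)"
  have "card X \<ge> 1" using X by (simp add: Suc_leI card_gt_0_iff)
  then have K: "K \<ge> 2" by (simp add: K_def)
  then have lnK: "ln K > 0" by simp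
  \<comment> \<open>The optimal parameter: it makes the two terms of \<open>ln Y0\<close> equal, so
    \<open>ln Y0 = 2 * ln K\<close>.\<close>
  define l where "l = sqrt (2 * ln K / (real k * M))"
  have l: "l > 0" "l\<^sup>2 = 2 * ln K / (real k * M)" using lnK M k by (auto simp: l_def)
  define Y where "Y S = (\<Sum>x\<in>X. exp (pairing xs S (\<lambda>i. l * a x i)) + exp (pairing xs S (\<lambda>i. - l * a x i)))" for S
  define Y0 where "Y0 = K * exp (l\<^sup>2 * (real k * M) / 2)"
  have Y0: "Y0 > 0" using K by (simp add: Y0_def)
  have lnY0: "ln Y0 = ln K + l\<^sup>2 * (real k * M) / 2" using K by (simp add: Y0_def ln_mult)
  have bound: "sign_sum_mean xs k (\<lambda>S. exp (pairing xs S (\<lambda>i. c * a x i))) \<le> exp (l\<^sup>2 * (real k * M) / 2)"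
    if "x \<in> X" "c\<^sup>2 = l\<^sup>2" for x c
  proof -
    have "sign_sum_mean xs k (\<lambda>S. exp (pairing xs S (\<lambda>i. c * a x i)))
      \<le> exp (real k * (\<Sum>i\<in>set xs. (c * a x i)\<^sup>2) / 2)"
      by (rule sign_sum_mean_exp[OF xs])
    also have "(\<Sum>i\<in>set xs. (c * a x i)\<^sup>2) = l\<^sup>2 * (\<Sum>i\<in>set xs. (a x i)\<^sup>2)"
      by (simp add: power_mult_distrib that(2) sum_distrib_left)
    also have "exp (real k * (l\<^sup>2 * (\<Sum>i\<in>set xs. (a x i)\<^sup>2)) / 2) \<le> exp (real k * (l\<^sup>2 * M) / 2)"
      using a[OF that(1)] by (auto intro!: mult_left_mono divide_right_mono)
    finally show ?thesis by (simp add: algebra_simps)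
  qed
  have "sign_sum_mean xs k Y = (\<Sum>x\<in>X. sign_sum_mean xs k (\<lambda>S. exp (pairing xs S (\<lambda>i. l * a x i)))
     + sign_sum_mean xs k (\<lambda>S. exp (pairing xs S (\<lambda>i. - l * a x i))))"
    unfolding Y_def by (simp only: sign_sum_mean_sum[OF X(1)] sign_sum_mean_add)
  also have "\<dots> \<le> (\<Sum>x\<in>X. exp (l\<^sup>2 * (real k * M) / 2) + exp (l\<^sup>2 * (real k * M) / 2))"
    by (intro sum_mono add_mono bound) auto
  also have "\<dots> = Y0" by (simp add: Y0_def K_def)
  finally have EY: "sign_sum_mean xs k Y \<le> Y0" .
  \<comment> \<open>Jensen's inequality for the logarithm in the form of its tangent at
    \<open>Y0\<close>: the bound is affine in \<open>Y S\<close>, hence compatible with linear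
    means.\<close>
  have pt: "(SUP z\<in>{z. (\<Sum>x\<in>X. \<bar>z x\<bar>) \<le> 1}. 2 * pairing xs S (\<lambda>i. \<Sum>x\<in>X. z x * a x i))
    \<le> 2 / l * (ln Y0 - 1) + 2 / l / Y0 * Y S" for S
  proof (rule cSUP_least)
    show "{z :: 'x \<Rightarrow> real. (\<Sum>x\<in>X. \<bar>z x\<bar>) \<le> 1} \<noteq> {}"
      by (rule ex_in_conv[THEN iffD1], rule exI[of _ "\<lambda>_. 0"]) simp
    fix z :: "'x \<Rightarrow> real" assume "z \<in> {z. (\<Sum>x\<in>X. \<bar>z x\<bar>) \<le> 1}"
    then have z: "(\<Sum>x\<in>X. \<bar>z x\<bar>) \<le> 1" by simp
    define p where "p x = pairing xs S (a x)" for x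
    have pos: "0 < exp (l * p x) + exp (- (l * p x))" for x by (simp add: add_pos_pos)
    have YS: "Y S = (\<Sum>x\<in>X. exp (l * p x) + exp (- (l * p x)))"
      by (simp add: Y_def p_def sum_distrib_left sum_negf mult_ac)
    then have Ypos: "Y S > 0" using pos X by (simp add: sum_pos)
    have pY: "\<bar>p x\<bar> \<le> ln (Y S) / l" if "x \<in> X" for x
    proof -
      have "exp (l * \<bar>p x\<bar>) \<le> exp (l * p x) + exp (- (l * p x))"
        by (cases "p x \<ge> 0") (auto simp: less_imp_le)
      also have "\<dots> \<le> Y S" unfolding YS using that X(1) pos less_imp_le by (intro member_le_sum) auto
      finally have "l * \<bar>p x\<bar> \<le> ln (Y S)" using Ypos by (simp add: ln_ge_iff)
      then show ?thesis using l(1) by (simp add: field_simps)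
    qed
    obtain x0 where x0: "x0 \<in> X" using X by blast
    have nn: "0 \<le> ln (Y S) / l" using pY[OF x0] by linarith
    have "pairing xs S (\<lambda>i. \<Sum>x\<in>X. z x * a x i) = (\<Sum>x\<in>X. z x * p x)"
      unfolding p_def sum_distrib_left by (subst sum.swap) (simp add: mult_ac)
    also have "\<dots> \<le> (\<Sum>x\<in>X. \<bar>z x\<bar> * (ln (Y S) / l))"
    proof (rule sum_mono)
      fix x assume x: "x \<in> X"
      have "z x * p x \<le> \<bar>z x\<bar> * \<bar>p x\<bar>" by (simp add: abs_mult[symmetric])
      also have "\<dots> \<le> \<bar>z x\<bar> * (ln (Y S) / l)" using pY[OF x] by (intro mult_left_mono) auto
      finally show "z x * p x \<le> \<bar>z x\<bar> * (ln (Y S) / l)" .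
    qed
    also have "\<dots> = (\<Sum>x\<in>X. \<bar>z x\<bar>) * (ln (Y S) / l)" by (simp only: sum_distrib_right)
    also have "\<dots> \<le> 1 * (ln (Y S) / l)" using z nn by (intro mult_right_mono) auto
    finally have 1: "pairing xs S (\<lambda>i. \<Sum>x\<in>X. z x * a x i) \<le> ln (Y S) / l" by simp
    have "ln (Y S) = ln (Y S / Y0) + ln Y0" using Ypos Y0 by (simp add: ln_div)
    also have "\<dots> \<le> (Y S / Y0 - 1) + ln Y0" using Ypos Y0 by (intro add_right_mono ln_le_minus_one) auto
    finally have "ln (Y S) / l \<le> (Y S / Y0 - 1 + ln Y0) / l" using l(1) by (intro divide_right_mono) auto
    then have "2 * pairing xs S (\<lambda>i. \<Sum>x\<in>X. z x * a x i) \<le> 2 * ((Y S / Y0 - 1 + ln Y0) / l)"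
      using 1 by linarith
    also have "\<dots> = 2 / l * (ln Y0 - 1) + 2 / l / Y0 * Y S"
      using l(1) Y0 by (simp add: field_simps)
    finally show "2 * pairing xs S (\<lambda>i. \<Sum>x\<in>X. z x * a x i) \<le> 2 / l * (ln Y0 - 1) + 2 / l / Y0 * Y S" .
  qed
  have "sign_sum_mean xs k (\<lambda>S. SUP z\<in>{z. (\<Sum>x\<in>X. \<bar>z x\<bar>) \<le> 1}. 2 * pairing xs S (\<lambda>i. \<Sum>x\<in>X. z x * a x i))
    \<le> sign_sum_mean xs k (\<lambda>S. 2 / l * (ln Y0 - 1) + 2 / l / Y0 * Y S)"
    by (rule sign_sum_mean_mono[OF pt])
  also have "\<dots> = 2 / l * (ln Y0 - 1) + 2 / l / Y0 * sign_sum_mean xs k Y"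
    by (simp only: sign_sum_mean_add sign_sum_mean_cmult sign_sum_mean_const)
  also have "\<dots> \<le> 2 / l * (ln Y0 - 1) + 2 / l / Y0 * Y0"
    using EY l Y0 by (intro add_left_mono mult_left_mono) auto
  also have "\<dots> = 2 * (ln Y0 / l)" using Y0 l by (simp add: field_simps)
  also have "ln Y0 = 2 * ln K" using M k by (simp add: lnY0 l(2))
  also have "2 * ln K / l = sqrt (2 * real k * M * ln K)"
  proof (rule real_sqrt_unique[symmetric])
    have "(2 * ln K / l)\<^sup>2 = (2 * ln K)\<^sup>2 / l\<^sup>2" by (simp add: power_divide)
    also have "\<dots> = 2 * real k * M * ln K" unfolding l(2) using M k lnK by (simp add: power2_eq_square field_simps)
    finally show "(2 * ln K / l)\<^sup>2 = 2 * real k * M * ln K" .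
    show "0 \<le> 2 * ln K / l" using lnK l by simp
  qed
  finally show ?thesis by (simp add: K_def)
qed

abbreviation width_rate :: "real \<Rightarrow> nat \<Rightarrow> nat \<Rightarrow> real" where
  "width_rate M N m \<equiv> sqrt (M * ln (2 * real N) / real m)"

text \<open>
  The low \<open>M\<^sup>*\<close> estimate for the absolutely convex hull of the vectors \<open>a x\<close>.
\<close>

lemma ex_small_section:
  fixes a :: "'x \<Rightarrow> 'i \<Rightarrow> real"
  assumes I: "finite I" and X: "finite X" "X \<noteq> {}" and M: "M > 0" and k: "k > 0"
    and a: "\<And>x. x \<in> X \<Longrightarrow> (\<Sum>i\<in>I. (a x i)\<^sup>2) \<le> M"
  obtains G :: "nat \<Rightarrow> 'i \<Rightarrow> real" where
    "\<And>z. (\<And>j. j < k \<Longrightarrow> (\<Sum>x\<in>X. z x * (\<Sum>i\<in>I. G j i * a x i)) = 0) \<Longrightarrow>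
      sqrt (\<Sum>i\<in>I. (\<Sum>x\<in>X. z x * a x i)\<^sup>2)
        \<le> 15 * width_rate M (card X) k * (\<Sum>x\<in>X. \<bar>z x\<bar>)"
proof -
  obtain xs where xs: "set xs = I" "distinct xs" using finite_distinct_list[OF I] by blast
  define T where "T = {z :: 'x \<Rightarrow> real. (\<Sum>x\<in>X. \<bar>z x\<bar>) \<le> 1}"
  \<comment> \<open>The value 0 outside \<open>I\<close> makes the bound by sqrt M hold at every
    index, as \<open>ex_signs_deviation\<close> requires.\<close>
  define L where "L z i = (if i \<in> I then \<Sum>x\<in>X. z x * a x i else 0)" for z i
  have T: "T \<noteq> {}"
    unfolding T_def by (rule ex_in_conv[THEN iffD1], rule exI[of _ "\<lambda>_. 0"]) simp
  have Lb: "\<bar>L z i\<bar> \<le> sqrt M" if "z \<in> T" for z i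
  proof (cases "i \<in> I")
    case True
    have ab: "\<bar>a x i\<bar> \<le> sqrt M" if "x \<in> X" for x
    proof -
      have "(a x i)\<^sup>2 \<le> (\<Sum>i\<in>I. (a x i)\<^sup>2)" using True I by (intro member_le_sum) auto
      also have "\<dots> \<le> M" by (rule a[OF that])
      finally show ?thesis by (simp add: real_le_rsqrt)
    qed
    have "\<bar>L z i\<bar> \<le> (\<Sum>x\<in>X. \<bar>z x * a x i\<bar>)" using True by (simp add: L_def sum_abs)
    also have "\<dots> \<le> (\<Sum>x\<in>X. \<bar>z x\<bar> * sqrt M)"
      by (intro sum_mono) (auto simp: abs_mult intro!: mult_left_mono ab)
    also have "\<dots> = (\<Sum>x\<in>X. \<bar>z x\<bar>) * sqrt M" by (simp add: sum_distrib_right)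
    also have "\<dots> \<le> 1 * sqrt M" using that M by (intro mult_right_mono) (auto simp: T_def)
    finally show ?thesis by simp
  qed (use M in \<open>simp add: L_def\<close>)
  define h where "h z = sign_mean xs (\<lambda>g. \<bar>pairing xs g (L z)\<bar>)" for z
  have pL: "pairing xs g (L z) = pairing xs g (\<lambda>i. \<Sum>x\<in>X. z x * a x i)" for g z
    by (intro sum.cong) (auto simp: L_def xs)
  obtain G where G: "\<forall>z\<in>T. 0 + (\<Sum>i<k. h z - \<bar>pairing xs (G i) (L z)\<bar>)
    \<le> sign_sum_mean xs k (\<lambda>S. SUP z\<in>T. 0 + 2 * pairing xs S (L z))"
    using ex_signs_deviation[where W = "\<lambda>_. 0" and L = L and B = "sqrt M" and xs = xs and k = k, OF T bdd_aboveI2[of _ _ 0] Lb]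
    unfolding h_def by blast
  have D: "sign_sum_mean xs k (\<lambda>S. SUP z\<in>T. 0 + 2 * pairing xs S (L z))
    \<le> 2 * sqrt (2 * real k * M * ln (2 * real (card X)))"
    using sign_sum_mean_SUP_le[OF xs(2) X M k, of a] a by (simp only: pL) (simp add: T_def xs)
  have card: "card X \<ge> 1" using X by (simp add: Suc_leI card_gt_0_iff)
  then have ln0: "ln (2 * real (card X)) \<ge> 0" by simp
  show thesis
  proof
    fix z assume ker: "\<And>j. j < k \<Longrightarrow> (\<Sum>x\<in>X. z x * (\<Sum>i\<in>I. G j i * a x i)) = 0"
    define N where "N = (\<Sum>x\<in>X. \<bar>z x\<bar>)"
    show "sqrt (\<Sum>i\<in>I. (\<Sum>x\<in>X. z x * a x i)\<^sup>2)
        \<le> 15 * width_rate M (card X) k * (\<Sum>x\<in>X. \<bar>z x\<bar>)"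
    proof (cases "N = 0")
      case True
      then have "\<And>x. x \<in> X \<Longrightarrow> z x = 0" using X(1) by (simp add: N_def sum_nonneg_eq_0_iff)
      then show ?thesis by simp
    next
      case False
      then have N: "N > 0" by (simp add: N_def sum_nonneg order_less_le)
      define y where "y x = z x / N" for x
      have "(\<Sum>x\<in>X. \<bar>y x\<bar>) = N / N" using N by (simp add: y_def N_def sum_divide_distrib[symmetric])
      then have yT: "y \<in> T" using N by (simp add: T_def)
      have "pairing xs (G j) (L y) = 0" if "j < k" for j
      proof -
        have "pairing xs (G j) (L y) = (\<Sum>x\<in>X. z x * (\<Sum>i\<in>I. G j i * a x i)) / N"
          unfolding pL unfolding y_def xs sum_distrib_left sum_divide_distrib
          by (subst sum.swap) (simp add: mult_ac)
        then show ?thesis using ker[OF that] by simp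
      qed
      \<comment> \<open>All k pairings vanish at \<open>y\<close>, so the sum of deviations is k
        times the mean, with nothing subtracted.\<close>
      then have "real k * h y \<le> 2 * sqrt (2 * real k * M * ln (2 * real (card X)))"
        using bspec[OF G yT] D by simp
      then have "h y \<le> 2 * sqrt (2 * real k * M * ln (2 * real (card X))) / real k"
        using k by (simp add: field_simps)
      also have "\<dots> = 2 * sqrt 2 * (sqrt (M * ln (2 * real (card X))) * (sqrt (real k) / real k))"
        by (simp add: real_sqrt_mult)
      also have "sqrt (real k) / real k = 1 / sqrt (real k)"
        using k by (simp add: field_simps)
      finally have hy: "h y \<le> 2 * sqrt 2 * width_rate M (card X) k"
        by (simp add: real_sqrt_divide)
      \<comment> \<open>The constant 15 is the Khinchine constant 5 times 3, a bound for 2 sqrt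
        2.\<close>
      have "sqrt 2 \<le> sqrt ((3/2)\<^sup>2)" by (intro real_sqrt_le_mono) (simp add: power2_eq_square)
      then have "5 * (2 * sqrt 2 * width_rate M (card X) k)
         \<le> 15 * width_rate M (card X) k"
        using mult_right_mono[of "2 * sqrt 2" 3 "width_rate M (card X) k"] M ln0 by simp
      then have hy': "5 * h y \<le> 15 * width_rate M (card X) k" using hy by linarith
      have "sqrt (\<Sum>i\<in>I. (\<Sum>x\<in>X. z x * a x i)\<^sup>2) = N * sqrt (\<Sum>i\<in>I. (L y i)\<^sup>2)"
      proof -
        have "(\<Sum>i\<in>I. (\<Sum>x\<in>X. z x * a x i)\<^sup>2) = (\<Sum>i\<in>I. N\<^sup>2 * (L y i)\<^sup>2)"
        proof (rule sum.cong)
          fix i assume "i \<in> I"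
          then have "(\<Sum>x\<in>X. z x * a x i) = N * L y i"
            using N by (simp add: L_def y_def sum_distrib_left)
          then show "(\<Sum>x\<in>X. z x * a x i)\<^sup>2 = N\<^sup>2 * (L y i)\<^sup>2" by (simp add: power_mult_distrib)
        qed simp
        then show ?thesis using N by (simp add: sum_distrib_left[symmetric] real_sqrt_mult)
      qed
      also have "\<dots> \<le> N * (5 * h y)"
        using khinchine[OF xs(2), of "L y"] N by (intro mult_left_mono) (auto simp: h_def xs)
      also have "\<dots> \<le> N * (15 * width_rate M (card X) k)"
        using hy' N by (intro mult_left_mono) auto
      finally show ?thesis by (simp add: N_def mult_ac)
    qed
  qed
qed

section \<open>Widths of Euclidean balls in the uniform norm\<close>

text \<open>A pair \<open>(u, b)\<close> encodes the inequality "sum of c_j u_j is at most b" in the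
  unknowns c. The rules generate its consequences by nonnegative combinations, so a pair with u = 0
  and b < 0 would witness inconsistency.\<close>

inductive_set cone_hull :: "((nat \<Rightarrow> real) \<times> real) set \<Rightarrow> ((nat \<Rightarrow> real) \<times> real) set"
  for S where
  base: "s \<in> S \<Longrightarrow> s \<in> cone_hull S"
| add: "(u, b) \<in> cone_hull S \<Longrightarrow> (v, c) \<in> cone_hull S \<Longrightarrow> ((\<lambda>j. u j + v j), b + c) \<in> cone_hull S"
| scale: "(u, b) \<in> cone_hull S \<Longrightarrow> l \<ge> 0 \<Longrightarrow> ((\<lambda>j. l * u j), l * b) \<in> cone_hull S"

lemma cone_hull_subset:
  assumes "S' \<subseteq> cone_hull S"
  shows "cone_hull S' \<subseteq> cone_hull S"
proof
  fix s assume "s \<in> cone_hull S'"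
  then show "s \<in> cone_hull S"
    by (induction rule: cone_hull.induct) (use assms in \<open>auto intro: cone_hull.intros\<close>)
qed

text \<open>The induction step is Fourier--Motzkin elimination of the last unknown.\<close>

lemma farkas:
  assumes "finite S"
    and "\<And>u b. (u, b) \<in> cone_hull S \<Longrightarrow> (\<And>j. j < m \<Longrightarrow> u j = 0) \<Longrightarrow> 0 \<le> b"
  shows "\<exists>c :: nat \<Rightarrow> real. \<forall>(u, b)\<in>S. (\<Sum>j<m. c j * u j) \<le> b"
  using assms
proof (induction m arbitrary: S)
  case 0
  then show ?case by (auto intro: cone_hull.base)
next
  case (Suc m)
  define P where "P = {s \<in> S. fst s m > 0}"
  define N where "N = {s \<in> S. fst s m < 0}"
  define Z where "Z = {s \<in> S. fst s m = 0}"
  \<comment> \<open>\<open>s\<close> bounds the last unknown from above and \<open>t\<close> from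
    below. The weights are positive and chosen so that the coefficient of that unknown
    cancels.\<close>
  define mix where "mix s t = ((\<lambda>j. fst s m * fst t j + (- fst t m) * fst s j),
     fst s m * snd t + (- fst t m) * snd s)" for s t :: "(nat \<Rightarrow> real) \<times> real"
  define S' where "S' = Z \<union> (\<lambda>(s, t). mix s t) ` (P \<times> N)"
  have fin: "finite P" "finite N" "finite Z" using Suc.prems(1) by (auto simp: P_def N_def Z_def)
  then have finS': "finite S'" by (simp add: S'_def)
  have sub: "S' \<subseteq> cone_hull S"
  proof
    fix x assume "x \<in> S'"
    then consider "x \<in> Z" | s t where "s \<in> P" "t \<in> N" "x = mix s t" by (auto simp: S'_def)
    then show "x \<in> cone_hull S"
    proof cases
      case 1
      then show ?thesis by (auto simp: Z_def intro: cone_hull.base)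
    next
      case 2
      have "(fst s, snd s) \<in> cone_hull S" "(fst t, snd t) \<in> cone_hull S"
        using 2 by (auto simp: P_def N_def intro: cone_hull.base)
      then show ?thesis
        unfolding 2(3) mix_def using 2 by (intro cone_hull.add cone_hull.scale) (auto simp: P_def N_def)
    qed
  qed
  have zero: "u m = 0" if "(u, b) \<in> cone_hull S'" for u b
  proof -
    have "fst s m = 0" if "s \<in> cone_hull S'" for s
      using that
    proof (induction rule: cone_hull.induct)
      case (base s)
      then show ?case by (auto simp: S'_def Z_def mix_def)
    qed auto
    from this[OF that] show ?thesis by simp
  qed
  have "\<exists>c :: nat \<Rightarrow> real. \<forall>(u, b)\<in>S'. (\<Sum>j<m. c j * u j) \<le> b"
  proof (rule Suc.IH[OF finS'])
    fix u b assume ub: "(u, b) \<in> cone_hull S'" "\<And>j. j < m \<Longrightarrow> u j = 0"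
    have "(u, b) \<in> cone_hull S" using ub(1) cone_hull_subset[OF sub] by blast
    then show "0 \<le> b"
      using Suc.prems(2) ub zero[OF ub(1)] by (metis less_antisym)
  qed
  then obtain c where c: "\<And>u b. (u, b) \<in> S' \<Longrightarrow> (\<Sum>j<m. c j * u j) \<le> b" by blast
  \<comment> \<open>The bound that \<open>s\<close> imposes on the last unknown once the others are
    fixed as \<open>c\<close>: an upper bound for \<open>s\<close> in \<open>P\<close>, a lower one
    for \<open>s\<close> in \<open>N\<close>.\<close>
  define r where "r s = (snd s - (\<Sum>j<m. c j * fst s j)) / fst s m" for s :: "(nat \<Rightarrow> real) \<times> real"
  have NP: "r t \<le> r s" if "s \<in> P" "t \<in> N" for s t
  proof -
    have pos: "fst s m > 0" "fst t m < 0" using that by (auto simp: P_def N_def)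
    have "mix s t \<in> S'" using that by (auto simp: S'_def)
    then have "(\<Sum>j<m. c j * (fst s m * fst t j + (- fst t m) * fst s j)) \<le> fst s m * snd t + (- fst t m) * snd s"
      unfolding mix_def by (rule c)
    moreover have "(\<Sum>j<m. c j * (fst s m * fst t j + (- fst t m) * fst s j)) =
      fst s m * (\<Sum>j<m. c j * fst t j) + (- fst t m) * (\<Sum>j<m. c j * fst s j)"
      unfolding sum_distrib_left sum.distrib[symmetric] by (intro sum.cong refl) (simp add: algebra_simps)
    ultimately have "0 \<le> fst s m * (snd t - (\<Sum>j<m. c j * fst t j)) + (- fst t m) * (snd s - (\<Sum>j<m. c j * fst s j))"
      by (simp add: algebra_simps)
    moreover have "snd t - (\<Sum>j<m. c j * fst t j) = fst t m * r t" "snd s - (\<Sum>j<m. c j * fst s j) = fst s m * r s"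
      using pos by (auto simp: r_def)
    ultimately have "0 \<le> (fst s m * (- fst t m)) * (r s - r t)" by (simp add: algebra_simps)
    moreover have "0 < fst s m * (- fst t m)" using pos by (simp add: mult_pos_neg)
    moreover have "0 \<le> y" if "0 \<le> x * y" "0 < x" for x y :: real
      using that by (simp add: zero_le_mult_iff)
    ultimately show ?thesis by (metis diff_ge_0_iff_ge)
  qed
  \<comment> \<open>Lower bounds lie below upper bounds, so the smallest upper bound serves, or the
    largest lower bound if there is no upper one.\<close>
  obtain q where q: "\<And>s. s \<in> P \<Longrightarrow> q \<le> r s" "\<And>t. t \<in> N \<Longrightarrow> r t \<le> q"
  proof (cases "P = {}")
    case True
    show ?thesis
    proof (cases "N = {}")
      case True
      then show ?thesis using \<open>P = {}\<close> that by auto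
    next
      case False
      show ?thesis by (rule that[of "Max (r ` N)"]) (use True fin False in auto)
    qed
  next
    case False
    show ?thesis
      by (rule that[of "Min (r ` P)"]) (use False fin NP in auto)
  qed
  show ?case
  proof (intro exI[of _ "c(m := q)"] ballI, clarify)
    fix u b assume s: "(u, b) \<in> S"
    have eq: "(\<Sum>j<Suc m. (c(m := q)) j * u j) = (\<Sum>j<m. c j * u j) + q * u m"
      by (simp add: sum.lessThan_Suc)
    consider "u m = 0" | "u m > 0" | "u m < 0" by linarith
    then have "(\<Sum>j<m. c j * u j) + q * u m \<le> b"
    proof cases
      case 1
      then have "(u, b) \<in> S'" using s by (simp add: S'_def Z_def)
      then show ?thesis using c 1 by simp
    next
      case 2
      then have "q \<le> r (u, b)" using s by (intro q) (simp add: P_def)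
      then have "q * u m \<le> r (u, b) * u m" using 2 by (intro mult_right_mono) auto
      then show ?thesis using 2 by (simp add: r_def)
    next
      case 3
      then have "r (u, b) \<le> q" using s by (intro q) (simp add: N_def)
      then have "q * u m \<le> r (u, b) * u m" using 3 by (intro mult_right_mono_neg) auto
      then show ?thesis using 3 by (simp add: r_def)
    qed
    then show "(\<Sum>j<Suc m. (c(m := q)) j * u j) \<le> b" by (simp only: eq)
  qed
qed

text \<open>The sup-norm distance from \<open>b\<close> to the span of the \<open>u j\<close> is
  detected by weights \<open>z\<close> that annihilate the span, measured in l1. The two-sided
  bounds at all points form a finite linear system in the coefficients, to which
  \<open>farkas\<close> applies.\<close>

lemma sup_distance_duality:
  fixes u :: "nat \<Rightarrow> 'x \<Rightarrow> real"
  assumes X: "finite X" and e: "0 \<le> e"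
    and dual: "\<And>z. (\<And>j. j < m \<Longrightarrow> (\<Sum>x\<in>X. z x * u j x) = 0) \<Longrightarrow> \<bar>\<Sum>x\<in>X. z x * b x\<bar> \<le> e * (\<Sum>x\<in>X. \<bar>z x\<bar>)"
  shows "\<exists>c. \<forall>x\<in>X. \<bar>b x - (\<Sum>j<m. c j * u j x)\<bar> \<le> e"
proof -
  define S where "S = (\<lambda>x. (\<lambda>j. u j x, e + b x)) ` X \<union> (\<lambda>x. (\<lambda>j. - u j x, e - b x)) ` X"
  \<comment> \<open>A nonnegative combination of the two-sided bounds is summarized by one signed
    weight per point. Opposite weights at a point may cancel, which only lowers the l1 norm; hence
    an inequality in the last component.\<close>
  have inv: "\<exists>z. (\<forall>j. fst s j = (\<Sum>x\<in>X. z x * u j x)) \<and> e * (\<Sum>x\<in>X. \<bar>z x\<bar>) + (\<Sum>x\<in>X. z x * b x) \<le> snd s"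
    if "s \<in> cone_hull S" for s
    using that
  proof (induction rule: cone_hull.induct)
    case (base s)
    then consider x where "x \<in> X" "s = (\<lambda>j. u j x, e + b x)" | x where "x \<in> X" "s = (\<lambda>j. - u j x, e - b x)"
      by (auto simp: S_def)
    then show ?case
    proof cases
      case 1
      show ?thesis
        by (rule exI[of _ "\<lambda>y. if y = x then 1 else 0"])
          (use 1 X in \<open>simp add: if_distrib[of abs] if_distrib[of "\<lambda>t. t * _"] cong: if_cong\<close>)
    next
      case 2
      show ?thesis
        by (rule exI[of _ "\<lambda>y. if y = x then -1 else 0"])
          (use 2 X in \<open>simp add: if_distrib[of abs] if_distrib[of "\<lambda>t. t * _"] cong: if_cong\<close>)
    qed
  next
    case (add v b1 w b2)
    then obtain z1 z2 where z: "\<forall>j. v j = (\<Sum>x\<in>X. z1 x * u j x)" "e * (\<Sum>x\<in>X. \<bar>z1 x\<bar>) + (\<Sum>x\<in>X. z1 x * b x) \<le> b1"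
      "\<forall>j. w j = (\<Sum>x\<in>X. z2 x * u j x)" "e * (\<Sum>x\<in>X. \<bar>z2 x\<bar>) + (\<Sum>x\<in>X. z2 x * b x) \<le> b2" by auto
    have "e * (\<Sum>x\<in>X. \<bar>z1 x + z2 x\<bar>) \<le> e * (\<Sum>x\<in>X. \<bar>z1 x\<bar> + \<bar>z2 x\<bar>)"
      by (intro mult_left_mono e sum_mono abs_triangle_ineq)
    then show ?case
      using z by (intro exI[of _ "\<lambda>x. z1 x + z2 x"]) (simp add: sum.distrib algebra_simps)
  next
    case (scale v b1 l)
    then obtain z where z: "\<forall>j. v j = (\<Sum>x\<in>X. z x * u j x)" "e * (\<Sum>x\<in>X. \<bar>z x\<bar>) + (\<Sum>x\<in>X. z x * b x) \<le> b1" by auto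
    have "l * (e * (\<Sum>x\<in>X. \<bar>z x\<bar>) + (\<Sum>x\<in>X. z x * b x)) \<le> l * b1"
      using z(2) scale by (intro mult_left_mono) auto
    then show ?case
      using z(1) scale(2) by (intro exI[of _ "\<lambda>x. l * z x"])
        (simp add: sum_distrib_left abs_mult algebra_simps)
  qed
  have "\<exists>c :: nat \<Rightarrow> real. \<forall>(v, d)\<in>S. (\<Sum>j<m. c j * v j) \<le> d"
  proof (rule farkas)
    show "finite S" using X by (simp add: S_def)
    fix v d assume v: "(v, d) \<in> cone_hull S" "\<And>j. j < m \<Longrightarrow> v j = 0"
    then obtain z where z: "\<forall>j. v j = (\<Sum>x\<in>X. z x * u j x)"
      "e * (\<Sum>x\<in>X. \<bar>z x\<bar>) + (\<Sum>x\<in>X. z x * b x) \<le> d" using inv by fastforce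
    show "0 \<le> d" using dual[of z] z v(2) by fastforce
  qed
  then obtain c where c: "\<And>v d. (v, d) \<in> S \<Longrightarrow> (\<Sum>j<m. c j * v j) \<le> d" by blast
  have "\<bar>b x - (\<Sum>j<m. c j * u j x)\<bar> \<le> e" if "x \<in> X" for x
    using c[of "\<lambda>j. u j x" "e + b x"] c[of "\<lambda>j. - u j x" "e - b x"] that
    by (simp add: S_def sum_negf)
  then show ?thesis by blast
qed

text \<open>Weights annihilating the functions x \<mapsto> <G j, a x> form exactly the section of
  \<open>ex_small_section\<close>. There the combination of the \<open>a x\<close> is short, and
  Cauchy-Schwarz against \<open>y\<close> gives the dual bound.\<close>

lemma ex_width_basis_real:
  fixes a :: "'x \<Rightarrow> 'i \<Rightarrow> real"
  assumes I: "finite I" and X: "finite X" "X \<noteq> {}" and M: "M > 0" and m: "m > 0"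
    and a: "\<And>x. x \<in> X \<Longrightarrow> (\<Sum>i\<in>I. (a x i)\<^sup>2) \<le> M"
  obtains u :: "nat \<Rightarrow> 'x \<Rightarrow> real" where
    "\<And>y :: 'i \<Rightarrow> real. \<exists>c. \<forall>x\<in>X. \<bar>(\<Sum>i\<in>I. y i * a x i) - (\<Sum>j<m. c j * u j x)\<bar>
      \<le> 15 * width_rate M (card X) m * sqrt (\<Sum>i\<in>I. (y i)\<^sup>2)"
proof -
  obtain G :: "nat \<Rightarrow> 'i \<Rightarrow> real" where G:
    "\<And>z. (\<And>j. j < m \<Longrightarrow> (\<Sum>x\<in>X. z x * (\<Sum>i\<in>I. G j i * a x i)) = 0) \<Longrightarrow>
      sqrt (\<Sum>i\<in>I. (\<Sum>x\<in>X. z x * a x i)\<^sup>2)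
        \<le> 15 * width_rate M (card X) m * (\<Sum>x\<in>X. \<bar>z x\<bar>)"
    using ex_small_section[where a = a, OF I X M m a] by blast
  show thesis
  proof (rule that[of "\<lambda>j x. \<Sum>i\<in>I. G j i * a x i"])
    fix y :: "'i \<Rightarrow> real"
    let ?E = "15 * width_rate M (card X) m"
    have "card X \<ge> 1" using X by (simp add: Suc_leI card_gt_0_iff)
    then have "0 \<le> M * ln (2 * real (card X)) / real m" using M by simp
    then have E: "0 \<le> ?E" by simp
    show "\<exists>c. \<forall>x\<in>X. \<bar>(\<Sum>i\<in>I. y i * a x i) - (\<Sum>j<m. c j * (\<Sum>i\<in>I. G j i * a x i))\<bar>
      \<le> ?E * sqrt (\<Sum>i\<in>I. (y i)\<^sup>2)"
    proof (rule sup_distance_duality[OF X(1)])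
      show "0 \<le> ?E * sqrt (\<Sum>i\<in>I. (y i)\<^sup>2)" using E by (simp add: sum_nonneg)
      fix z assume z: "\<And>j. j < m \<Longrightarrow> (\<Sum>x\<in>X. z x * (\<Sum>i\<in>I. G j i * a x i)) = 0"
      have "(\<Sum>x\<in>X. z x * (\<Sum>i\<in>I. y i * a x i)) = (\<Sum>i\<in>I. y i * (\<Sum>x\<in>X. z x * a x i))"
        unfolding sum_distrib_left by (subst sum.swap) (simp add: mult_ac)
      then have "\<bar>\<Sum>x\<in>X. z x * (\<Sum>i\<in>I. y i * a x i)\<bar> \<le> (\<Sum>i\<in>I. \<bar>y i\<bar> * \<bar>\<Sum>x\<in>X. z x * a x i\<bar>)"
        by (simp add: abs_mult[symmetric] sum_abs)
      also have "\<dots> \<le> L2_set y I * L2_set (\<lambda>i. \<Sum>x\<in>X. z x * a x i) I"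
        by (rule L2_set_mult_ineq)
      also have "\<dots> \<le> sqrt (\<Sum>i\<in>I. (y i)\<^sup>2) * (?E * (\<Sum>x\<in>X. \<bar>z x\<bar>))"
        unfolding L2_set_def by (intro mult_left_mono G z) (auto simp: sum_nonneg)
      finally show "\<bar>\<Sum>x\<in>X. z x * (\<Sum>i\<in>I. y i * a x i)\<bar> \<le> ?E * sqrt (\<Sum>i\<in>I. (y i)\<^sup>2) * (\<Sum>x\<in>X. \<bar>z x\<bar>)"
        by (simp add: mult_ac)
    qed
  qed
qed

text \<open>Real and imaginary parts are approximated from the same real basis, their coefficients
  forming complex ones; this doubles the constant 15.\<close>

lemma ex_width_basis:
  fixes a :: "'x \<Rightarrow> 'i \<Rightarrow> real"
  assumes I: "finite I" and X: "finite X" "X \<noteq> {}" and M: "M > 0" and m: "m > 0"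
    and a: "\<And>x. x \<in> X \<Longrightarrow> (\<Sum>i\<in>I. (a x i)\<^sup>2) \<le> M"
  obtains u :: "nat \<Rightarrow> 'x \<Rightarrow> real" where
    "\<And>y :: 'i \<Rightarrow> complex. \<exists>c :: nat \<Rightarrow> complex. \<forall>x\<in>X. norm ((\<Sum>i\<in>I. y i * of_real (a x i)) - (\<Sum>j<m. c j * of_real (u j x)))
      \<le> 30 * width_rate M (card X) m * sqrt (\<Sum>i\<in>I. (norm (y i))\<^sup>2)"
proof -
  let ?E = "15 * width_rate M (card X) m"
  obtain u :: "nat \<Rightarrow> 'x \<Rightarrow> real" where u:
    "\<And>y :: 'i \<Rightarrow> real. \<exists>c. \<forall>x\<in>X. \<bar>(\<Sum>i\<in>I. y i * a x i) - (\<Sum>j<m. c j * u j x)\<bar> \<le> ?E * sqrt (\<Sum>i\<in>I. (y i)\<^sup>2)"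
    using ex_width_basis_real[where a = a, OF I X M m a] by blast
  have "card X \<ge> 1" using X by (simp add: Suc_leI card_gt_0_iff)
  then have "0 \<le> M * ln (2 * real (card X)) / real m" using M by simp
  then have E: "0 \<le> ?E" by simp
  show thesis
  proof (rule that[of u])
    fix y :: "'i \<Rightarrow> complex"
    let ?R = "sqrt (\<Sum>i\<in>I. (norm (y i))\<^sup>2)"
    obtain c1 where c1: "\<forall>x\<in>X. \<bar>(\<Sum>i\<in>I. Re (y i) * a x i) - (\<Sum>j<m. c1 j * u j x)\<bar> \<le> ?E * sqrt (\<Sum>i\<in>I. (Re (y i))\<^sup>2)"
      using u[of "\<lambda>i. Re (y i)"] by blast
    obtain c2 where c2: "\<forall>x\<in>X. \<bar>(\<Sum>i\<in>I. Im (y i) * a x i) - (\<Sum>j<m. c2 j * u j x)\<bar> \<le> ?E * sqrt (\<Sum>i\<in>I. (Im (y i))\<^sup>2)"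
      using u[of "\<lambda>i. Im (y i)"] by blast
    have le: "sqrt (\<Sum>i\<in>I. (Re (y i))\<^sup>2) \<le> ?R" "sqrt (\<Sum>i\<in>I. (Im (y i))\<^sup>2) \<le> ?R"
      by (auto intro!: real_sqrt_le_mono sum_mono simp: cmod_power2)
    show "\<exists>c. \<forall>x\<in>X. norm ((\<Sum>i\<in>I. y i * of_real (a x i)) - (\<Sum>j<m. c j * of_real (u j x)))
      \<le> 30 * width_rate M (card X) m * ?R"
    proof (intro exI[of _ "\<lambda>j. Complex (c1 j) (c2 j)"] ballI)
      fix x assume x: "x \<in> X"
      let ?d = "(\<Sum>i\<in>I. y i * of_real (a x i)) - (\<Sum>j<m. Complex (c1 j) (c2 j) * of_real (u j x))"
      have "norm ?d \<le> \<bar>Re ?d\<bar> + \<bar>Im ?d\<bar>" by (rule cmod_le)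
      also have "\<dots> \<le> ?E * sqrt (\<Sum>i\<in>I. (Re (y i))\<^sup>2) + ?E * sqrt (\<Sum>i\<in>I. (Im (y i))\<^sup>2)"
        using bspec[OF c1 x] bspec[OF c2 x] by (intro add_mono) simp_all
      also have "\<dots> \<le> ?E * ?R + ?E * ?R"
        by (intro add_mono mult_left_mono le E)
      finally show "norm ?d \<le> 30 * width_rate M (card X) m * ?R" by (simp add: mult_ac)
    qed
  qed
qed

section \<open>Mixed differences on the torus\<close>

abbreviation torus_box :: "(real ^ 'n) set" where
  "torus_box \<equiv> cbox 0 (\<chi> j. 2 * pi)"

lemma mem_torus_box: "x \<in> torus_box \<longleftrightarrow> (\<forall>j. 0 \<le> x $ j \<and> x $ j \<le> 2 * pi)"
  by (simp add: mem_box_cart)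

lemma emeasure_cbox_cart:
  fixes a b :: "real ^ 'n"
  assumes "\<And>j. a $ j \<le> b $ j"
  shows "emeasure lborel (cbox a b) = ennreal (\<Prod>j\<in>UNIV. b $ j - a $ j)"
    and "emeasure lborel (box a b) = ennreal (\<Prod>j\<in>UNIV. b $ j - a $ j)"
proof -
  have le: "\<forall>i\<in>Basis. a \<bullet> i \<le> b \<bullet> i"
    using assms by (auto simp: Basis_vec_def inner_axis)
  have inj: "inj (\<lambda>j::'n. axis j (1::real))" by (auto simp: inj_on_def axis_eq_axis)
  have "(\<Prod>i\<in>Basis. (b - a) \<bullet> i) = (\<Prod>j\<in>UNIV. b $ j - a $ j)"
  proof -
    have B: "(Basis :: (real ^ 'n) set) = (\<lambda>j. axis j 1) ` UNIV" by (auto simp: Basis_vec_def)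
    show ?thesis unfolding B by (subst prod.reindex[OF inj]) (simp add: inner_axis)
  qed
  then show "emeasure lborel (cbox a b) = ennreal (\<Prod>j\<in>UNIV. b $ j - a $ j)"
    "emeasure lborel (box a b) = ennreal (\<Prod>j\<in>UNIV. b $ j - a $ j)"
    using le by (simp_all add: emeasure_lborel_cbox_eq emeasure_lborel_box_eq)
qed

lemma emeasure_torus_box: "emeasure lborel (torus_box :: (real ^ 'n) set) = ennreal ((2 * pi) ^ CARD('n))"
  by (subst emeasure_cbox_cart) auto

lemma sets_torus_measure [simp, measurable_cong]: "sets torus_measure = sets borel"
  by (simp add: torus_measure_def)

lemma space_torus_measure [simp]: "space torus_measure = UNIV"
  by (simp add: torus_measure_def)

lemma prob_space_torus_measure: "prob_space torus_measure"
  unfolding torus_measure_def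
  by (intro prob_space_uniform_measure) (simp_all add: emeasure_torus_box)

interpretation torus: prob_space "torus_measure :: (real ^ 'n) measure"
  by (rule prob_space_torus_measure)

lemma nn_integral_torus:
  fixes f :: "real ^ 'n \<Rightarrow> ennreal"
  assumes [measurable]: "f \<in> borel_measurable borel"
  shows "(\<integral>\<^sup>+x. f x \<partial>torus_measure) =
    ennreal (1 / (2 * pi) ^ CARD('n)) * (\<integral>\<^sup>+x. f x * indicator torus_box x \<partial>lborel)"
proof -
  define V where "V = (2 * pi) ^ CARD('n)"
  have V: "V > 0" "emeasure lborel (torus_box :: (real ^ 'n) set) = ennreal V"
    by (simp_all add: V_def emeasure_torus_box)
  have "(\<integral>\<^sup>+x. f x \<partial>torus_measure) = (\<integral>\<^sup>+x. f x * indicator torus_box x \<partial>lborel) / ennreal V"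
    unfolding torus_measure_def by (subst nn_integral_uniform_measure) (auto simp: V)
  also have "\<dots> = ennreal (1 / V) * (\<integral>\<^sup>+x. f x * indicator torus_box x \<partial>lborel)"
    using V(1) by (simp add: divide_ennreal_def inverse_ennreal mult.commute inverse_eq_divide)
  finally show ?thesis by (simp only: V_def)
qed

lemma integral_torus:
  fixes F :: "real ^ 'n \<Rightarrow> complex"
  assumes [measurable]: "F \<in> borel_measurable borel" and supp: "\<And>y. F y \<noteq> 0 \<Longrightarrow> y \<in> torus_box"
  shows "(\<integral>y. F y \<partial>torus_measure) = (1 / (2 * pi) ^ CARD('n)) *\<^sub>R (\<integral>y. F y \<partial>lborel)"
proof -
  have eq: "torus_measure = density lborel (\<lambda>x::real ^ 'n. ennreal (indicator torus_box x / (2 * pi) ^ CARD('n)))"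
    unfolding torus_measure_def uniform_measure_def emeasure_torus_box
    by (intro density_cong) (auto simp: divide_ennreal[symmetric] split: split_indicator)
  have "(\<integral>y. F y \<partial>torus_measure) = (\<integral>y. (indicator torus_box y / (2 * pi) ^ CARD('n)) *\<^sub>R F y \<partial>lborel)"
    unfolding eq by (subst integral_density) auto
  also have "\<dots> = (\<integral>y. (1 / (2 * pi) ^ CARD('n)) *\<^sub>R F y \<partial>lborel)"
    by (intro Bochner_Integration.integral_cong refl) (use supp in \<open>auto split: split_indicator\<close>)
  finally show ?thesis by simp
qed

text \<open>The support conditions keep the integrand inside the box before and after the shift, so
  translation invariance of Lebesgue measure applies without wrapping around.\<close>

lemma integral_torus_shift:
  fixes F :: "real ^ 'n \<Rightarrow> complex"
  assumes [measurable]: "F \<in> borel_measurable borel"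
    and supp: "\<And>y. F y \<noteq> 0 \<Longrightarrow> y \<in> torus_box" "\<And>y. F (y + v) \<noteq> 0 \<Longrightarrow> y \<in> torus_box"
  shows "(\<integral>y. F (y + v) \<partial>torus_measure) = (\<integral>y. F y \<partial>torus_measure)"
proof -
  have "(\<integral>y. F y \<partial>lborel) = (\<integral>y. F y \<partial>distr lborel borel ((+) v))"
    by (simp add: lborel_distr_plus)
  also have "\<dots> = (\<integral>y. F (y + v) \<partial>lborel)"
    by (subst integral_distr) (auto simp: add.commute)
  finally show ?thesis
    using supp by (subst (1 2) integral_torus) auto
qed

text \<open>The factor 2 avoids Jensen's inequality.\<close>

lemma nn_integral_powr_le_of_Lp_norm:
  fixes g :: "real ^ 'n \<Rightarrow> complex"
  assumes [measurable]: "g \<in> borel_measurable borel"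
    and p: "1 \<le> P" "ereal P \<le> p" and b: "b > 0" and le: "Lp_norm p g \<le> ennreal b"
  shows "(\<integral>\<^sup>+x. ennreal (norm (g x) powr P) \<partial>torus_measure) \<le> ennreal (2 * b powr P)"
proof (cases "p = \<infinity>")
  case True
  then have "esssup torus_measure (\<lambda>x. ennreal (norm (g x))) \<le> ennreal b"
    using le by (simp add: Lp_norm_def)
  then have "AE x in torus_measure. ennreal (norm (g x)) \<le> ennreal b"
    using esssup_AE[where M = torus_measure and f = "\<lambda>x. ennreal (norm (g x))"] by (auto elim!: eventually_mono intro: order_trans)
  then have "AE x in torus_measure. ennreal (norm (g x) powr P) \<le> ennreal (2 * b powr P)"
  proof eventually_elim
    case (elim x)
    then have "norm (g x) \<le> b" using b by simp
    then have "norm (g x) powr P \<le> b powr P" using p by (intro powr_mono2) auto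
    moreover have "0 \<le> b powr P" by simp
    ultimately show ?case by (intro ennreal_leI) linarith
  qed
  then have "(\<integral>\<^sup>+x. ennreal (norm (g x) powr P) \<partial>torus_measure) \<le> (\<integral>\<^sup>+x. ennreal (2 * b powr P) \<partial>(torus_measure :: (real ^ 'n) measure))"
    by (rule nn_integral_mono_AE)
  then show ?thesis by (simp add: torus.emeasure_space_1[simplified])
next
  case False
  then obtain q where q: "p = ereal q" using p by (cases p) auto
  then have Pq: "P \<le> q" using p by simp
  define I where "I = (\<integral>\<^sup>+x. ennreal (norm (g x) powr q) \<partial>torus_measure)"
  have fin: "I \<noteq> \<infinity>" and I1: "ennreal (enn2real I powr (1 / q)) \<le> ennreal b"
    using le q by (auto simp: Lp_norm_def Let_def I_def top_unique split: if_splits)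
  have q0: "q > 0" using Pq p by simp
  from I1 have "enn2real I powr (1 / q) \<le> b" using b by simp
  then have "(enn2real I powr (1 / q)) powr q \<le> b powr q" using q0 by (intro powr_mono2) auto
  then have "enn2real I \<le> b powr q" using q0 by (simp add: powr_powr)
  then have I2: "I \<le> ennreal (b powr q)" using fin ennreal_enn2real[of I] by (metis ennreal_leI infinity_ennreal_def less_top)
  \<comment> \<open>Values up to \<open>b\<close> give the first term. Above \<open>b\<close> the
    missing power P - q is nonpositive and largest at \<open>b\<close>. Each term integrates to at
    most b^P, hence the factor 2.\<close>
  have pt: "a powr P \<le> b powr P + b powr (P - q) * a powr q" if "a \<ge> 0" for a
  proof (cases "a \<le> b")
    case True
    then have "a powr P \<le> b powr P" using that p by (intro powr_mono2) auto
    then show ?thesis by (simp add: add_increasing2)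
  next
    case False
    then have a: "a > b" "a > 0" using b by auto
    have "a powr P = a powr (P - q) * a powr q" using a by (simp add: powr_add[symmetric])
    also have "\<dots> \<le> b powr (P - q) * a powr q"
      using a b Pq by (intro mult_right_mono powr_mono2') auto
    finally show ?thesis by (simp add: add_increasing)
  qed
  have "(\<integral>\<^sup>+x. ennreal (norm (g x) powr P) \<partial>torus_measure)
    \<le> (\<integral>\<^sup>+x. ennreal (b powr P) + ennreal (b powr (P - q)) * ennreal (norm (g x) powr q) \<partial>torus_measure)"
    by (intro nn_integral_mono) (auto simp: ennreal_mult[symmetric] ennreal_plus[symmetric] simp del: ennreal_plus intro!: ennreal_leI pt)
  also have "\<dots> = ennreal (b powr P) + ennreal (b powr (P - q)) * I"
    by (subst nn_integral_add) (auto simp: nn_integral_cmult I_def torus.emeasure_space_1[simplified])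
  also have "\<dots> \<le> ennreal (b powr P) + ennreal (b powr (P - q)) * ennreal (b powr q)"
    by (intro add_left_mono mult_left_mono I2) auto
  also have "\<dots> = ennreal (2 * b powr P)"
    using b by (simp add: ennreal_mult[symmetric] ennreal_plus[symmetric] powr_add[symmetric] del: ennreal_plus)
  finally show ?thesis .
qed

section \<open>First mixed differences and the smoothness condition\<close>

abbreviation mdiff :: "real ^ 'n \<Rightarrow> 'n set \<Rightarrow> (real ^ 'n \<Rightarrow> complex) \<Rightarrow> real ^ 'n \<Rightarrow> complex" where
  "mdiff \<equiv> mixed_difference (Suc 0)"

lemma mdiff_insert: "j \<notin> e \<Longrightarrow> mdiff t (insert j e) f = difference (t $ j) j (mdiff t e f)"
  for e :: "'n::finite set"
  by (simp add: mixed_difference_insert)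

lemma mdiff_measurable [measurable]:
  fixes f :: "real ^ 'n \<Rightarrow> complex"
  assumes [measurable]: "f \<in> borel_measurable borel"
  shows "mdiff t e f \<in> borel_measurable borel"
proof -
  have "finite e" by simp
  then show ?thesis
  proof (induction e rule: finite_induct)
    case (insert j e)
    note [measurable] = insert.IH
    show ?case unfolding mdiff_insert[OF insert.hyps(2)] difference_def by measurable
  qed (simp add: mixed_difference_empty)
qed

text \<open>A shift in one coordinate is the identity plus a difference; expanding the product over
  \<open>A\<close> gives one term for each subset.\<close>

lemma shift_eq_sum_mdiff:
  fixes f :: "real ^ 'n \<Rightarrow> complex"
  shows "f (x + (\<Sum>j\<in>A. axis j (t $ j))) = (\<Sum>e\<in>Pow A. mdiff t e f x)"
proof -
  have "finite A" by simp
  then show ?thesis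
  proof (induction A arbitrary: x rule: finite_induct)
    case (insert i A)
    have fin: "finite (Pow A)" using insert by simp
    have inj: "inj_on (insert i) (Pow A)" using insert(2) by (auto simp: inj_on_def)
    have "(\<Sum>e\<in>Pow (insert i A). mdiff t e f x) = (\<Sum>e\<in>Pow A. mdiff t e f x) + (\<Sum>e\<in>insert i ` Pow A. mdiff t e f x)"
      unfolding Pow_insert using insert by (intro sum.union_disjoint) auto
    also have "(\<Sum>e\<in>insert i ` Pow A. mdiff t e f x) = (\<Sum>e\<in>Pow A. mdiff t e f (x + axis i (t $ i)) - mdiff t e f x)"
      unfolding sum.reindex[OF inj] o_def
    proof (intro sum.cong refl)
      fix e assume "e \<in> Pow A"
      then have "i \<notin> e" using insert(2) by auto
      then show "mdiff t (insert i e) f x = mdiff t e f (x + axis i (t $ i)) - mdiff t e f x"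
        by (simp only: mdiff_insert[OF \<open>i \<notin> e\<close>] difference_def)
    qed
    finally have "(\<Sum>e\<in>Pow (insert i A). mdiff t e f x) = (\<Sum>e\<in>Pow A. mdiff t e f (x + axis i (t $ i)))"
      by (simp add: sum_subtractf)
    also have "\<dots> = f (x + axis i (t $ i) + (\<Sum>j\<in>A. axis j (t $ j)))" by (simp add: insert.IH)
    finally show ?case using insert by (simp add: add.assoc)
  qed (simp add: mixed_difference_empty)
qed

text \<open>A form of the class with one finite exponent, implied for every P from 1 up to p,
  whether p is finite or not. The bound passes through a positive \<open>b\<close> because the
  product of step sizes is 0 as soon as one step in \<open>e\<close> is 0.\<close>

definition mixed_smooth :: "real \<Rightarrow> real \<Rightarrow> (real ^ 'n \<Rightarrow> complex) \<Rightarrow> bool" where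
  "mixed_smooth r P f \<longleftrightarrow> f \<in> borel_measurable borel \<and>
    (\<forall>e t b. 0 < b \<longrightarrow> (\<Prod>j\<in>e. \<bar>t $ j\<bar> powr r) \<le> b \<longrightarrow>
      (\<integral>\<^sup>+x. ennreal (norm (mdiff t e f x) powr P) \<partial>torus_measure) \<le> ennreal (2 * b powr P))"

abbreviation smooth_class :: "real \<Rightarrow> real set \<Rightarrow> (real ^ 'n \<Rightarrow> complex) set" where
  "smooth_class r S \<equiv> {f. \<forall>P\<in>S. mixed_smooth r P f}"

lemma class_H_imp_mixed_smooth:
  assumes "f \<in> class_H r p" "1 \<le> P" "ereal P \<le> p" "0 < r" "r < 1"
  shows "mixed_smooth r P f"
proof -
  have r: "nat \<lfloor>r\<rfloor> + 1 = Suc 0" using assms by (simp add: floor_eq_iff[of r 0, simplified])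
  have [measurable]: "f \<in> borel_measurable borel" using assms(1) by (simp add: class_H_def Lp_space_def)
  have "(\<integral>\<^sup>+x. ennreal (norm (mdiff t e f x) powr P) \<partial>torus_measure) \<le> ennreal (2 * b powr P)"
    if "0 < b" "(\<Prod>j\<in>e. \<bar>t $ j\<bar> powr r) \<le> b" for e t b
  proof (rule nn_integral_powr_le_of_Lp_norm)
    have "Lp_norm p (mdiff t e f) \<le> ennreal (\<Prod>j\<in>e. \<bar>t $ j\<bar> powr r)"
      using assms(1) unfolding class_H_def r by blast
    then show "Lp_norm p (mdiff t e f) \<le> ennreal b"
      using that by (meson ennreal_leI order_trans)
  qed (use assms that in auto)
  then show ?thesis by (auto simp: mixed_smooth_def)
qed

lemma mixed_smooth_mdiff_integrable:
  assumes "mixed_smooth r 1 f"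
  shows "integrable torus_measure (mdiff t e f)"
proof (rule integrableI_bounded)
  have [measurable]: "f \<in> borel_measurable borel" using assms by (simp add: mixed_smooth_def)
  show "mdiff t e f \<in> borel_measurable torus_measure" by measurable
  \<comment> \<open>The summand 1 only makes \<open>b\<close> positive when a step vanishes; any
    finite bound gives integrability.\<close>
  define b where "b = (\<Prod>j\<in>e. \<bar>t $ j\<bar> powr r) + 1"
  have "(\<Prod>j\<in>e. \<bar>t $ j\<bar> powr r) \<ge> 0" by (simp add: prod_nonneg)
  then have "b > 0" "(\<Prod>j\<in>e. \<bar>t $ j\<bar> powr r) \<le> b" by (auto simp: b_def)
  then have "(\<integral>\<^sup>+x. ennreal (norm (mdiff t e f x) powr 1) \<partial>torus_measure) \<le> ennreal (2 * b powr 1)"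
    using assms unfolding mixed_smooth_def by blast
  then show "(\<integral>\<^sup>+x. ennreal (norm (mdiff t e f x)) \<partial>torus_measure) < \<infinity>"
    by (simp add: le_less_trans[OF _ ennreal_less_top])
qed

section \<open>Dyadic kernels\<close>

definition dyad :: "nat \<Rightarrow> real \<Rightarrow> int" where
  "dyad k u = \<lfloor>2 ^ k * u / (2 * pi)\<rfloor>"

lemma dyad_eq_iff:
  "dyad k u = q \<longleftrightarrow> 2 * pi * of_int q / 2 ^ k \<le> u \<and> u < 2 * pi * (of_int q + 1) / 2 ^ k"
proof -
  have "q' \<le> c * u / d \<longleftrightarrow> d * q' / c \<le> u" "c * u / d < q' \<longleftrightarrow> u < d * q' / c" if "c > 0" "d > 0" for c d q' :: real
    using that by (simp_all add: field_simps)
  from this[of "2 ^ k" "2 * pi"] show ?thesis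
    unfolding dyad_def floor_eq_iff by simp
qed

lemma dyad_Suc_div_2: "dyad (Suc k) u div 2 = dyad k u"
proof -
  have "dyad (Suc k) u div 2 = \<lfloor>(2 ^ Suc k * u / (2 * pi)) / of_int 2\<rfloor>"
    unfolding dyad_def by (rule floor_divide_real_eq_div[symmetric]) simp
  also have "(2 ^ Suc k * u / (2 * pi)) / of_int 2 = 2 ^ k * u / (2 * pi)" by simp
  finally show ?thesis by (simp only: dyad_def)
qed

lemma dyad_shift: "dyad k (u + 2 * pi * of_int i / 2 ^ k) = dyad k u + i"
proof -
  have "2 ^ k * (u + 2 * pi * of_int i / 2 ^ k) / (2 * pi) = 2 ^ k * u / (2 * pi) + of_int i"
    by (simp add: field_simps)
  then show ?thesis by (simp add: dyad_def)
qed

lemma dyad_measurable [measurable]: "dyad k \<in> measurable borel (count_space UNIV)"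
  unfolding dyad_def[abs_def] by (rule measurable_compose[OF _ measurable_real_floor]) measurable

lemma dyad_range:
  assumes "0 \<le> dyad k u" "dyad k u < 2 ^ k"
  shows "0 \<le> u" "u \<le> 2 * pi"
proof -
  have "2 * pi * of_int (dyad k u) / 2 ^ k \<le> u \<and> u < 2 * pi * (of_int (dyad k u) + 1) / 2 ^ k"
    using dyad_eq_iff[of k u "dyad k u"] by simp
  moreover have "0 \<le> 2 * pi * of_int (dyad k u) / 2 ^ k" using assms by simp
  moreover have "2 * pi * (of_int (dyad k u) + 1) / 2 ^ k \<le> 2 * pi"
  proof -
    have "dyad k u + 1 \<le> 2 ^ k" using assms by simp
    then have "of_int (dyad k u + 1) \<le> (of_int (2 ^ k) :: real)" by (simp only: of_int_le_iff)
    then have "2 * pi * (of_int (dyad k u) + 1) \<le> 2 * pi * 2 ^ k" by simp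
    then show ?thesis by (simp add: pos_divide_le_eq)
  qed
  ultimately show "0 \<le> u" "u \<le> 2 * pi" by linarith+
qed

definition in_dyad :: "nat \<Rightarrow> int \<Rightarrow> real \<Rightarrow> real" where
  "in_dyad k q u = (if dyad k u = q then 1 else 0)"

text \<open>Intervals \<open>q\<close> and \<open>sibling q\<close> are the two halves of interval
  \<open>q div 2\<close> one level up.\<close>

definition sibling :: "int \<Rightarrow> int" where
  "sibling q = (if even q then q + 1 else q - 1)"

definition sibling_step :: "nat \<Rightarrow> bool \<Rightarrow> real" where
  "sibling_step k b = (if b then 1 else -1) * (2 * pi / 2 ^ k)"

lemma in_dyad_measurable [measurable]: "in_dyad k q \<in> borel_measurable borel"
  unfolding in_dyad_def[abs_def] by (rule measurable_compose[OF dyad_measurable]) simp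

lemma in_dyad_sibling: "in_dyad k (sibling q) u = in_dyad k q (u - sibling_step k (even q))"
proof -
  have "u - sibling_step k (even q) = u + 2 * pi * of_int (q - sibling q) / 2 ^ k"
    by (simp add: sibling_step_def sibling_def)
  then have "dyad k (u - sibling_step k (even q)) = dyad k u + (q - sibling q)"
    by (simp only: dyad_shift)
  then show ?thesis by (simp add: in_dyad_def)
qed

text \<open>The difference of the averaging kernels of two consecutive levels; level 0 has no predecessor.\<close>

definition haar_kernel :: "nat \<Rightarrow> int \<Rightarrow> real \<Rightarrow> real" where
  "haar_kernel k q u = 2 ^ k * in_dyad k q u - (if k = 0 then 0 else 2 ^ (k - 1) * in_dyad (k - 1) (q div 2) u)"

lemma haar_kernel_0: "haar_kernel 0 q u = in_dyad 0 q u"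
  by (simp add: haar_kernel_def)

lemma div_2_eq_iff: "n div 2 = q div 2 \<longleftrightarrow> n = q \<or> n = sibling q"
proof (cases "even q")
  case True
  then obtain m where "q = 2 * m" by (elim evenE)
  then show ?thesis by (auto simp: sibling_def)
next
  case False
  then obtain m where "q = 2 * m + 1" by (elim oddE)
  then show ?thesis by (auto simp: sibling_def)
qed

text \<open>The parent interval is the union of interval \<open>q\<close> and its sibling, so
  subtracting the parent average leaves half the difference of the two, and the sibling is a
  translate.\<close>

lemma haar_kernel_pos:
  assumes "k > 0"
  shows "haar_kernel k q u = 2 ^ (k - 1) * (in_dyad k q u - in_dyad k q (u - sibling_step k (even q)))"
proof -
  obtain l where k: "k = Suc l" using assms by (cases k) auto
  have "dyad l u = q div 2 \<longleftrightarrow> dyad (Suc l) u = q \<or> dyad (Suc l) u = sibling q"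
    using div_2_eq_iff[of "dyad (Suc l) u" q] by (simp only: dyad_Suc_div_2)
  moreover have "sibling q \<noteq> q" by (simp add: sibling_def)
  ultimately have "in_dyad l (q div 2) u = in_dyad k q u + in_dyad k (sibling q) u"
    by (auto simp: in_dyad_def k)
  then show ?thesis
    unfolding in_dyad_sibling[symmetric] by (simp add: haar_kernel_def k algebra_simps)
qed

lemma haar_kernel_measurable [measurable]: "haar_kernel k q \<in> borel_measurable borel"
  unfolding haar_kernel_def[abs_def] by measurable

section \<open>Dyadic cells and their coefficients\<close>

abbreviation total :: "('n::finite \<Rightarrow> nat) \<Rightarrow> nat" where
  "total s \<equiv> (\<Sum>j\<in>UNIV. s j)"

definition cells :: "('n \<Rightarrow> nat) \<Rightarrow> ('n \<Rightarrow> int) set" where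
  "cells s = {q. \<forall>j. 0 \<le> q j \<and> q j < 2 ^ s j}"

lemma finite_cells [simp]: "finite (cells (s :: 'n::finite \<Rightarrow> nat))"
proof -
  have "cells s \<subseteq> PiE UNIV (\<lambda>j. {0..<2 ^ s j})" by (auto simp: cells_def)
  moreover have "finite (PiE (UNIV :: 'n set) (\<lambda>j. {0..<2 ^ s j} :: int set))"
    by (intro finite_PiE) auto
  ultimately show ?thesis by (rule finite_subset)
qed

definition cell_set :: "('n \<Rightarrow> nat) \<Rightarrow> ('n \<Rightarrow> int) \<Rightarrow> (real ^ 'n) set" where
  "cell_set s q = {y. \<forall>j. dyad (s j) (y $ j) = q j}"

lemma cell_set_measurable [measurable]: "cell_set s q \<in> sets (borel :: (real ^ 'n) measure)"
proof -
  have "cell_set s q = (\<Inter>j. {y \<in> space borel. dyad (s j) (y $ j) = q j})" by (auto simp: cell_set_def)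
  also have "\<dots> \<in> sets borel"
    by (intro sets.countable_INT'') measurable
  finally show ?thesis .
qed

lemma cell_set_subset: "q \<in> cells s \<Longrightarrow> cell_set s q \<subseteq> torus_box"
  by (auto simp: cells_def cell_set_def mem_torus_box dest!: dyad_range dest: spec)
    (metis dyad_range)+

lemma emeasure_cell_set:
  assumes q: "q \<in> cells s"
  shows "emeasure lborel (cell_set s q :: (real ^ 'n) set) = ennreal ((2 * pi) ^ CARD('n) / 2 ^ total s)"
proof -
  define a b :: "real ^ 'n" where "a = (\<chi> j. 2 * pi * of_int (q j) / 2 ^ s j)"
    and "b = (\<chi> j. 2 * pi * (of_int (q j) + 1) / 2 ^ s j)"
  have ab: "a $ j \<le> b $ j" for j by (simp add: a_def b_def divide_right_mono)
  have "b $ j - a $ j = 2 * pi / 2 ^ s j" for j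
    by (simp add: a_def b_def diff_divide_distrib[symmetric] algebra_simps)
  then have pr: "(\<Prod>j\<in>UNIV. b $ j - a $ j) = (2 * pi) ^ CARD('n) / 2 ^ total s"
    by (simp add: prod_dividef power_sum)
  \<comment> \<open>The half-open cell lies between the open and the closed box, which have equal
    volume.\<close>
  have sub: "box a b \<subseteq> cell_set s q" "cell_set s q \<subseteq> cbox a b"
    unfolding cell_set_def dyad_eq_iff by (auto simp: mem_box_cart a_def b_def less_imp_le)
  have "emeasure lborel (box a b) \<le> emeasure lborel (cell_set s q)"
    by (intro emeasure_mono sub) simp
  moreover have "emeasure lborel (cell_set s q) \<le> emeasure lborel (cbox a b)"
    by (intro emeasure_mono sub) simp
  ultimately show ?thesis
    using emeasure_cbox_cart[of a b, OF ab] by (simp add: pr)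
qed

lemma measure_cell_set:
  assumes q: "q \<in> cells s"
  shows "measure torus_measure (cell_set s q :: (real ^ 'n) set) = 1 / 2 ^ total s"
proof -
  have "emeasure torus_measure (cell_set s q) = (\<integral>\<^sup>+x. indicator (cell_set s q) x \<partial>torus_measure)"
    by (rule nn_integral_indicator[symmetric]) simp
  also have "\<dots> = ennreal (1 / (2 * pi) ^ CARD('n)) * (\<integral>\<^sup>+x. indicator (cell_set s q) x * indicator torus_box x \<partial>lborel)"
    by (rule nn_integral_torus) simp
  also have "(\<integral>\<^sup>+x. indicator (cell_set s q) x * indicator torus_box x \<partial>lborel) = (\<integral>\<^sup>+x. indicator (cell_set s q) x \<partial>lborel)"
    using cell_set_subset[OF q] by (intro nn_integral_cong) (auto split: split_indicator)
  also have "\<dots> = ennreal ((2 * pi) ^ CARD('n) / 2 ^ total s)"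
    by (subst nn_integral_indicator) (simp_all add: emeasure_cell_set[OF q])
  also have "ennreal (1 / (2 * pi) ^ CARD('n)) * ennreal ((2 * pi) ^ CARD('n) / 2 ^ total s) = ennreal (1 / 2 ^ total s)"
    by (subst ennreal_mult[symmetric]) (auto simp: power_mult_distrib)
  finally show ?thesis by (simp add: measure_def)
qed

text \<open>The constant value on cell \<open>q\<close> of the block of index \<open>s\<close>, the
  tensor product over the coordinates of differences of consecutive averaging operators. It is a
  function value, not a coefficient in a normalized basis.\<close>

definition haar_coef :: "(real ^ 'n \<Rightarrow> complex) \<Rightarrow> ('n \<Rightarrow> nat) \<Rightarrow> ('n \<Rightarrow> int) \<Rightarrow> complex" where
  "haar_coef f s q = (\<integral>y. (\<Prod>j\<in>UNIV. haar_kernel (s j) (q j) (y $ j)) *\<^sub>R f y \<partial>torus_measure)"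

lemma integrable_scaleR_bounded:
  fixes F :: "real ^ 'n \<Rightarrow> complex"
  assumes "integrable torus_measure F" and [measurable]: "K \<in> borel_measurable borel" and "\<And>y. \<bar>K y\<bar> \<le> c"
  shows "integrable torus_measure (\<lambda>y. K y *\<^sub>R F y)"
proof (rule Bochner_Integration.integrable_bound)
  show "integrable torus_measure (\<lambda>y. c *\<^sub>R F y)" using assms(1) by simp
  have [measurable]: "F \<in> borel_measurable borel" using borel_measurable_integrable[OF assms(1)] by simp
  show "(\<lambda>y. K y *\<^sub>R F y) \<in> borel_measurable torus_measure" by measurable
  show "AE y in torus_measure. norm (K y *\<^sub>R F y) \<le> norm (c *\<^sub>R F y)"
    using assms(3) by (intro AE_I2) (auto intro!: mult_right_mono intro: order_trans[OF _ abs_ge_self])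
qed

text \<open>Translating one half of the kernel turns it into a difference of the function.\<close>

lemma integral_kernel_difference:
  fixes F :: "real ^ 'n \<Rightarrow> complex" and w :: "'n \<Rightarrow> real \<Rightarrow> real"
  assumes F: "integrable torus_measure F" "integrable torus_measure (difference h i F)"
    and w [measurable]: "\<And>j. w j \<in> borel_measurable borel" and bw: "\<And>j u. \<bar>w j u\<bar> \<le> 1"
    and sw: "\<And>j u. w j u \<noteq> 0 \<Longrightarrow> 0 \<le> u \<and> u \<le> 2 * pi"
    and sh: "\<And>u. w i (u - h) \<noteq> 0 \<Longrightarrow> 0 \<le> u \<and> u \<le> 2 * pi"
  shows "(\<integral>y. ((w i (y $ i) - w i (y $ i - h)) * (\<Prod>j\<in>UNIV - {i}. w j (y $ j))) *\<^sub>R F y \<partial>torus_measure)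
    = - (\<integral>y. (\<Prod>j\<in>UNIV. w j (y $ j)) *\<^sub>R difference h i F y \<partial>torus_measure)"
proof -
  define K where "K y = (\<Prod>j\<in>UNIV - {i}. w j (y $ j))" for y
  have [measurable]: "K \<in> borel_measurable borel" unfolding K_def by measurable
  have bK: "\<bar>K y\<bar> \<le> 1" for y
    unfolding K_def abs_prod by (intro prod_le_1) (auto simp: bw)
  have [measurable]: "F \<in> borel_measurable borel" using borel_measurable_integrable[OF F(1)] by simp
  have [measurable]: "w i \<in> borel_measurable borel" by simp
  have prod: "(\<Prod>j\<in>UNIV. w j (y $ j)) = w i (y $ i) * K y" for y
    unfolding K_def by (subst prod.remove[of _ i]) auto
  have Kshift: "K (y + axis i h) = K y" for y
    unfolding K_def by (intro prod.cong) (auto simp: axis_def)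
  have m1: "(\<lambda>y. w i (y $ i) * K y) \<in> borel_measurable borel" by measurable
  have b1: "\<bar>w i u * K y\<bar> \<le> 1" for u y
    unfolding abs_mult using bw[of i u] bK[of y] by (intro mult_le_one) auto
  have K0: "0 \<le> y $ j \<and> y $ j \<le> 2 * pi" if "K y \<noteq> 0" "j \<noteq> i" for y j
    using that sw[of j "y $ j"] by (auto simp: K_def)
  have supp: "y \<in> torus_box" if "(w i (y $ i) * K y) \<noteq> 0" for y
    unfolding mem_torus_box using that sw[of i] K0 by (metis mult_eq_0_iff)
  have supp': "y \<in> torus_box" if "(w i (y $ i - h) * K y) \<noteq> 0" for y
    unfolding mem_torus_box using that sh K0 by (metis mult_eq_0_iff)
  have i1: "integrable torus_measure (\<lambda>y. (w i (y $ i) * K y) *\<^sub>R F y)"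
    by (rule integrable_scaleR_bounded[OF F(1) m1 b1])
  have i2: "integrable torus_measure (\<lambda>y. (w i (y $ i - h) * K y) *\<^sub>R F y)"
    by (rule integrable_scaleR_bounded[OF F(1) _ b1]) measurable
  have i3: "integrable torus_measure (\<lambda>y. (w i (y $ i) * K y) *\<^sub>R difference h i F y)"
    by (rule integrable_scaleR_bounded[OF F(2) m1 b1])
  have shift: "(\<integral>y. (w i (y $ i - h) * K y) *\<^sub>R F y \<partial>torus_measure)
     = (\<integral>y. (w i (y $ i) * K y) *\<^sub>R F (y + axis i h) \<partial>torus_measure)"
  proof -
    let ?G = "\<lambda>y. (w i (y $ i - h) * K y) *\<^sub>R F y"
    have eq: "?G (y + axis i h) = (w i (y $ i) * K y) *\<^sub>R F (y + axis i h)" for y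
      by (simp add: Kshift)
    have "(\<integral>y. ?G (y + axis i h) \<partial>torus_measure) = (\<integral>y. ?G y \<partial>torus_measure)"
    proof (rule integral_torus_shift)
      show "?G \<in> borel_measurable borel" by measurable
      show "y \<in> torus_box" if "?G y \<noteq> 0" for y using that supp' by auto
      show "y \<in> torus_box" if "?G (y + axis i h) \<noteq> 0" for y using that supp unfolding eq by auto
    qed
    then show ?thesis unfolding eq by simp
  qed
  have "(\<integral>y. ((w i (y $ i) - w i (y $ i - h)) * K y) *\<^sub>R F y \<partial>torus_measure)
    = (\<integral>y. (w i (y $ i) * K y) *\<^sub>R F y \<partial>torus_measure) - (\<integral>y. (w i (y $ i - h) * K y) *\<^sub>R F y \<partial>torus_measure)"
    by (subst Bochner_Integration.integral_diff[OF i1 i2, symmetric]) (simp add: algebra_simps)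
  also have "\<dots> = - ((\<integral>y. (w i (y $ i) * K y) *\<^sub>R F (y + axis i h) \<partial>torus_measure) - (\<integral>y. (w i (y $ i) * K y) *\<^sub>R F y \<partial>torus_measure))"
    by (simp add: shift)
  also have "(\<integral>y. (w i (y $ i) * K y) *\<^sub>R F (y + axis i h) \<partial>torus_measure) =
     (\<integral>y. (w i (y $ i) * K y) *\<^sub>R difference h i F y + (w i (y $ i) * K y) *\<^sub>R F y \<partial>torus_measure)"
    by (intro Bochner_Integration.integral_cong refl) (simp add: difference_def algebra_simps)
  also have "\<dots> = (\<integral>y. (w i (y $ i) * K y) *\<^sub>R difference h i F y \<partial>torus_measure) + (\<integral>y. (w i (y $ i) * K y) *\<^sub>R F y \<partial>torus_measure)"
    by (rule Bochner_Integration.integral_add[OF i3 i1])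
  finally show ?thesis unfolding prod K_def[symmetric] by simp
qed

lemma in_dyad_support: "0 \<le> q \<Longrightarrow> q < 2 ^ k \<Longrightarrow> in_dyad k q u \<noteq> 0 \<Longrightarrow> 0 \<le> u \<and> u \<le> 2 * pi"
  using dyad_range[of k u] by (auto simp: in_dyad_def split: if_splits)

lemma sibling_range:
  assumes "k > 0" "0 \<le> q" "q < 2 ^ k"
  shows "0 \<le> sibling q" "sibling q < 2 ^ k"
proof -
  obtain l where k: "k = Suc l" using assms(1) by (cases k) auto
  show "0 \<le> sibling q" using assms by (cases "q = 0") (auto simp: sibling_def)
  show "sibling q < 2 ^ k" using assms unfolding k sibling_def
    by (auto elim!: evenE)
qed

abbreviation sibling_shift :: "('n \<Rightarrow> nat) \<Rightarrow> ('n \<Rightarrow> bool) \<Rightarrow> real ^ 'n" where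
  "sibling_shift s z \<equiv> \<chi> j. sibling_step (s j) (z j)"

text \<open>Coordinate by coordinate, the difference in the kernel is moved onto \<open>f\<close>
  and a plain indicator stays behind. The step depends on \<open>q\<close> only through the parities
  of its entries, so at most 2^d different functions occur on the right for one
  \<open>s\<close>.\<close>

lemma norm_haar_coef_le:
  fixes f :: "real ^ 'n \<Rightarrow> complex"
  assumes f: "mixed_smooth r 1 f" and q: "q \<in> cells s"
  shows "norm (haar_coef f s q) \<le> 2 ^ total s *
    (\<integral>y. indicator (cell_set s q) y * norm (mdiff (sibling_shift s (\<lambda>j. even (q j))) {j. s j > 0} f y) \<partial>torus_measure)"
proof -
  have [measurable]: "f \<in> borel_measurable borel" using f by (simp add: mixed_smooth_def)
  define t where "t = sibling_shift s (\<lambda>j. even (q j))"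
  define A where "A j = in_dyad (s j) (q j)" for j
  \<comment> \<open>The kernel without its factor \<open>2 ^ (s j - 1)\<close>. At level 0 it is an
    indicator already and no difference is taken.\<close>
  define B where "B j u = (if s j > 0 then A j u - A j (u - t $ j) else A j u)" for j u
  have [measurable]: "A j \<in> borel_measurable borel" for j by (simp add: A_def)
  have [measurable]: "B j \<in> borel_measurable borel" for j unfolding B_def[abs_def] by measurable
  have At: "A j (u - t $ j) = in_dyad (s j) (sibling (q j)) u" for j u
    by (simp add: A_def t_def in_dyad_sibling)
  have qr: "0 \<le> q j" "q j < 2 ^ s j" for j using q by (auto simp: cells_def)
  have sA: "0 \<le> u \<and> u \<le> 2 * pi" if "A j u \<noteq> 0" for j u
    using that in_dyad_support[OF qr[of j]] by (simp add: A_def)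
  have sA': "0 \<le> u \<and> u \<le> 2 * pi" if "A j (u - t $ j) \<noteq> 0" "s j > 0" for j u
    using that in_dyad_support[OF sibling_range[OF that(2) qr[of j]]] by (simp add: At)
  have bA: "\<bar>A j u\<bar> \<le> 1" for j u by (simp add: A_def in_dyad_def)
  have bB: "\<bar>B j u\<bar> \<le> 1" for j u by (simp add: B_def A_def in_dyad_def)
  have sB: "0 \<le> u \<and> u \<le> 2 * pi" if "B j u \<noteq> 0" for j u
    using that sA[of j u] sA'[of j u] by (cases "A j u = 0") (auto simp: B_def split: if_splits)
  let ?M = "\<lambda>e y. \<Prod>j\<in>UNIV. (if j \<in> e then A j else B j) (y $ j)"
  have main: "(\<integral>y. (\<Prod>j\<in>UNIV. B j (y $ j)) *\<^sub>R f y \<partial>torus_measure)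
     = (-1) ^ card e *\<^sub>R (\<integral>y. ?M e y *\<^sub>R mdiff t e f y \<partial>torus_measure)"
    if "e \<subseteq> {j. s j > 0}" for e
  proof -
    have "finite e" by simp
    then show ?thesis using that
    proof (induction e rule: finite_induct)
      case empty
      then show ?case by (simp add: mixed_difference_empty)
    next
      case (insert i e)
      define w where "w j = (if j \<in> insert i e then A j else B j)" for j
      have i: "s i > 0" using insert by auto
      have "?M e y =
        (w i (y $ i) - w i (y $ i - t $ i)) * (\<Prod>j\<in>UNIV - {i}. w j (y $ j))" for y
      proof -
        have "?M e y =
          (if i \<in> e then A i else B i) (y $ i) * (\<Prod>j\<in>UNIV - {i}. (if j \<in> e then A j else B j) (y $ j))"
          by (rule prod.remove) auto
        also have "(\<Prod>j\<in>UNIV - {i}. (if j \<in> e then A j else B j) (y $ j)) = (\<Prod>j\<in>UNIV - {i}. w j (y $ j))"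
          by (intro prod.cong) (auto simp: w_def)
        finally show ?thesis using insert i by (simp add: w_def B_def)
      qed
      moreover have "(\<integral>y. ((w i (y $ i) - w i (y $ i - t $ i)) * (\<Prod>j\<in>UNIV - {i}. w j (y $ j))) *\<^sub>R mdiff t e f y \<partial>torus_measure)
        = - (\<integral>y. (\<Prod>j\<in>UNIV. w j (y $ j)) *\<^sub>R difference (t $ i) i (mdiff t e f) y \<partial>torus_measure)"
      proof (rule integral_kernel_difference)
        show "integrable torus_measure (mdiff t e f)" by (rule mixed_smooth_mdiff_integrable[OF f])
        show "integrable torus_measure (difference (t $ i) i (mdiff t e f))"
          using mixed_smooth_mdiff_integrable[OF f, of t "insert i e"] by (simp only: mdiff_insert[OF insert.hyps(2)])
        show "w j \<in> borel_measurable borel" for j by (simp add: w_def)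
        show "\<bar>w j u\<bar> \<le> 1" for j u by (simp add: w_def bA bB)
        show "0 \<le> u \<and> u \<le> 2 * pi" if "w j u \<noteq> 0" for j u
          using that sA[of j u] sB[of j u] by (simp add: w_def split: if_splits)
        show "0 \<le> u \<and> u \<le> 2 * pi" if "w i (u - t $ i) \<noteq> 0" for u
          using that sA'[of i u] i by (simp add: w_def)
      qed
      ultimately have "(\<integral>y. ?M e y *\<^sub>R mdiff t e f y \<partial>torus_measure) =
        - (\<integral>y. (\<Prod>j\<in>UNIV. w j (y $ j)) *\<^sub>R mdiff t (insert i e) f y \<partial>torus_measure)"
        by (simp only: mdiff_insert[OF insert.hyps(2)])
      then show ?case
        using insert by (simp add: w_def)
    qed
  qed
  define c where "c j = (if s j > 0 then 2 ^ (s j - 1) else (1 :: real))" for j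
  have ker: "haar_kernel (s j) (q j) u = c j * B j u" for j u
    by (simp add: c_def B_def haar_kernel_pos haar_kernel_0 A_def t_def)
  define e where "e = {j. s j > 0}"
  have "haar_coef f s q = (\<Prod>j\<in>UNIV. c j) *\<^sub>R (\<integral>y. (\<Prod>j\<in>UNIV. B j (y $ j)) *\<^sub>R f y \<partial>torus_measure)"
    by (simp add: haar_coef_def ker prod.distrib flip: scaleR_scaleR)
  also have "(\<integral>y. (\<Prod>j\<in>UNIV. B j (y $ j)) *\<^sub>R f y \<partial>torus_measure) = (-1) ^ card e *\<^sub>R
     (\<integral>y. ?M e y *\<^sub>R mdiff t e f y \<partial>torus_measure)"
    by (rule main) (simp add: e_def)
  \<comment> \<open>All coordinates of positive level have been exchanged and those of level 0 were
    indicators from the start, so the product is the indicator of the cell.\<close>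
  also have "(\<lambda>y. ?M e y) = (\<lambda>y. indicator (cell_set s q) y)"
  proof
    fix y
    have "(if j \<in> e then A j else B j) (y $ j) = A j (y $ j)" for j by (simp add: e_def B_def)
    then show "?M e y = indicator (cell_set s q) y"
      by (auto simp: A_def in_dyad_def cell_set_def split: split_indicator)
  qed
  finally have "norm (haar_coef f s q) = (\<Prod>j\<in>UNIV. c j) * norm (\<integral>y. indicator (cell_set s q) y *\<^sub>R mdiff t e f y \<partial>torus_measure)"
    using prod_nonneg[of UNIV c] by (simp add: abs_mult power_abs c_def[abs_def])
  also have "\<dots> \<le> (\<Prod>j\<in>UNIV. c j) * (\<integral>y. norm (indicator (cell_set s q) y *\<^sub>R mdiff t e f y) \<partial>torus_measure)"
    by (intro mult_left_mono integral_norm_bound prod_nonneg) (auto simp: c_def)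
  also have "\<dots> = (\<Prod>j\<in>UNIV. c j) * (\<integral>y. indicator (cell_set s q) y * norm (mdiff t e f y) \<partial>torus_measure)"
    by simp
  also have "\<dots> \<le> (\<Prod>j\<in>UNIV. 2 ^ s j) * (\<integral>y. indicator (cell_set s q) y * norm (mdiff t e f y) \<partial>torus_measure)"
    by (intro mult_right_mono prod_mono integral_nonneg_AE) (auto simp: c_def intro: power_increasing)
  finally show ?thesis by (simp add: power_sum t_def e_def)
qed

text \<open>The choice a = X^(1/P) makes both terms equal. Used on each cell in place of Hoelder's
  inequality; X = 0 is separate because \<open>a\<close> must be positive, and there
  \<open>a\<close> tends to 0.\<close>

lemma powr_le_of_young:
  fixes N X P :: real
  assumes "N \<ge> 0" "X \<ge> 0" "P \<ge> 1" and le: "\<And>a. a > 0 \<Longrightarrow> N \<le> a + a powr (1 - P) * X"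
  shows "N powr P \<le> 2 powr P * X"
proof (cases "X = 0")
  case True
  have "N \<le> 0"
    by (rule field_le_epsilon) (use le True in auto)
  then show ?thesis using assms True by simp
next
  case False
  then have X: "X > 0" using assms by simp
  define a where "a = X powr (1 / P)"
  have "a powr (1 - P) * X = X powr ((1 - P) / P) * X powr 1" using X by (simp add: a_def powr_powr)
  also have "\<dots> = X powr ((1 - P) / P + 1)" by (simp only: powr_add)
  also have "(1 - P) / P + 1 = 1 / P" using assms by (simp add: field_simps)
  also have "X powr (1 / P) = a" by (simp add: a_def)
  finally have "N \<le> 2 * a" using le[of a] X by (simp add: a_def)
  then have "N powr P \<le> (2 * a) powr P" using assms by (intro powr_mono2) auto
  also have "\<dots> = 2 powr P * X" using X assms by (simp add: a_def powr_mult powr_powr)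
  finally show ?thesis .
qed

text \<open>2^d for the parity patterns, one 2 from \<open>mixed_smooth\<close>, one 2 from
  \<open>powr_le_of_young\<close>, and (2 pi)^d from the step sizes.\<close>

definition block_bound :: "'n::finite itself \<Rightarrow> real" where
  "block_bound _ = 2 ^ (CARD('n) + 2) * (2 * pi) ^ CARD('n)"

lemma block_bound_pos: "block_bound TYPE('n::finite) > 0"
  by (simp add: block_bound_def)

text \<open>On each cell the coefficient is an average of a difference of \<open>f\<close>, so its
  P-th power is controlled by the local integral of the P-th power. The cells are disjoint, so for
  one fixed difference the local integrals add up to at most the global one.\<close>

lemma sum_haar_coef_powr_le:
  fixes f :: "real ^ 'n \<Rightarrow> complex"
  assumes f: "mixed_smooth r 1 f" "mixed_smooth r P f" and P: "1 \<le> P" and r: "0 < r" "r < 1"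
  shows "(\<Sum>q\<in>cells s. norm (haar_coef f s q) powr P)
    \<le> 2 ^ total s * (block_bound TYPE('n) * 2 powr (- r * real (total s))) powr P"
proof -
  have [measurable]: "f \<in> borel_measurable borel" using f by (simp add: mixed_smooth_def)
  define n where "n = total s"
  define e where "e = {j. s j > 0}"
  define G where "G z y = norm (mdiff (sibling_shift s z) e f y)" for z y
  have [measurable]: "G z \<in> borel_measurable borel" for z unfolding G_def[abs_def] by measurable
  have G0: "G z y \<ge> 0" for z y by (simp add: G_def)
  define b where "b = (2 * pi) ^ CARD('n) * 2 powr (- r * real n)"
  have b: "b > 0" by (simp add: b_def)
  have step: "(\<Prod>j\<in>e. \<bar>sibling_shift s z $ j\<bar> powr r) \<le> b" for z
  proof -
    have "(\<Prod>j\<in>e. \<bar>sibling_shift s z $ j\<bar> powr r) \<le> (\<Prod>j\<in>e. 2 * pi * 2 powr (- r * real (s j)))"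
    proof (intro prod_mono conjI)
      fix j
      have "\<bar>sibling_shift s z $ j\<bar> = 2 * pi * 2 powr (- real (s j))"
        by (simp add: sibling_step_def powr_minus powr_realpow divide_inverse abs_mult)
      then have "\<bar>sibling_shift s z $ j\<bar> powr r = (2 * pi) powr r * 2 powr (- r * real (s j))"
        by (simp add: powr_mult powr_powr mult.commute)
      also have "(2 * pi) powr r \<le> (2 * pi) powr 1"
        using r pi_ge_two by (intro powr_mono) auto
      finally show "\<bar>sibling_shift s z $ j\<bar> powr r \<le> 2 * pi * 2 powr (- r * real (s j))"
        by simp
    qed simp
    \<comment> \<open>Coordinates of level 0 are added with factors 2 pi \<ge> 1, after which the
      bound depends on \<open>s\<close> only through \<open>total s\<close>.\<close>
    also have "\<dots> \<le> (\<Prod>j\<in>UNIV. 2 * pi * 2 powr (- r * real (s j)))"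
    proof (rule prod_mono2)
      fix j assume "j \<in> UNIV - e"
      then have "s j = 0" by (simp add: e_def)
      then show "1 \<le> 2 * pi * 2 powr (- r * real (s j))" using pi_ge_two by simp
    qed auto
    also have "\<dots> = b"
      by (simp add: b_def n_def prod.distrib powr_sum[symmetric] sum_distrib_left)
    finally show ?thesis .
  qed
  have nnG: "(\<integral>\<^sup>+y. ennreal (G z y powr P) \<partial>torus_measure) \<le> ennreal (2 * b powr P)" for z
    using f(2) b step[of z] unfolding mixed_smooth_def G_def by blast
  have iG: "integrable torus_measure (\<lambda>y. G z y powr P)" for z
    by (rule integrableI_bounded) (use nnG[of z] in \<open>auto simp: le_less_trans[OF _ ennreal_less_top]\<close>)
  have IG: "(\<integral>y. G z y powr P \<partial>torus_measure) \<le> 2 * b powr P" for z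
    using nnG[of z] nn_integral_eq_integral[OF iG[of z]] by simp
  have iG1: "integrable torus_measure (G z)" for z
    unfolding G_def by (intro integrable_norm mixed_smooth_mdiff_integrable[OF f(1)])
  define p where "p q = (\<lambda>j. even (q j))" for q :: "'n \<Rightarrow> int"
  define D where "D q = (\<integral>y. indicator (cell_set s q) y * G (p q) y powr P \<partial>torus_measure)" for q
  have iD: "integrable torus_measure (\<lambda>y. indicator (cell_set s q) y * G z y powr P)" for q z
    using integrable_mult_indicator[OF _ iG[of z], of "cell_set s q"] by simp
  have D0: "D q \<ge> 0" for q unfolding D_def by (intro integral_nonneg_AE AE_I2) simp
  have coef: "norm (haar_coef f s q) powr P \<le> 2 powr P * (2 ^ n * D q)" if q: "q \<in> cells s" for q
  proof (rule powr_le_of_young)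
    fix a :: real assume a: "a > 0"
    have pt: "x \<le> a + a powr (1 - P) * x powr P" if "x \<ge> 0" for x
    proof (cases "x \<le> a")
      case False
      then have x: "x > a" "x > 0" using a by auto
      have "x = x powr (1 - P) * x powr P" using x by (simp add: powr_add[symmetric])
      also have "\<dots> \<le> a powr (1 - P) * x powr P"
        using x a P by (intro mult_right_mono powr_mono2') auto
      finally show ?thesis using a by linarith
    qed (simp add: add_increasing2)
    have i1: "integrable torus_measure (\<lambda>y::real ^ 'n. a * indicator (cell_set s q) y)"
      by (intro integrable_mult_right integrable_real_indicator) (auto simp: torus.emeasure_finite less_top[symmetric])
    have i2: "integrable torus_measure (\<lambda>y. a powr (1 - P) * (indicator (cell_set s q) y * G (p q) y powr P))"
      by (intro integrable_mult_right iD)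
    have "(\<integral>y. indicator (cell_set s q) y * G (p q) y \<partial>torus_measure)
      \<le> (\<integral>y. a * indicator (cell_set s q) y + a powr (1 - P) * (indicator (cell_set s q) y * G (p q) y powr P) \<partial>torus_measure)"
    proof (rule integral_mono)
      show "integrable torus_measure (\<lambda>y. indicator (cell_set s q) y * G (p q) y)"
        using integrable_mult_indicator[OF _ iG1[of "p q"], of "cell_set s q"] by simp
      show "integrable torus_measure (\<lambda>y. a * indicator (cell_set s q) y + a powr (1 - P) * (indicator (cell_set s q) y * G (p q) y powr P))"
        by (rule Bochner_Integration.integrable_add[OF i1 i2])
      show "indicator (cell_set s q) y * G (p q) y \<le> a * indicator (cell_set s q) y + a powr (1 - P) * (indicator (cell_set s q) y * G (p q) y powr P)" for y
        using pt[OF G0[of "p q" y]] by (simp split: split_indicator)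
    qed
    also have "\<dots> = a * measure torus_measure (cell_set s q) + a powr (1 - P) * D q"
      by (subst Bochner_Integration.integral_add[OF i1 i2]) (simp add: D_def)
    also have "measure torus_measure (cell_set s q) = 1 / 2 ^ n"
      unfolding n_def by (rule measure_cell_set[OF q])
    finally have "2 ^ n * (\<integral>y. indicator (cell_set s q) y * G (p q) y \<partial>torus_measure) \<le> 2 ^ n * (a * (1 / 2 ^ n) + a powr (1 - P) * D q)"
      by (intro mult_left_mono) auto
    then show "norm (haar_coef f s q) \<le> a + a powr (1 - P) * (2 ^ n * D q)"
      using norm_haar_coef_le[OF f(1) q] by (simp add: n_def[symmetric] G_def p_def e_def distrib_left mult_ac)
  qed (use P D0 in auto)
  have disj: "(\<Sum>q\<in>cells s. indicator (cell_set s q) y) \<le> (1 :: real)" for y :: "real ^ 'n"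
  proof -
    have "(\<Sum>q\<in>cells s. indicator (cell_set s q) y) = (\<Sum>q\<in>cells s. if q = (\<lambda>j. dyad (s j) (y $ j)) then 1 else (0::real))"
      by (intro sum.cong refl) (auto simp: cell_set_def fun_eq_iff split: split_indicator)
    also have "\<dots> \<le> 1" by (subst sum.delta) auto
    finally show ?thesis .
  qed
  \<comment> \<open>The difference in \<open>D q\<close> varies with the parity pattern of
    \<open>q\<close>. Summing over all patterns \<open>z\<close> frees the function from
    \<open>q\<close>, so the sum over cells can be taken inside the integral.\<close>
  have "(\<Sum>q\<in>cells s. D q) \<le> (\<Sum>q\<in>cells s. \<Sum>z\<in>UNIV. \<integral>y. indicator (cell_set s q) y * G z y powr P \<partial>torus_measure)"
  proof (rule sum_mono)
    fix q
    show "D q \<le> (\<Sum>z\<in>UNIV. \<integral>y. indicator (cell_set s q) y * G z y powr P \<partial>torus_measure)"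
      unfolding D_def by (rule member_le_sum[of "p q" UNIV]) (auto intro!: integral_nonneg_AE AE_I2)
  qed
  also have "\<dots> = (\<Sum>z\<in>UNIV. \<Sum>q\<in>cells s. \<integral>y. indicator (cell_set s q) y * G z y powr P \<partial>torus_measure)"
    by (rule sum.swap)
  also have "\<dots> \<le> (\<Sum>z\<in>(UNIV :: ('n \<Rightarrow> bool) set). 2 * b powr P)"
  proof (rule sum_mono)
    fix z
    have "(\<Sum>q\<in>cells s. \<integral>y. indicator (cell_set s q) y * G z y powr P \<partial>torus_measure)
      = (\<integral>y. (\<Sum>q\<in>cells s. indicator (cell_set s q) y * G z y powr P) \<partial>torus_measure)"
      by (rule Bochner_Integration.integral_sum[symmetric]) (rule iD)
    also have "\<dots> \<le> (\<integral>y. G z y powr P \<partial>torus_measure)"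
    proof (rule integral_mono)
      show "integrable torus_measure (\<lambda>y. \<Sum>q\<in>cells s. indicator (cell_set s q) y * G z y powr P)"
        by (intro Bochner_Integration.integrable_sum iD)
      show "(\<Sum>q\<in>cells s. indicator (cell_set s q) y * G z y powr P) \<le> G z y powr P" for y
        unfolding sum_distrib_right[symmetric]
        using mult_right_mono[OF disj[of y], of "G z y powr P"] by simp
    qed (rule iG)
    also have "\<dots> \<le> 2 * b powr P" by (rule IG)
    finally show "(\<Sum>q\<in>cells s. \<integral>y. indicator (cell_set s q) y * G z y powr P \<partial>torus_measure) \<le> 2 * b powr P" .
  qed
  also have "\<dots> = 2 ^ CARD('n) * (2 * b powr P)" by (simp add: card_fun)
  finally have SD: "(\<Sum>q\<in>cells s. D q) \<le> 2 ^ (CARD('n) + 1) * b powr P" by simp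
  have "(\<Sum>q\<in>cells s. norm (haar_coef f s q) powr P) \<le> (\<Sum>q\<in>cells s. 2 powr P * (2 ^ n * D q))"
    by (intro sum_mono coef)
  also have "\<dots> = 2 powr P * 2 ^ n * (\<Sum>q\<in>cells s. D q)" by (simp only: sum_distrib_left mult.assoc)
  also have "\<dots> \<le> 2 powr P * 2 ^ n * (2 ^ (CARD('n) + 1) * b powr P)"
    by (intro mult_left_mono SD) auto
  \<comment> \<open>The constant is replaced by its P-th power so that everything except 2^n stands
    under the exponent P.\<close>
  also have "\<dots> \<le> 2 powr P * 2 ^ n * ((2 ^ (CARD('n) + 1)) powr P * b powr P)"
  proof (intro mult_left_mono mult_right_mono)
    have "(2 ^ (CARD('n) + 1)) powr 1 \<le> (2 ^ (CARD('n) + 1) :: real) powr P"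
      using P by (intro powr_mono one_le_power) auto
    then show "2 ^ (CARD('n) + 1) \<le> (2 ^ (CARD('n) + 1) :: real) powr P" by simp
  qed auto
  also have "\<dots> = 2 ^ n * (2 * 2 ^ (CARD('n) + 1) * b) powr P"
  proof -
    have "2 powr P * N * (Q powr P * b powr P) = N * (2 * Q * b) powr P" if "Q > 0" for N Q :: real
      using that b by (simp add: powr_mult)
    from this[of "2 ^ (CARD('n) + 1)" "2 ^ n"] show ?thesis by simp
  qed
  also have "2 * 2 ^ (CARD('n) + 1) * b = block_bound TYPE('n) * 2 powr (- r * real n)"
    by (simp add: block_bound_def b_def)
  finally show ?thesis by (simp only: n_def)
qed

section \<open>Dyadic blocks\<close>

text \<open>The reduction modulo the number of intervals wraps the index back to the box; every
  function of \<open>cell_of s\<close> is therefore periodic.\<close>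

definition cell_of :: "('n \<Rightarrow> nat) \<Rightarrow> real ^ 'n \<Rightarrow> 'n \<Rightarrow> int" where
  "cell_of s x = (\<lambda>j. dyad (s j) (x $ j) mod 2 ^ s j)"

lemma cell_of_in_cells: "cell_of s x \<in> cells s"
  by (simp add: cell_of_def cells_def)

definition haar_block :: "(real ^ 'n \<Rightarrow> complex) \<Rightarrow> ('n \<Rightarrow> nat) \<Rightarrow> real ^ 'n \<Rightarrow> complex" where
  "haar_block f s x = haar_coef f s (cell_of s x)"

definition cell_average :: "(real ^ 'n \<Rightarrow> complex) \<Rightarrow> nat \<Rightarrow> real ^ 'n \<Rightarrow> complex" where
  "cell_average f K x = (\<integral>y. (2 ^ (K * CARD('n)) * indicator (cell_set (\<lambda>_. K) (cell_of (\<lambda>_. K) x)) y) *\<^sub>R f y \<partial>torus_measure)"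

lemma dyad_mod_Suc_div_2: "(dyad (Suc k) u mod 2 ^ Suc k) div 2 = dyad k u mod 2 ^ k"
proof -
  have "dyad (Suc k) u mod (2 * 2 ^ k) = 2 * (dyad (Suc k) u div 2 mod 2 ^ k) + dyad (Suc k) u mod 2"
    by (rule zmod_zmult2_eq) simp
  then show ?thesis by (simp add: dyad_Suc_div_2)
qed

lemma sum_haar_kernel:
  "(\<Sum>k\<le>K. haar_kernel k (dyad k u mod 2 ^ k) v) = 2 ^ K * in_dyad K (dyad K u mod 2 ^ K) v"
proof (induction K)
  case 0
  then show ?case by (simp add: haar_kernel_0)
next
  case (Suc K)
  have "haar_kernel (Suc K) (dyad (Suc K) u mod 2 ^ Suc K) v =
    2 ^ Suc K * in_dyad (Suc K) (dyad (Suc K) u mod 2 ^ Suc K) v - 2 ^ K * in_dyad K (dyad K u mod 2 ^ K) v"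
    by (simp only: haar_kernel_def dyad_mod_Suc_div_2) simp
  then show ?case using Suc by simp
qed

text \<open>The sum over a cube of level vectors factors into one sum per coordinate, and each of
  these telescopes to the averaging kernel of level \<open>K\<close>.\<close>

lemma sum_haar_block:
  fixes f :: "real ^ 'n \<Rightarrow> complex"
  assumes f: "integrable torus_measure f"
  shows "(\<Sum>s\<in>PiE UNIV (\<lambda>_. {..K}). haar_block f s x) = cell_average f K x"
proof -
  have bk: "\<bar>haar_kernel k q u\<bar> \<le> 2 ^ K * 2" if "k \<le> K" for k q u
  proof -
    have "\<bar>haar_kernel k q u\<bar> \<le> \<bar>2 ^ k * in_dyad k q u\<bar> + \<bar>if k = 0 then 0 else 2 ^ (k - 1) * in_dyad (k - 1) (q div 2) u\<bar>"
      unfolding haar_kernel_def by (rule abs_triangle_ineq4)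
    also have "\<dots> \<le> 2 ^ K + 2 ^ K"
      using that by (intro add_mono) (auto simp: in_dyad_def power_increasing)
    finally show ?thesis by simp
  qed
  have int: "integrable torus_measure (\<lambda>y. (\<Prod>j\<in>UNIV. haar_kernel (s j) (cell_of s x j) (y $ j)) *\<^sub>R f y)"
    if "s \<in> PiE UNIV (\<lambda>_. {..K})" for s
  proof (rule integrable_scaleR_bounded[OF f])
    show "(\<lambda>y. \<Prod>j\<in>UNIV. haar_kernel (s j) (cell_of s x j) (y $ j)) \<in> borel_measurable borel"
      by measurable
    show "\<bar>\<Prod>j\<in>UNIV. haar_kernel (s j) (cell_of s x j) (y $ j)\<bar> \<le> (\<Prod>j\<in>(UNIV::'n set). 2 ^ K * 2)" for y
      unfolding abs_prod using that by (intro prod_mono) (auto intro!: bk)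
  qed
  have "(\<Sum>s\<in>PiE UNIV (\<lambda>_. {..K}). haar_block f s x) =
    (\<integral>y. (\<Sum>s\<in>PiE UNIV (\<lambda>_. {..K}). (\<Prod>j\<in>UNIV. haar_kernel (s j) (cell_of s x j) (y $ j)) *\<^sub>R f y) \<partial>torus_measure)"
    unfolding haar_block_def haar_coef_def
    by (rule Bochner_Integration.integral_sum[symmetric]) (rule int)
  also have "(\<lambda>y. \<Sum>s\<in>PiE UNIV (\<lambda>_. {..K}). (\<Prod>j\<in>UNIV. haar_kernel (s j) (cell_of s x j) (y $ j)) *\<^sub>R f y)
    = (\<lambda>y. (2 ^ (K * CARD('n)) * indicator (cell_set (\<lambda>_. K) (cell_of (\<lambda>_. K) x)) y) *\<^sub>R f y)"
  proof
    fix y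
    have "(\<Sum>s\<in>PiE UNIV (\<lambda>_. {..K}). \<Prod>j\<in>UNIV. haar_kernel (s j) (cell_of s x j) (y $ j))
      = (\<Prod>j\<in>UNIV. \<Sum>k\<le>K. haar_kernel k (dyad k (x $ j) mod 2 ^ k) (y $ j))"
      unfolding cell_of_def by (rule prod_sum_PiE[symmetric]) auto
    also have "\<dots> = (\<Prod>j\<in>UNIV. 2 ^ K * in_dyad K (dyad K (x $ j) mod 2 ^ K) (y $ j))"
      by (simp only: sum_haar_kernel)
    also have "\<dots> = 2 ^ (K * CARD('n)) * (\<Prod>j\<in>UNIV. in_dyad K (dyad K (x $ j) mod 2 ^ K) (y $ j))"
      by (simp add: prod.distrib power_mult)
    also have "(\<Prod>j\<in>UNIV. in_dyad K (dyad K (x $ j) mod 2 ^ K) (y $ j)) = indicator (cell_set (\<lambda>_. K) (cell_of (\<lambda>_. K) x)) y"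
      by (auto simp: in_dyad_def cell_set_def cell_of_def split: split_indicator)
    finally show "(\<Sum>s\<in>PiE UNIV (\<lambda>_. {..K}). (\<Prod>j\<in>UNIV. haar_kernel (s j) (cell_of s x j) (y $ j)) *\<^sub>R f y)
      = (2 ^ (K * CARD('n)) * indicator (cell_set (\<lambda>_. K) (cell_of (\<lambda>_. K) x)) y) *\<^sub>R f y"
      by (simp only: scaleR_sum_left[symmetric])
  qed
  finally show ?thesis by (simp add: cell_average_def)
qed

lemma cell_of_measurable [measurable]: "(\<lambda>x. F (cell_of s x)) \<in> borel_measurable (borel :: (real ^ 'n::finite) measure)"
  for F :: "('n::finite \<Rightarrow> int) \<Rightarrow> complex"
proof -
  have eq: "F (cell_of s x) = (\<Sum>q\<in>cells s. F q * indicator {x. cell_of s x = q} x)" for x :: "real ^ 'n"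
  proof -
    have "F (cell_of s x) = (\<Sum>q\<in>cells s. if q = cell_of s x then F q else 0)"
      by (simp add: sum.delta cell_of_in_cells)
    also have "\<dots> = (\<Sum>q\<in>cells s. F q * indicator {x. cell_of s x = q} x)"
      by (intro sum.cong) (auto simp: indicator_def)
    finally show ?thesis .
  qed
  have [measurable]: "{x :: real ^ 'n. cell_of s x = q} \<in> sets borel" for q
  proof -
    have "{x :: real ^ 'n. cell_of s x = q} = (\<Inter>j. {y \<in> space borel. dyad (s j) (y $ j) mod 2 ^ s j = q j})"
      by (auto simp: cell_of_def)
    also have "\<dots> \<in> sets borel"
    proof (intro sets.countable_INT'')
      fix j
      have "(\<lambda>y :: real ^ 'n. dyad (s j) (y $ j) mod 2 ^ s j) \<in> measurable borel (count_space UNIV)"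
        by (rule measurable_compose[OF measurable_compose[OF _ dyad_measurable]]) auto
      then show "{y \<in> space borel. dyad (s j) ((y :: real ^ 'n) $ j) mod 2 ^ s j = q j} \<in> sets borel"
        by measurable
    qed auto
    finally show ?thesis .
  qed
  show ?thesis unfolding eq by measurable
qed

lemma haar_block_measurable [measurable]: "haar_block f s \<in> borel_measurable borel"
  unfolding haar_block_def[abs_def] by (rule cell_of_measurable[where F = "haar_coef f s" and s = s])

lemma cell_average_measurable [measurable]: "cell_average (f :: real ^ 'n \<Rightarrow> complex) K \<in> borel_measurable borel"
proof -
  define F where "F q = (\<integral>y. (2 ^ (K * CARD('n)) * indicator (cell_set (\<lambda>_. K) q) y) *\<^sub>R f y \<partial>torus_measure)" for q
  have "cell_average f K = (\<lambda>x. F (cell_of (\<lambda>_. K) x))"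
    by (simp add: fun_eq_iff cell_average_def F_def)
  then show ?thesis using cell_of_measurable[where F = F and s = "\<lambda>_. K"] by simp
qed

section \<open>Cell averages approximate the function\<close>

lemma AE_torus_unit_cell: "AE x in torus_measure. \<forall>j. dyad 0 ((x :: real ^ 'n) $ j) = 0"
proof -
  \<comment> \<open>The cell of level 0 is half-open and the box closed; they differ by a null
    set.\<close>
  have "measure torus_measure (cell_set (\<lambda>_. 0) (\<lambda>_. 0) :: (real ^ 'n) set) = 1"
    by (subst measure_cell_set) (auto simp: cells_def)
  then have "AE x in torus_measure. x \<in> (cell_set (\<lambda>_. 0) (\<lambda>_. 0) :: (real ^ 'n) set)"
    by (rule torus.AE_prob_1)
  then show ?thesis by (simp add: cell_set_def)
qed

lemma dyad_mod_eq:
  assumes "dyad 0 u = 0"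
  shows "dyad k u mod 2 ^ k = dyad k u"
proof -
  have "dyad k u div 2 ^ k = dyad 0 u"
  proof (induction k)
    case (Suc k)
    have "dyad (Suc k) u div 2 ^ Suc k = dyad (Suc k) u div 2 div 2 ^ k"
      by (simp add: zdiv_zmult2_eq)
    then show ?case using Suc by (simp only: dyad_Suc_div_2)
  qed simp
  then show ?thesis using assms by (simp add: minus_div_mult_eq_mod[symmetric])
qed

text \<open>The change under a shift is the sum of the mixed differences over nonempty sets. Each
  has at least one factor h^r, and its other factors are at most 1 because
  \<open>h \<le> 1\<close>.\<close>

lemma nn_integral_shift_difference_le:
  fixes f :: "real ^ 'n \<Rightarrow> complex"
  assumes f: "mixed_smooth r 1 f" and r: "0 < r" and h: "0 < h" "h \<le> 1" and t: "\<And>j. \<bar>t $ j\<bar> \<le> h"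
  shows "(\<integral>\<^sup>+x. ennreal (norm (f x - f (x + t))) \<partial>torus_measure) \<le> ennreal (2 ^ (CARD('n) + 1) * h powr r)"
proof -
  have [measurable]: "f \<in> borel_measurable borel" using f by (simp add: mixed_smooth_def)
  let ?E = "Pow UNIV - {{}} :: 'n set set"
  have eq: "f x - f (x + t) = - (\<Sum>e\<in>?E. mdiff t e f x)" for x
  proof -
    have "x + t = x + (\<Sum>j\<in>UNIV. axis j (t $ j))"
      by (simp add: vec_eq_iff axis_def sum.delta)
    then have "f (x + t) = (\<Sum>e\<in>Pow UNIV. mdiff t e f x)"
      by (simp only: shift_eq_sum_mdiff)
    also have "\<dots> = mdiff t {} f x + (\<Sum>e\<in>?E. mdiff t e f x)"
      by (rule sum.remove) auto
    finally show ?thesis by (simp add: mixed_difference_empty)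
  qed
  have "(\<integral>\<^sup>+x. ennreal (norm (f x - f (x + t))) \<partial>torus_measure) \<le> (\<integral>\<^sup>+x. (\<Sum>e\<in>?E. ennreal (norm (mdiff t e f x))) \<partial>torus_measure)"
    unfolding eq norm_minus_cancel by (intro nn_integral_mono) (auto intro!: ennreal_leI norm_sum)
  also have "\<dots> = (\<Sum>e\<in>?E. \<integral>\<^sup>+x. ennreal (norm (mdiff t e f x)) \<partial>torus_measure)"
    by (rule nn_integral_sum) measurable
  also have "\<dots> \<le> (\<Sum>e\<in>?E. ennreal (2 * h powr r))"
  proof (rule sum_mono)
    fix e assume "e \<in> ?E"
    then obtain i where i: "i \<in> e" by auto
    have h1: "h powr r \<le> 1" using h r powr_mono2[of r h 1] by simp
    have tj: "\<bar>t $ j\<bar> powr r \<le> h powr r" for j using t[of j] r by (intro powr_mono2) auto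
    have "(\<Prod>j\<in>e. \<bar>t $ j\<bar> powr r) = \<bar>t $ i\<bar> powr r * (\<Prod>j\<in>e - {i}. \<bar>t $ j\<bar> powr r)"
      by (rule prod.remove) (use i in auto)
    also have "\<dots> \<le> h powr r * 1"
      using h1 tj by (intro mult_mono prod_le_1) (auto intro: order_trans prod_nonneg)
    finally have "(\<integral>\<^sup>+x. ennreal (norm (mdiff t e f x) powr 1) \<partial>torus_measure) \<le> ennreal (2 * (h powr r) powr 1)"
      using f h unfolding mixed_smooth_def by simp
    then show "(\<integral>\<^sup>+x. ennreal (norm (mdiff t e f x)) \<partial>torus_measure) \<le> ennreal (2 * h powr r)" by simp
  qed
  also have "\<dots> = ennreal (of_nat (card ?E) * (2 * h powr r))"
    by (simp add: ennreal_of_nat_eq_real_of_nat ennreal_mult[symmetric])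
  also have "\<dots> \<le> ennreal (2 ^ CARD('n) * (2 * h powr r))"
  proof (intro ennreal_leI mult_right_mono)
    have "card ?E \<le> card (Pow (UNIV :: 'n set))" by (intro card_mono) auto
    also have "\<dots> = 2 ^ CARD('n)" by (rule card_Pow) simp
    finally show "real (card ?E) \<le> 2 ^ CARD('n)" by (metis of_nat_le_iff of_nat_numeral of_nat_power)
  qed auto
  finally show ?thesis by (simp add: mult_ac)
qed

text \<open>Points of one cell differ by at most \<open>h\<close> in each coordinate, so the average
  over a cell is dominated by one over shifts in a cube of side 2 h, whose volume is 2^d times that
  of the cell. Fubini leaves the L_1 change under each fixed shift. \<open>3 \<le> K\<close> ensures
  \<open>h \<le> 1\<close>, as 2 pi \<le> 8.\<close>

lemma cell_average_error:
  fixes f :: "real ^ 'n \<Rightarrow> complex"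
  assumes f: "mixed_smooth r 1 f" and r: "0 < r" and K: "3 \<le> K"
  shows "(\<integral>\<^sup>+x. ennreal (norm (f x - cell_average f K x)) \<partial>torus_measure)
    \<le> ennreal (2 ^ (2 * CARD('n) + 1) * (2 * pi / 2 ^ K) powr r)"
proof -
  have [measurable]: "f \<in> borel_measurable borel" using f by (simp add: mixed_smooth_def)
  have fi: "integrable torus_measure f"
    using mixed_smooth_mdiff_integrable[OF f, of _ "{}"] by (simp add: mixed_difference_empty)
  define h where "h = 2 * pi / 2 ^ K"
  have h0: "0 < h" by (simp add: h_def)
  have h1: "h \<le> 1"
  proof -
    have "2 * pi \<le> (2 :: real) ^ 3" using pi_less_4 by simp
    also have "\<dots> \<le> 2 ^ K" using K by (intro power_increasing) auto
    finally show ?thesis by (simp add: h_def)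
  qed
  define N :: real where "N = 2 ^ (K * CARD('n))"
  define V :: real where "V = (2 * pi) ^ CARD('n)"
  have NV: "N > 0" "V > 0" by (auto simp: N_def V_def)
  define Q where "Q = (cbox (\<chi> j. - h) (\<chi> j. h) :: (real ^ 'n) set)"
  have [measurable]: "Q \<in> sets borel" by (simp add: Q_def)
  have eQ: "emeasure lborel Q = ennreal ((2 * h) ^ CARD('n))"
    unfolding Q_def by (subst emeasure_cbox_cart) (use h0 in auto)
  let ?I = "\<lambda>x. \<integral>\<^sup>+t. ennreal (norm (f x - f (x + t))) * indicator Q t \<partial>lborel"
  have pt: "ennreal (norm (f x - cell_average f K x)) \<le>
    ennreal (N / V) * ?I x"
    if x: "\<forall>j. dyad 0 (x $ j) = 0" for x
  proof -
    define c where "c = cell_of (\<lambda>_. K) x"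
    define C where "C = (cell_set (\<lambda>_. K) c :: (real ^ 'n) set)"
    have [measurable]: "C \<in> sets borel" by (simp add: C_def)
    have c: "c \<in> cells (\<lambda>_. K)" by (simp add: c_def cell_of_in_cells)
    have mC: "measure torus_measure C = 1 / N"
      unfolding C_def by (subst measure_cell_set[OF c]) (simp add: N_def mult.commute)
    have i1: "integrable torus_measure (\<lambda>y. (N * indicator C y) *\<^sub>R f x)"
      by (intro integrable_scaleR_left integrable_mult_right integrable_real_indicator)
        (auto simp: torus.emeasure_finite less_top[symmetric])
    have i2: "integrable torus_measure (\<lambda>y. (N * indicator C y) *\<^sub>R f y)"
      by (rule integrable_scaleR_bounded[OF fi, where c = N]) (use NV in \<open>auto split: split_indicator\<close>)
    have "(\<integral>y. (N * indicator C y) *\<^sub>R f x \<partial>torus_measure) = f x"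
      by (subst integral_scaleR_left) (use NV in \<open>auto simp: mC intro!: integrable_mult_right integrable_real_indicator simp: torus.emeasure_finite less_top[symmetric]\<close>)
    then have "f x - cell_average f K x = (\<integral>y. (N * indicator C y) *\<^sub>R f x \<partial>torus_measure) - (\<integral>y. (N * indicator C y) *\<^sub>R f y \<partial>torus_measure)"
      by (simp add: cell_average_def C_def c_def N_def)
    also have "\<dots> = (\<integral>y. (N * indicator C y) *\<^sub>R f x - (N * indicator C y) *\<^sub>R f y \<partial>torus_measure)"
      by (rule Bochner_Integration.integral_diff[OF i1 i2, symmetric])
    finally have "ennreal (norm (f x - cell_average f K x)) \<le>
       (\<integral>\<^sup>+y. ennreal (norm ((N * indicator C y) *\<^sub>R f x - (N * indicator C y) *\<^sub>R f y)) \<partial>torus_measure)"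
      using integral_norm_bound_ennreal[OF Bochner_Integration.integrable_diff[OF i1 i2]] by simp
    also have "\<dots> = (\<integral>\<^sup>+y. ennreal N * (ennreal (norm (f x - f y)) * indicator C y) \<partial>torus_measure)"
      using NV by (intro nn_integral_cong)
        (auto split: split_indicator simp: ennreal_mult[symmetric] scaleR_diff_right[symmetric])
    also have "\<dots> = ennreal N * (\<integral>\<^sup>+y. ennreal (norm (f x - f y)) * indicator C y \<partial>torus_measure)"
      by (rule nn_integral_cmult) measurable
    also have "(\<integral>\<^sup>+y. ennreal (norm (f x - f y)) * indicator C y \<partial>torus_measure) =
       ennreal (1 / V) * (\<integral>\<^sup>+y. ennreal (norm (f x - f y)) * indicator C y * indicator torus_box y \<partial>lborel)"
      unfolding V_def by (rule nn_integral_torus) measurable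
    also have "(\<integral>\<^sup>+y. ennreal (norm (f x - f y)) * indicator C y * indicator torus_box y \<partial>lborel)
      \<le> (\<integral>\<^sup>+y. ennreal (norm (f x - f y)) * indicator Q (y - x) \<partial>lborel)"
    proof (rule nn_integral_mono)
      fix y
      have "y - x \<in> Q" if "y \<in> C"
      proof -
        have "\<bar>y $ j - x $ j\<bar> \<le> h" for j
        proof -
          have "dyad K (y $ j) = dyad K (x $ j)"
            using that x dyad_mod_eq[of "x $ j" K] by (simp add: C_def c_def cell_set_def cell_of_def)
          then obtain q where "dyad K (y $ j) = q" "dyad K (x $ j) = q" by blast
          then have "2 * pi * of_int q / 2 ^ K \<le> y $ j \<and> y $ j < 2 * pi * (of_int q + 1) / 2 ^ K"
            "2 * pi * of_int q / 2 ^ K \<le> x $ j \<and> x $ j < 2 * pi * (of_int q + 1) / 2 ^ K"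
            unfolding dyad_eq_iff by auto
          moreover have "2 * pi * (of_int q + 1) / 2 ^ K = 2 * pi * of_int q / 2 ^ K + h"
            by (simp add: h_def add_divide_distrib[symmetric] distrib_left)
          ultimately show ?thesis by linarith
        qed
        then show ?thesis by (auto simp: Q_def mem_box_cart abs_le_iff) (metis minus_le_iff minus_diff_eq)
      qed
      then show "ennreal (norm (f x - f y)) * indicator C y * indicator torus_box y \<le> ennreal (norm (f x - f y)) * indicator Q (y - x)"
        by (auto split: split_indicator)
    qed
    also have "(\<integral>\<^sup>+y. ennreal (norm (f x - f y)) * indicator Q (y - x) \<partial>lborel) =
      (\<integral>\<^sup>+y. ennreal (norm (f x - f y)) * indicator Q (y - x) \<partial>distr lborel borel ((+) x))"
      by (simp add: lborel_distr_plus)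
    also have "\<dots> = ?I x"
      by (subst nn_integral_distr) auto
    finally show ?thesis using NV
      by (simp add: mult.assoc[symmetric] ennreal_mult[symmetric] mult_left_mono)
  qed
  interpret P: pair_sigma_finite "torus_measure :: (real ^ 'n) measure" "lborel :: (real ^ 'n) measure"
    by standard
  have "(\<integral>\<^sup>+x. ennreal (norm (f x - cell_average f K x)) \<partial>torus_measure)
    \<le> (\<integral>\<^sup>+x. ennreal (N / V) * ?I x \<partial>torus_measure)"
    by (rule nn_integral_mono_AE) (use AE_torus_unit_cell in eventually_elim, rule pt)
  also have "\<dots> = ennreal (N / V) * (\<integral>\<^sup>+x. ?I x \<partial>torus_measure)"
    by (rule nn_integral_cmult) measurable
  also have "(\<integral>\<^sup>+x. ?I x \<partial>torus_measure)
    = (\<integral>\<^sup>+t. (\<integral>\<^sup>+x. ennreal (norm (f x - f (x + t))) * indicator Q t \<partial>torus_measure) \<partial>lborel)"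
    by (rule P.Fubini'[symmetric]) measurable
  also have "\<dots> \<le> (\<integral>\<^sup>+t. ennreal (2 ^ (CARD('n) + 1) * h powr r) * indicator Q (t :: real ^ 'n) \<partial>lborel)"
  proof (rule nn_integral_mono)
    fix t :: "real ^ 'n"
    show "(\<integral>\<^sup>+x. ennreal (norm (f x - f (x + t))) * indicator Q t \<partial>torus_measure) \<le> ennreal (2 ^ (CARD('n) + 1) * h powr r) * indicator Q t"
    proof (cases "t \<in> Q")
      case True
      then have "\<bar>t $ j\<bar> \<le> h" for j by (simp add: Q_def mem_box_cart abs_le_iff minus_le_iff)
      then show ?thesis using nn_integral_shift_difference_le[OF f r h0 h1, of t] True by simp
    qed simp
  qed
  also have "\<dots> = ennreal (2 ^ (CARD('n) + 1) * h powr r) * ennreal ((2 * h) ^ CARD('n))"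
    by (subst nn_integral_cmult_indicator) (simp_all add: eQ)
  finally have "(\<integral>\<^sup>+x. ennreal (norm (f x - cell_average f K x)) \<partial>torus_measure)
     \<le> ennreal (N / V) * (ennreal (2 ^ (CARD('n) + 1) * h powr r) * ennreal ((2 * h) ^ CARD('n)))"
    by (simp add: mult_left_mono)
  also have "\<dots> = ennreal (N / V * (2 ^ (CARD('n) + 1) * h powr r * (2 * h) ^ CARD('n)))"
    using NV h0 by (simp add: ennreal_mult[symmetric])
  also have "N / V * (2 ^ (CARD('n) + 1) * h powr r * (2 * h) ^ CARD('n)) = 2 ^ (2 * CARD('n) + 1) * h powr r"
  proof -
    have "V = (h * 2 ^ K) ^ CARD('n)" by (simp add: V_def h_def)
    also have "\<dots> = h ^ CARD('n) * N" by (simp add: N_def power_mult_distrib power_mult)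
    finally have V: "V = h ^ CARD('n) * N" .
    have 1: "N / V * h ^ CARD('n) = 1" unfolding V using NV h0 by simp
    have "N / V * (2 ^ (CARD('n) + 1) * h powr r * (2 * h) ^ CARD('n)) =
      (N / V * h ^ CARD('n)) * (2 ^ (CARD('n) + 1) * h powr r * 2 ^ CARD('n))"
      by (simp only: power_mult_distrib mult_ac)
    then have "N / V * (2 ^ (CARD('n) + 1) * h powr r * (2 * h) ^ CARD('n)) = 2 ^ (CARD('n) + 1) * h powr r * 2 ^ CARD('n)"
      by (simp only: 1 mult_1)
    moreover have "2 ^ (2 * k + 1) = 2 ^ (k + 1) * (2 :: real) ^ k" for k
      by (induction k) auto
    ultimately show ?thesis by (simp only: mult_ac)
  qed
  finally show ?thesis by (simp only: h_def)
qed

text \<open>The cell averages tend to \<open>f\<close> in L_1, so a bound that is uniform in all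
  large \<open>K\<close> passes to \<open>f\<close> almost everywhere.\<close>

lemma AE_le_of_cell_average_le:
  fixes f S :: "real ^ 'n \<Rightarrow> complex"
  assumes f: "mixed_smooth r 1 f" and r: "0 < r" and [measurable]: "S \<in> borel_measurable borel"
    and le: "\<And>K x. K0 \<le> K \<Longrightarrow> norm (cell_average f K x - S x) \<le> \<tau>"
  shows "AE x in torus_measure. norm (f x - S x) \<le> \<tau>"
proof -
  have [measurable]: "f \<in> borel_measurable borel" using f by (simp add: mixed_smooth_def)
  \<comment> \<open>\<open>ennreal\<close> sends negative numbers to 0, so this is the integral of
    the positive part of the excess.\<close>
  define I where "I = (\<integral>\<^sup>+x. ennreal (norm (f x - S x) - \<tau>) \<partial>torus_measure)"
  have "I \<le> ennreal (2 ^ (2 * CARD('n) + 1) * (2 * pi / 2 ^ K) powr r)" if "max 3 K0 \<le> K" for K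
  proof -
    have "I \<le> (\<integral>\<^sup>+x. ennreal (norm (f x - cell_average f K x)) \<partial>torus_measure)"
      unfolding I_def
    proof (intro nn_integral_mono ennreal_leI)
      fix x
      have "norm (f x - S x) \<le> norm (f x - cell_average f K x) + norm (cell_average f K x - S x)"
        using norm_triangle_ineq[of "f x - cell_average f K x" "cell_average f K x - S x"] by simp
      then show "norm (f x - S x) - \<tau> \<le> norm (f x - cell_average f K x)" using le[of K x] that by simp
    qed
    also have "\<dots> \<le> ennreal (2 ^ (2 * CARD('n) + 1) * (2 * pi / 2 ^ K) powr r)"
      using that by (intro cell_average_error[OF f r]) simp
    finally show ?thesis .
  qed
  moreover have "(\<lambda>K. ennreal (2 ^ (2 * CARD('n) + 1) * (2 * pi / 2 ^ K) powr r)) \<longlonglongrightarrow> 0"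
  proof -
    have "(\<lambda>K. 2 * pi / 2 ^ K :: real) \<longlonglongrightarrow> 0"
      using tendsto_mult_right_zero[OF LIMSEQ_power_zero[of "1/2 :: real"], of "2 * pi"]
      by (simp add: power_divide)
    then have "(\<lambda>K. (2 * pi / 2 ^ K) powr r) \<longlonglongrightarrow> 0 powr r"
      using r by (intro tendsto_powr') auto
    then have "(\<lambda>K. 2 ^ (2 * CARD('n) + 1) * (2 * pi / 2 ^ K) powr r) \<longlonglongrightarrow> 0"
      using r by (intro tendsto_mult_right_zero) simp
    then show ?thesis using tendsto_ennrealI by fastforce
  qed
  ultimately have "I \<le> 0"
    by (intro LIMSEQ_le_const[of _ _ I] exI[of _ "max 3 K0"]) auto
  then have "I = 0" by simp
  then have "AE x in torus_measure. ennreal (norm (f x - S x) - \<tau>) = 0"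
    unfolding I_def by (subst (asm) nn_integral_0_iff_AE) auto
  then show ?thesis by eventually_elim (simp add: ennreal_eq_0_iff)
qed

section \<open>Layers\<close>

definition level :: "nat \<Rightarrow> ('n::finite \<Rightarrow> nat) set" where
  "level n = {s. total s = n}"

lemma level_le: "s \<in> level n \<Longrightarrow> s j \<le> n"
  by (auto simp: level_def intro: member_le_sum)

lemma finite_level [simp]: "finite (level n :: ('n::finite \<Rightarrow> nat) set)"
proof -
  have "level n \<subseteq> PiE (UNIV :: 'n set) (\<lambda>_. {..n})" by (auto simp: level_le)
  then show ?thesis by (rule finite_subset) (intro finite_PiE, auto)
qed

text \<open>One coordinate is determined by the others and the total. This saves a power of n and is
  the origin of d - 1.\<close>

lemma card_level_le: "card (level n :: ('n::finite \<Rightarrow> nat) set) \<le> (n + 1) ^ (CARD('n) - 1)"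
proof -
  obtain i :: 'n where True by blast
  let ?r = "\<lambda>s :: 'n \<Rightarrow> nat. restrict s (UNIV - {i})"
  have inj: "inj_on ?r (level n)"
  proof (rule inj_onI)
    fix s t :: "'n \<Rightarrow> nat" assume st: "s \<in> level n" "t \<in> level n" "?r s = ?r t"
    have eq: "s j = t j" if "j \<noteq> i" for j using fun_cong[OF st(3), of j] that by simp
    have "s i + (\<Sum>j\<in>UNIV - {i}. s j) = t i + (\<Sum>j\<in>UNIV - {i}. t j)"
      using st(1,2) by (simp add: level_def sum.remove[symmetric])
    moreover have "(\<Sum>j\<in>UNIV - {i}. s j) = (\<Sum>j\<in>UNIV - {i}. t j)"
      by (intro sum.cong) (auto simp: eq)
    ultimately have "s i = t i" by simp
    then show "s = t" using eq by (metis ext)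
  qed
  have "card (level n :: ('n \<Rightarrow> nat) set) = card (?r ` level n)" by (rule card_image[OF inj, symmetric])
  also have "\<dots> \<le> card (PiE (UNIV - {i}) (\<lambda>_. {..n}))"
    by (intro card_mono finite_PiE) (auto simp: PiE_iff level_le split: if_splits)
  also have "\<dots> = (n + 1) ^ (CARD('n) - 1)" by (subst card_PiE) (auto simp: card_Diff_singleton)
  finally show ?thesis .
qed

lemma card_level_le_powr:
  "real (card (level n :: ('n::finite \<Rightarrow> nat) set)) \<le> (real n + 1) powr (real CARD('n) - 1)"
proof -
  have "real (card (level n :: ('n \<Rightarrow> nat) set)) \<le> real ((n + 1) ^ (CARD('n) - 1))"
    using card_level_le[of n, where 'n = 'n] by (simp only: of_nat_le_iff)
  also have "\<dots> = (real n + 1) ^ (CARD('n) - 1)" by (simp add: add.commute)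
  also have "\<dots> = (real n + 1) powr real (CARD('n) - 1)" by (rule powr_realpow[symmetric]) simp
  also have "real (CARD('n) - 1) = real CARD('n) - 1" by (simp add: of_nat_diff Suc_leI)
  finally show ?thesis .
qed

text \<open>A single value is bounded by the whole l_P sum. This crude estimate serves layers that
  receive no functions, and the tail.\<close>

lemma norm_haar_coef_le_powr:
  fixes f :: "real ^ 'n \<Rightarrow> complex"
  assumes f: "mixed_smooth r 1 f" "mixed_smooth r P f" and P: "1 \<le> P" and r: "0 < r" "r < 1"
    and s: "s \<in> level n" and q: "q \<in> cells s"
  shows "norm (haar_coef f s q) \<le> block_bound TYPE('n) * 2 powr (- r * real n) * 2 powr (real n / P)"
proof -
  define B where "B = block_bound TYPE('n) * 2 powr (- r * real n)"
  have B: "B > 0" by (simp add: B_def block_bound_pos)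
  have "norm (haar_coef f s q) powr P \<le> (\<Sum>q\<in>cells s. norm (haar_coef f s q) powr P)"
    using q by (intro member_le_sum) auto
  also have "\<dots> \<le> 2 ^ n * B powr P"
  proof -
    have "total s = n" using s by (simp add: level_def)
    then show ?thesis using sum_haar_coef_powr_le[OF f P r, of s] by (simp only: B_def)
  qed
  finally have "(norm (haar_coef f s q) powr P) powr (1 / P) \<le> (2 ^ n * B powr P) powr (1 / P)"
    using P by (intro powr_mono2) auto
  also have "\<dots> = 2 powr (real n / P) * B"
    using P B by (simp add: powr_mult powr_powr powr_realpow[symmetric])
  finally show ?thesis using P by (simp add: powr_powr B_def mult_ac)
qed

lemma poly_exp_summable:
  fixes A c :: real
  assumes "A \<ge> 0" "c > 0"
  shows "summable (\<lambda>n. (real n + 1) powr A * 2 powr (- c * real n))"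
proof (cases "A = 0")
  case True
  have "summable (\<lambda>n. (2 powr (- c)) ^ n)"
    using assms by (intro summable_geometric) (simp add: powr_less_one)
  then show ?thesis using True by (simp add: powr_realpow[symmetric] powr_powr)
next
  case False
  then have A: "A > 0" using assms by simp
  \<comment> \<open>The tangent of the logarithm at \<open>y\<close> has slope 1 / y, and A / y = (c
    / 2) ln 2: the polynomial factor costs half of the exponential decay.\<close>
  define y where "y = 2 * A / (c * ln 2)"
  have y: "y > 0" using A assms by (simp add: y_def)
  define C where "C = exp (A * ln y - A + A / y)"
  have le: "(real n + 1) powr A * 2 powr (- c * real n) \<le> C * (2 powr (- c / 2)) ^ n" for n
  proof -
    have "ln (real n + 1) = ln ((real n + 1) / y) + ln y" using y by (simp add: ln_div)
    also have "\<dots> \<le> ((real n + 1) / y - 1) + ln y"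
      using y by (intro add_right_mono ln_le_minus_one) auto
    finally have "A * ln (real n + 1) \<le> A * ((real n + 1) / y - 1 + ln y)" using A by (intro mult_left_mono) auto
    also have "\<dots> = (A * ln y - A + A / y) + (A / y) * real n" using y by (simp add: field_simps)
    also have "A / y = c / 2 * ln 2" using A assms by (simp add: y_def)
    finally have "A * ln (real n + 1) - c * real n * ln 2 \<le> (A * ln y - A + c / 2 * ln 2) - c / 2 * real n * ln 2"
      by (simp add: algebra_simps)
    then have "exp (A * ln (real n + 1) - c * real n * ln 2) \<le> exp ((A * ln y - A + c / 2 * ln 2) - c / 2 * real n * ln 2)"
      by simp
    moreover have "(real n + 1) powr A * 2 powr (- c * real n) = exp (A * ln (real n + 1) - c * real n * ln 2)"
      by (simp add: powr_def exp_add[symmetric])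
    moreover have "C * (2 powr (- c / 2)) ^ n = exp ((A * ln y - A + c / 2 * ln 2) - c / 2 * real n * ln 2)"
      using \<open>A / y = c / 2 * ln 2\<close> by (simp add: C_def powr_def exp_of_nat_mult[symmetric] exp_add[symmetric] algebra_simps)
    ultimately show ?thesis by simp
  qed
  have "summable (\<lambda>n. C * (2 powr (- c / 2)) ^ n)"
    using assms by (intro summable_mult summable_geometric) (simp add: powr_less_one)
  then show ?thesis
  proof (rule summable_comparison_test')
    fix n :: nat
    have "norm ((real n + 1) powr A * 2 powr (- c * real n)) = (real n + 1) powr A * 2 powr (- c * real n)"
      by (simp only: real_norm_def) (rule abs_of_nonneg, intro mult_nonneg_nonneg powr_ge_zero)
    then show "norm ((real n + 1) powr A * 2 powr (- c * real n)) \<le> C * (2 powr (- c / 2)) ^ n"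
      using le[of n] by (simp only:)
  qed
qed

text \<open>The term \<open>t n\<close> bounds layer n in the uniform norm. The estimate is proved
  for cell averages of every level \<open>K \<ge> N\<close>, where it is a finite sum, and then
  transferred to \<open>f\<close>.\<close>

lemma haar_tail:
  fixes f :: "real ^ 'n \<Rightarrow> complex"
  assumes f: "mixed_smooth r 1 f" "mixed_smooth r P f" and P: "1 \<le> P" and r: "0 < r" "r < 1"
  defines "t \<equiv> \<lambda>n. (real n + 1) powr (real CARD('n) - 1) * (block_bound TYPE('n) * 2 powr (- (r - 1 / P) * real n))"
  assumes t: "summable t"
  shows "AE x in torus_measure. norm (f x - (\<Sum>n\<le>N. \<Sum>s\<in>level n. haar_block f s x)) \<le> (\<Sum>n. t (n + Suc N))"
proof (rule AE_le_of_cell_average_le[OF f(1) r(1)])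
  show "(\<lambda>x. \<Sum>n\<le>N. \<Sum>s\<in>level n. haar_block f s x) \<in> borel_measurable borel" by measurable
  have t0: "t n \<ge> 0" for n
    unfolding t_def using block_bound_pos[where 'n = 'n] by (intro mult_nonneg_nonneg) auto
  fix K x assume K: "N \<le> K"
  define B where "B = PiE (UNIV :: 'n set) (\<lambda>_. {..K})"
  define L where "L = (\<Union>n\<in>{..N}. level n :: ('n \<Rightarrow> nat) set)"
  have fB: "finite B" unfolding B_def by (intro finite_PiE) auto
  have LB: "L \<subseteq> B"
    unfolding L_def B_def using level_le K by (fastforce intro: order_trans)
  \<comment> \<open>Averages collect the level vectors of a cube, layers those of a simplex. For
    \<open>N \<le> K\<close> the simplex lies in the cube, and the rest of the cube meets only
    finitely many layers, all beyond \<open>N\<close>.\<close>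
  have sub: "B - L \<subseteq> (\<Union>n\<in>{Suc N..K * CARD('n)}. level n)"
  proof
    fix s assume s: "s \<in> B - L"
    define n where "n = total s"
    have "s \<in> level n" by (simp add: level_def n_def)
    moreover have "n > N" using s \<open>s \<in> level n\<close> by (force simp: L_def)
    moreover have "n \<le> (\<Sum>j\<in>(UNIV :: 'n set). K)" unfolding n_def using s by (intro sum_mono) (auto simp: B_def)
    then have "n \<le> K * CARD('n)" by (simp add: mult.commute)
    ultimately show "s \<in> (\<Union>n\<in>{Suc N..K * CARD('n)}. level n)" by (auto intro!: bexI[of _ n])
  qed
  have dis: "\<forall>i\<in>I. \<forall>j\<in>I. i \<noteq> j \<longrightarrow> level i \<inter> (level j :: ('n \<Rightarrow> nat) set) = {}" for I
    by (auto simp: level_def)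
  have "cell_average f K x = (\<Sum>s\<in>B. haar_block f s x)"
    unfolding B_def using mixed_smooth_mdiff_integrable[OF f(1), of _ "{}"]
    by (intro sum_haar_block[symmetric]) (simp add: mixed_difference_empty)
  also have "\<dots> = (\<Sum>s\<in>B - L. haar_block f s x) + (\<Sum>s\<in>L. haar_block f s x)"
    by (rule sum.subset_diff[OF LB fB])
  also have "(\<Sum>s\<in>L. haar_block f s x) = (\<Sum>n\<le>N. \<Sum>s\<in>level n. haar_block f s x)"
    unfolding L_def by (intro sum.UNION_disjoint dis) auto
  finally have "norm (cell_average f K x - (\<Sum>n\<le>N. \<Sum>s\<in>level n. haar_block f s x)) = norm (\<Sum>s\<in>B - L. haar_block f s x)"
    by simp
  also have "\<dots> \<le> (\<Sum>s\<in>B - L. norm (haar_block f s x))" by (rule norm_sum)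
  also have "\<dots> \<le> (\<Sum>s\<in>(\<Union>n\<in>{Suc N..K * CARD('n)}. level n). norm (haar_block f s x))"
    by (intro sum_mono2 sub) auto
  also have "\<dots> = (\<Sum>n\<in>{Suc N..K * CARD('n)}. \<Sum>s\<in>level n. norm (haar_block f s x))"
    by (intro sum.UNION_disjoint dis) auto
  also have "\<dots> \<le> (\<Sum>n\<in>{Suc N..K * CARD('n)}. t n)"
  proof (rule sum_mono)
    fix n
    let ?b = "block_bound TYPE('n) * 2 powr (- r * real n) * 2 powr (real n / P)"
    have "(\<Sum>s\<in>level n. norm (haar_block f s x)) \<le> (\<Sum>s\<in>(level n :: ('n \<Rightarrow> nat) set). ?b)"
      unfolding haar_block_def
      by (intro sum_mono norm_haar_coef_le_powr[OF f P r] cell_of_in_cells)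
    also have "\<dots> = real (card (level n :: ('n \<Rightarrow> nat) set)) * ?b" by simp
    also have "\<dots> \<le> (real n + 1) powr (real CARD('n) - 1) * ?b"
    proof (rule mult_right_mono[OF card_level_le_powr])
      show "0 \<le> ?b" using block_bound_pos[where 'n = 'n] by simp
    qed
    also have "\<dots> = t n"
      unfolding t_def by (simp add: powr_add[symmetric] algebra_simps)
    finally show "(\<Sum>s\<in>level n. norm (haar_block f s x)) \<le> t n" .
  qed
  also have "\<dots> \<le> (\<Sum>n. t (n + Suc N))"
  proof -
    have "(\<Sum>n\<in>{Suc N..K * CARD('n)}. t n) \<le> (\<Sum>n\<in>(\<lambda>i. i + Suc N) ` {..<K * CARD('n)}. t n)"
    proof (rule sum_mono2)
      show "{Suc N..K * CARD('n)} \<subseteq> (\<lambda>i. i + Suc N) ` {..<K * CARD('n)}"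
      proof
        fix n assume "n \<in> {Suc N..K * CARD('n)}"
        then have "n = (n - Suc N) + Suc N" "n - Suc N \<in> {..<K * CARD('n)}" by auto
        then show "n \<in> (\<lambda>i. i + Suc N) ` {..<K * CARD('n)}" by blast
      qed
    qed (auto simp: t0)
    also have "\<dots> = (\<Sum>i<K * CARD('n). t (i + Suc N))"
      by (subst sum.reindex) (auto simp: inj_on_def)
    also have "\<dots> \<le> (\<Sum>n. t (n + Suc N))"
      by (intro sum_le_suminf summable_ignore_initial_segment t) (auto simp: t0)
    finally show ?thesis .
  qed
  finally show "norm (cell_average f K x - (\<Sum>n\<le>N. \<Sum>s\<in>level n. haar_block f s x)) \<le> (\<Sum>n. t (n + Suc N))" .
qed

text \<open>The functions \<open>u\<close> are common to all of \<open>A\<close> while the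
  coefficients may depend on the element, as in a Kolmogorov width. The error holds at every point,
  so dimensions and errors add for sums of layers.\<close>

definition approximable ::
    "nat \<Rightarrow> 'b set \<Rightarrow> ('b \<Rightarrow> real ^ 'n \<Rightarrow> complex) \<Rightarrow> real \<Rightarrow> bool" where
  "approximable m A F \<epsilon> \<longleftrightarrow>
    (\<exists>u. (\<forall>i<m. u i \<in> Lp_space \<infinity>) \<and>
      (\<forall>b\<in>A. \<exists>c :: nat \<Rightarrow> complex. \<forall>x. norm (F b x - (\<Sum>i<m. c i * u i x)) \<le> \<epsilon>))"

lemma approximable_0:
  assumes "\<And>b x. b \<in> A \<Longrightarrow> norm (F b x) \<le> \<epsilon>"
  shows "approximable 0 A F \<epsilon>"
  using assms by (auto simp: approximable_def)

lemma approximable_add: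
  assumes "approximable m A F \<epsilon>" "approximable m' A G \<epsilon>'"
  shows "approximable (m + m') A (\<lambda>b x. F b x + G b x) (\<epsilon> + \<epsilon>')"
proof -
  obtain u where u: "\<forall>i<m. u i \<in> Lp_space \<infinity>" "\<forall>b\<in>A. \<exists>c :: nat \<Rightarrow> complex. \<forall>x. norm (F b x - (\<Sum>i<m. c i * u i x)) \<le> \<epsilon>"
    using assms(1) by (auto simp: approximable_def)
  obtain v where v: "\<forall>i<m'. v i \<in> Lp_space \<infinity>" "\<forall>b\<in>A. \<exists>c :: nat \<Rightarrow> complex. \<forall>x. norm (G b x - (\<Sum>i<m'. c i * v i x)) \<le> \<epsilon>'"
    using assms(2) by (auto simp: approximable_def)
  define w where "w i = (if i < m then u i else v (i - m))" for i
  show ?thesis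
    unfolding approximable_def
  proof (intro exI[of _ w] conjI allI impI ballI)
    show "w i \<in> Lp_space \<infinity>" if "i < m + m'" for i using that u(1) v(1) by (auto simp: w_def)
    fix b assume "b \<in> A"
    then obtain c d :: "nat \<Rightarrow> complex" where c: "\<And>x. norm (F b x - (\<Sum>i<m. c i * u i x)) \<le> \<epsilon>"
      and d: "\<And>x. norm (G b x - (\<Sum>i<m'. d i * v i x)) \<le> \<epsilon>'" using u(2) v(2) by metis
    have split: "(\<Sum>i<m + m'. (if i < m then c i else d (i - m)) * w i x) = (\<Sum>i<m. c i * u i x) + (\<Sum>i<m'. d i * v i x)" for x
    proof -
      have "(\<Sum>i<m + m'. (if i < m then c i else d (i - m)) * w i x) =
        (\<Sum>i<m. (if i < m then c i else d (i - m)) * w i x) + (\<Sum>i\<in>{m..<m + m'}. (if i < m then c i else d (i - m)) * w i x)"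
        by (subst sum.union_disjoint[symmetric]) (auto intro!: sum.cong)
      also have "(\<Sum>i\<in>{m..<m + m'}. (if i < m then c i else d (i - m)) * w i x) = (\<Sum>i<m'. d i * v i x)"
        by (rule sum.reindex_bij_witness[of _ "\<lambda>i. i + m" "\<lambda>i. i - m"]) (auto simp: w_def)
      also have "(\<Sum>i<m. (if i < m then c i else d (i - m)) * w i x) = (\<Sum>i<m. c i * u i x)"
        by (intro sum.cong) (auto simp: w_def)
      finally show ?thesis .
    qed
    show "\<exists>c. \<forall>x. norm (F b x + G b x - (\<Sum>i<m + m'. c i * w i x)) \<le> \<epsilon> + \<epsilon>'"
    proof (intro exI[of _ "\<lambda>i. if i < m then c i else d (i - m)"] allI)
      fix x
      have "norm (F b x + G b x - (\<Sum>i<m + m'. (if i < m then c i else d (i - m)) * w i x)) =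
        norm ((F b x - (\<Sum>i<m. c i * u i x)) + (G b x - (\<Sum>i<m'. d i * v i x)))"
        unfolding split by (simp add: algebra_simps)
      also have "\<dots> \<le> \<epsilon> + \<epsilon>'" by (rule norm_triangle_le) (intro add_mono c d)
      finally show "norm (F b x + G b x - (\<Sum>i<m + m'. (if i < m then c i else d (i - m)) * w i x)) \<le> \<epsilon> + \<epsilon>'" .
    qed
  qed
qed

lemma approximable_sum:
  assumes "\<And>n :: nat. approximable (k n) A (F n) (\<epsilon> n)"
  shows "approximable (\<Sum>n\<le>N. k n) A (\<lambda>b x. \<Sum>n\<le>N. F n b x) (\<Sum>n\<le>N. \<epsilon> n)"
proof (induction N)
  case 0
  then show ?case using assms by simp
next
  case (Suc N)
  show ?case using approximable_add[OF Suc assms[of "Suc N"]] by simp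
qed

lemma zero_in_Lp_space: "(\<lambda>_ :: real ^ 'n. 0) \<in> Lp_space \<infinity>"
proof -
  have "esssup torus_measure (\<lambda>x :: real ^ 'n. ennreal (norm (0 :: complex))) \<le> 0"
    by (rule esssup_I) auto
  then show ?thesis by (simp add: Lp_space_def torus_periodic_def Lp_norm_def)
qed

lemma approximable_mono:
  assumes "approximable m A F \<epsilon>" "m \<le> m'" "\<epsilon> \<le> \<epsilon>'"
  shows "approximable m' A F \<epsilon>'"
proof -
  have "approximable (m' - m) A (\<lambda>_ _. 0) 0"
    unfolding approximable_def
    by (intro exI[of _ "\<lambda>_ _. 0"]) (auto simp: zero_in_Lp_space)
  from approximable_add[OF assms(1) this] have "approximable m' A F \<epsilon>"
    using assms(2) by simp
  then show ?thesis using assms(3) unfolding approximable_def by (meson order_trans)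
qed

lemma cell_of_periodic:
  fixes x :: "real ^ 'n"
  shows "cell_of s (x + axis j (2 * pi)) = cell_of s x"
proof
  fix i
  have "dyad (s i) (u + 2 * pi) mod 2 ^ s i = dyad (s i) u mod 2 ^ s i" for u
    using dyad_shift[of "s i" u "2 ^ s i"] by simp
  then show "cell_of s (x + axis j (2 * pi)) i = cell_of s x i"
    by (cases "i = j") (simp_all add: cell_of_def axis_def)
qed

lemma cell_function_in_Lp_space:
  fixes F :: "('n::finite \<Rightarrow> int) \<Rightarrow> complex"
  shows "(\<lambda>x :: real ^ 'n. F (cell_of s x)) \<in> Lp_space \<infinity>"
proof -
  have m: "(\<lambda>x :: real ^ 'n. F (cell_of s x)) \<in> borel_measurable borel" by (rule cell_of_measurable)
  have "esssup torus_measure (\<lambda>x :: real ^ 'n. ennreal (norm (F (cell_of s x)))) \<le> ennreal (\<Sum>q\<in>cells s. norm (F q))"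
  proof (rule esssup_I)
    note [measurable] = m
    show "(\<lambda>x :: real ^ 'n. ennreal (norm (F (cell_of s x)))) \<in> borel_measurable torus_measure" by measurable
    show "AE x in torus_measure. ennreal (norm (F (cell_of s (x :: real ^ 'n)))) \<le> ennreal (\<Sum>q\<in>cells s. norm (F q))"
      by (intro AE_I2 ennreal_leI) (auto intro!: member_le_sum cell_of_in_cells)
  qed
  then have "Lp_norm \<infinity> (\<lambda>x :: real ^ 'n. F (cell_of s x)) < \<infinity>"
    by (simp add: Lp_norm_def le_less_trans[OF _ ennreal_less_top])
  then show ?thesis using m by (simp add: Lp_space_def torus_periodic_def cell_of_periodic)
qed

text \<open>Every block of layer n is constant on the cubes of level n in each coordinate. Hence
  2^(n d) evaluation points determine the whole layer.\<close>

lemma cell_of_coarser: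
  assumes "s j \<le> n"
  shows "cell_of (\<lambda>_. n) x j div 2 ^ (n - s j) = cell_of s x j"
proof -
  have "(dyad (k + l) u mod 2 ^ (k + l)) div 2 ^ l = dyad k u mod 2 ^ k" for k l u
  proof (induction l)
    case (Suc l)
    have "(dyad (k + Suc l) u mod 2 ^ (k + Suc l)) div 2 ^ Suc l =
      (dyad (Suc (k + l)) u mod 2 ^ Suc (k + l)) div 2 div 2 ^ l"
      by (simp add: zdiv_zmult2_eq)
    also have "\<dots> = dyad k u mod 2 ^ k" unfolding dyad_mod_Suc_div_2 by (rule Suc)
    finally show ?case .
  qed simp
  from this[of "s j" "n - s j" "x $ j"] show ?thesis using assms by (simp add: cell_of_def)
qed

lemma card_cells: "card (cells (\<lambda>_. n) :: ('n::finite \<Rightarrow> int) set) = 2 ^ (n * CARD('n))"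
proof -
  have "cells (\<lambda>_. n) = PiE (UNIV :: 'n set) (\<lambda>_. {0..<2 ^ n})" by (auto simp: cells_def)
  then show ?thesis by (simp add: card_PiE power_mult nat_power_eq)
qed

lemma cells_nonempty: "cells s \<noteq> {}"
  by (auto simp: cells_def intro!: exI[of _ "\<lambda>_. 0"])

definition haar_layer :: "nat \<Rightarrow> (real ^ 'n \<Rightarrow> complex) \<Rightarrow> real ^ 'n \<Rightarrow> complex" where
  "haar_layer n f x = (\<Sum>s\<in>level n. haar_block f s x)"

text \<open>The 1 is for the dropped values, 30 sqrt d for the random subspace, and the factor 2 for
  rounding a real budget down to an integer.\<close>

definition layer_const :: "'n::finite itself \<Rightarrow> real" where
  "layer_const _ = 2 * block_bound TYPE('n) * (1 + 30 * sqrt (real CARD('n)))"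

lemma layer_const_pos: "layer_const TYPE('n::finite) > 0"
  using block_bound_pos[where 'n = 'n] by (simp add: layer_const_def add_pos_nonneg)

lemma level_nonempty: "(level n :: ('n::finite \<Rightarrow> nat) set) \<noteq> {}"
proof -
  obtain i :: 'n where True by blast
  have "(\<lambda>j. if j = i then n else 0) \<in> level n" by (simp add: level_def)
  then show ?thesis by blast
qed

text \<open>Values of modulus at most \<open>l\<close> are dropped; the others, over the whole
  layer, lie in a Euclidean ball to which \<open>ex_width_basis\<close> applies. The basis is
  obtained before \<open>f\<close> is fixed, so it serves the entire class.\<close>

lemma haar_layer_approximable_nat:
  assumes P: "2 \<le> P" and r: "0 < r" "r < 1" and m: "m > 0"
  shows "approximable m (smooth_class r {1, P} :: (real ^ 'n \<Rightarrow> complex) set) (haar_layer n)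
    ((real n + 1) powr (real CARD('n) - 1) * 2 powr (- r * real n) * (block_bound TYPE('n) * (1 + 30 * sqrt (real CARD('n)))) *
      (2 ^ n * (real n + 1) / real m) powr (1 / P))"
proof -
  let ?L = "level n :: ('n \<Rightarrow> nat) set"
  define I where "I = Sigma ?L cells"
  define X where "X = (cells (\<lambda>_. n) :: ('n \<Rightarrow> int) set)"
  \<comment> \<open>Evaluation at \<open>x\<close> picks one value per \<open>s\<close>, that of the
    cell containing \<open>x\<close>. The weight sqrt (2^n) is undone in \<open>y\<close>, whose
    squared length is then the sum of the squared L_2 norms of the truncated blocks.\<close>
  define a where "a x = (\<lambda>(s, q). if (\<lambda>j. x j div 2 ^ (n - s j)) = q then sqrt (2 ^ n) else (0 :: real))"
    for x :: "'n \<Rightarrow> int"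
  define L where "L = real (card ?L)"
  have L: "L > 0" using level_nonempty[of n, where 'n = 'n] by (simp add: L_def card_gt_0_iff)
  have fI: "finite I" unfolding I_def by (intro finite_SigmaI) auto
  have fX: "finite X" "X \<noteq> {}" by (simp_all add: X_def cells_nonempty)
  have a2: "(\<Sum>i\<in>I. (a x i)\<^sup>2) \<le> L * 2 ^ n" for x
  proof -
    have "(\<Sum>i\<in>I. (a x i)\<^sup>2) = (\<Sum>s\<in>level n. \<Sum>q\<in>cells s. (a x (s, q))\<^sup>2)"
      unfolding I_def by (subst sum.Sigma) auto
    also have "\<dots> \<le> (\<Sum>s\<in>?L. 2 ^ n)"
    proof (rule sum_mono)
      fix s :: "'n \<Rightarrow> nat"
      have "(\<Sum>q\<in>cells s. (a x (s, q))\<^sup>2) = (\<Sum>q\<in>cells s. if q = (\<lambda>j. x j div 2 ^ (n - s j)) then 2 ^ n else 0)"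
        by (intro sum.cong) (auto simp: a_def)
      also have "\<dots> \<le> 2 ^ n" by (subst sum.delta) auto
      finally show "(\<Sum>q\<in>cells s. (a x (s, q))\<^sup>2) \<le> 2 ^ n" .
    qed
    finally show ?thesis by (simp add: L_def)
  qed
  have Mpos: "L * 2 ^ n > 0" using L by simp
  obtain u :: "nat \<Rightarrow> ('n \<Rightarrow> int) \<Rightarrow> real" where u:
    "\<And>y :: ('n \<Rightarrow> nat) \<times> ('n \<Rightarrow> int) \<Rightarrow> complex. \<exists>c :: nat \<Rightarrow> complex. \<forall>x\<in>X.
      norm ((\<Sum>i\<in>I. y i * of_real (a x i)) - (\<Sum>j<m. c j * of_real (u j x)))
      \<le> 30 * width_rate (L * 2 ^ n) (card X) m * sqrt (\<Sum>i\<in>I. (norm (y i))\<^sup>2)"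
    using ex_width_basis[where a = a, OF fI fX Mpos m a2] by blast
  define k where "k = 2 ^ n * (real n + 1) / real m"
  have k: "k > 0" using m by (simp add: k_def add_nonneg_pos)
  \<comment> \<open>Balances the two errors: relative to \<open>L * B\<close>, dropping values costs
    h and the subspace costs sqrt (k h^(2 - P)) up to a constant. They agree when h^P = k.\<close>
  define h where "h = k powr (1 / P)"
  have h: "h > 0" using k by (simp add: h_def)
  define B where "B = block_bound TYPE('n) * 2 powr (- r * real n)"
  have B: "B > 0" using block_bound_pos[where 'n = 'n] by (simp add: B_def)
  define l where "l = B * h"
  have l: "l > 0" using B h by (simp add: l_def)
  \<comment> \<open>The logarithm of the number of evaluation points is at most d (n + 1); this is
    where \<open>k\<close> gets its factor n + 1.\<close>
  have width: "30 * width_rate (L * 2 ^ n) (card X) m \<le> 30 * sqrt (real CARD('n)) * sqrt L * sqrt k"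
  proof -
    have "2 * real (card X) = 2 powr (real n * real CARD('n) + 1)"
      by (simp add: X_def card_cells powr_add powr_realpow[symmetric])
    then have "ln (2 * real (card X)) = (real n * real CARD('n) + 1) * ln 2" by (simp add: ln_powr)
    also have "\<dots> \<le> (real n * real CARD('n) + real CARD('n)) * 1"
      using ln_2_less_1 by (intro mult_mono) (auto simp: Suc_leI)
    finally have "ln (2 * real (card X)) \<le> real CARD('n) * (real n + 1)" by (simp add: algebra_simps)
    then have "L * 2 ^ n * ln (2 * real (card X)) / real m \<le> L * 2 ^ n * (real CARD('n) * (real n + 1)) / real m"
      using L by (intro divide_right_mono mult_left_mono) auto
    also have "\<dots> = real CARD('n) * L * k" by (simp add: k_def)
    finally have "width_rate (L * 2 ^ n) (card X) m \<le> sqrt (real CARD('n) * L * k)" by simp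
    then show ?thesis by (simp add: real_sqrt_mult)
  qed
  have main: "\<exists>c :: nat \<Rightarrow> complex. \<forall>x. norm (haar_layer n f x - (\<Sum>j<m. c j * of_real (u j (cell_of (\<lambda>_. n) x))))
      \<le> L * B * h * (1 + 30 * sqrt (real CARD('n)))"
    if f: "mixed_smooth r 1 f" "mixed_smooth r P f" for f :: "real ^ 'n \<Rightarrow> complex"
  proof -
    define g where "g s q = (if norm (haar_coef f s q) > l then haar_coef f s q else 0)" for s q
    define y where "y = (\<lambda>(s, q). g s q / of_real (sqrt (2 ^ n)))"
    obtain c :: "nat \<Rightarrow> complex" where c: "\<forall>x\<in>X. norm ((\<Sum>i\<in>I. y i * of_real (a x i)) - (\<Sum>j<m. c j * of_real (u j x)))
      \<le> 30 * width_rate (L * 2 ^ n) (card X) m * sqrt (\<Sum>i\<in>I. (norm (y i))\<^sup>2)"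
      using u[of y] by blast
    have sumya: "(\<Sum>i\<in>I. y i * of_real (a (cell_of (\<lambda>_. n) x) i)) = (\<Sum>s\<in>level n. g s (cell_of s x))" for x :: "real ^ 'n"
    proof -
      have "(\<Sum>i\<in>I. y i * of_real (a (cell_of (\<lambda>_. n) x) i)) =
        (\<Sum>s\<in>level n. \<Sum>q\<in>cells s. y (s, q) * of_real (a (cell_of (\<lambda>_. n) x) (s, q)))"
        unfolding I_def by (subst sum.Sigma) auto
      also have "\<dots> = (\<Sum>s\<in>level n. g s (cell_of s x))"
      proof (rule sum.cong[OF refl])
        fix s :: "'n \<Rightarrow> nat" assume s: "s \<in> level n"
        have "(\<lambda>j. cell_of (\<lambda>_. n) x j div 2 ^ (n - s j)) = cell_of s x"
          using level_le[OF s] by (intro ext cell_of_coarser)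
        then have "(\<Sum>q\<in>cells s. y (s, q) * of_real (a (cell_of (\<lambda>_. n) x) (s, q))) = (\<Sum>q\<in>cells s. if q = cell_of s x then g s q else 0)"
          by (intro sum.cong) (auto simp: a_def y_def)
        also have "\<dots> = g s (cell_of s x)" by (simp add: sum.delta cell_of_in_cells)
        finally show "(\<Sum>q\<in>cells s. y (s, q) * of_real (a (cell_of (\<lambda>_. n) x) (s, q))) = g s (cell_of s x)" .
      qed
      finally show ?thesis .
    qed
    have y2: "(\<Sum>i\<in>I. (norm (y i))\<^sup>2) \<le> L * (B\<^sup>2 * h powr (2 - P))"
    proof -
      have "(\<Sum>i\<in>I. (norm (y i))\<^sup>2) = (\<Sum>s\<in>level n. \<Sum>q\<in>cells s. (norm (y (s, q)))\<^sup>2)"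
        unfolding I_def by (subst sum.Sigma) auto
      also have "\<dots> \<le> (\<Sum>s\<in>?L. B\<^sup>2 * h powr (2 - P))"
      proof (rule sum_mono)
        fix s :: "'n \<Rightarrow> nat" assume s: "s \<in> level n"
        \<comment> \<open>A surviving value exceeds \<open>l\<close> and 2 - P \<le> 0, so its
          square is at most l^(2 - P) times its P-th power. Dropped values contribute 0.\<close>
        have "(norm (y (s, q)))\<^sup>2 \<le> (l powr (2 - P) / 2 ^ n) * norm (haar_coef f s q) powr P" for q
        proof (cases "norm (haar_coef f s q) > l")
          case True
          define N where "N = norm (haar_coef f s q)"
          have N: "N > l" "N > 0" using True l by (auto simp: N_def)
          have "N\<^sup>2 = N powr 2" using N by (simp add: powr_numeral)
          also have "\<dots> = N powr (2 - P) * N powr P" by (simp add: powr_add[symmetric])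
          also have "\<dots> \<le> l powr (2 - P) * N powr P"
            using N l P by (intro mult_right_mono powr_mono2') auto
          finally have "N\<^sup>2 / 2 ^ n \<le> (l powr (2 - P) * N powr P) / 2 ^ n" by (intro divide_right_mono) auto
          moreover have "(norm (y (s, q)))\<^sup>2 = N\<^sup>2 / 2 ^ n"
            using True by (simp add: y_def g_def N_def norm_divide power_divide)
          ultimately show ?thesis by (simp add: N_def)
        qed (simp add: y_def g_def)
        then have "(\<Sum>q\<in>cells s. (norm (y (s, q)))\<^sup>2) \<le> (\<Sum>q\<in>cells s. (l powr (2 - P) / 2 ^ n) * norm (haar_coef f s q) powr P)"
          by (intro sum_mono)
        also have "\<dots> = (l powr (2 - P) / 2 ^ n) * (\<Sum>q\<in>cells s. norm (haar_coef f s q) powr P)"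
          by (simp only: sum_distrib_left)
        also have "\<dots> \<le> (l powr (2 - P) / 2 ^ n) * (2 ^ n * B powr P)"
        proof (rule mult_left_mono)
          have "total s = n" using s by (simp add: level_def)
          then show "(\<Sum>q\<in>cells s. norm (haar_coef f s q) powr P) \<le> 2 ^ n * B powr P"
            using sum_haar_coef_powr_le[OF f _ r, of s] P by (simp only: B_def)
        qed simp
        also have "\<dots> = l powr (2 - P) * B powr P" by simp
        also have "\<dots> = B powr (2 - P) * B powr P * h powr (2 - P)"
          using B h by (simp add: l_def powr_mult)
        also have "B powr (2 - P) * B powr P = B\<^sup>2"
          using B by (simp add: powr_add[symmetric] powr_numeral)
        finally show "(\<Sum>q\<in>cells s. (norm (y (s, q)))\<^sup>2) \<le> B\<^sup>2 * h powr (2 - P)" .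
      qed
      finally show ?thesis by (simp add: L_def)
    qed
    have prod: "sqrt k * sqrt (h powr (2 - P)) = h"
    proof -
      have "k = h powr P" using k P by (simp add: h_def powr_powr)
      then have "k * h powr (2 - P) = h powr 2" using h by (simp add: powr_add[symmetric])
      also have "\<dots> = h\<^sup>2" using h by (simp add: powr_numeral)
      finally have "sqrt (k * h powr (2 - P)) = h" using h by simp
      then show ?thesis by (simp add: real_sqrt_mult)
    qed
    have "norm (haar_layer n f x - (\<Sum>j<m. c j * of_real (u j (cell_of (\<lambda>_. n) x)))) \<le> L * B * h * (1 + 30 * sqrt (real CARD('n)))" for x
    proof -
      let ?x = "cell_of (\<lambda>_. n) x"
      have 1: "norm (haar_layer n f x - (\<Sum>i\<in>I. y i * of_real (a ?x i))) \<le> L * l"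
      proof -
        have "norm (haar_layer n f x - (\<Sum>i\<in>I. y i * of_real (a ?x i))) =
          norm (\<Sum>s\<in>level n. haar_coef f s (cell_of s x) - g s (cell_of s x))"
          by (simp add: sumya haar_layer_def haar_block_def sum_subtractf)
        also have "\<dots> \<le> (\<Sum>s\<in>?L. l)"
          by (rule sum_norm_le) (use l in \<open>auto simp: g_def\<close>)
        finally show ?thesis by (simp add: L_def)
      qed
      have "?x \<in> X" by (simp add: X_def cell_of_in_cells)
      then have "norm ((\<Sum>i\<in>I. y i * of_real (a ?x i)) - (\<Sum>j<m. c j * of_real (u j ?x)))
        \<le> 30 * width_rate (L * 2 ^ n) (card X) m * sqrt (\<Sum>i\<in>I. (norm (y i))\<^sup>2)"
        using c by blast
      also have "\<dots> \<le> (30 * sqrt (real CARD('n)) * sqrt L * sqrt k) * sqrt (L * (B\<^sup>2 * h powr (2 - P)))"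
        using L k y2 by (intro mult_mono width) (auto simp: sum_nonneg)
      also have "\<dots> = 30 * sqrt (real CARD('n)) * (sqrt L * sqrt L) * B * (sqrt k * sqrt (h powr (2 - P)))"
        using B by (simp add: real_sqrt_mult)
      also have "\<dots> = 30 * sqrt (real CARD('n)) * L * B * h" using L by (simp add: prod)
      finally have 2: "norm ((\<Sum>i\<in>I. y i * of_real (a ?x i)) - (\<Sum>j<m. c j * of_real (u j ?x)))
        \<le> 30 * sqrt (real CARD('n)) * L * B * h" .
      have "norm (haar_layer n f x - (\<Sum>j<m. c j * of_real (u j ?x))) \<le> L * l + 30 * sqrt (real CARD('n)) * L * B * h"
        using norm_triangle_le[OF add_mono[OF 1 2]] by simp
      then show ?thesis by (simp add: l_def algebra_simps)
    qed
    then show ?thesis by blast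
  qed
  have le: "L * B * h * (1 + 30 * sqrt (real CARD('n))) \<le>
    (real n + 1) powr (real CARD('n) - 1) * 2 powr (- r * real n) * (block_bound TYPE('n) * (1 + 30 * sqrt (real CARD('n)))) *
      (2 ^ n * (real n + 1) / real m) powr (1 / P)"
  proof -
    have "L * (B * h * (1 + 30 * sqrt (real CARD('n)))) \<le> (real n + 1) powr (real CARD('n) - 1) * (B * h * (1 + 30 * sqrt (real CARD('n))))"
      unfolding L_def using B h by (intro mult_right_mono card_level_le_powr) auto
    then show ?thesis by (simp add: B_def h_def k_def mult_ac)
  qed
  have "approximable m (smooth_class r {1, P} :: (real ^ 'n \<Rightarrow> complex) set) (haar_layer n)
    (L * B * h * (1 + 30 * sqrt (real CARD('n))))"
    unfolding approximable_def
  proof (intro exI[of _ "\<lambda>j x. of_real (u j (cell_of (\<lambda>_. n) x))"] conjI allI impI ballI)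
    show "(\<lambda>x :: real ^ 'n. complex_of_real (u i (cell_of (\<lambda>_. n) x))) \<in> Lp_space \<infinity>" for i
      by (rule cell_function_in_Lp_space[where F = "\<lambda>q. complex_of_real (u i q)"])
  qed (use main in auto)
  then show ?thesis by (rule approximable_mono[OF _ order_refl le])
qed

text \<open>Real budgets, possibly below 1, may decay geometrically over all layers. A budget below
  1 buys no function, but then 2^n \<le> k and the plain uniform bound suffices; otherwise rounding
  keeps at least half of the budget.\<close>

lemma haar_layer_approximable:
  assumes P: "2 \<le> P" and r: "0 < r" "r < 1" and \<mu>: "\<mu> > 0"
  shows "approximable (nat \<lfloor>\<mu>\<rfloor>) (smooth_class r {1, P} :: (real ^ 'n \<Rightarrow> complex) set) (haar_layer n)
    (layer_const TYPE('n) * (real n + 1) powr (real CARD('n) - 1) * 2 powr (- r * real n) *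
      (2 ^ n * (real n + 1) / \<mu>) powr (1 / P))"
proof -
  define D where "D = (real n + 1) powr (real CARD('n) - 1) * 2 powr (- r * real n)"
  have D: "D \<ge> 0" by (simp add: D_def)
  define B where "B = block_bound TYPE('n)"
  have B: "B > 0" by (simp add: B_def block_bound_pos)
  define E where "E = B * (1 + 30 * sqrt (real CARD('n)))"
  have E: "E \<ge> B" "E > 0" using B by (auto simp: E_def add_pos_nonneg)
  define k where "k = 2 ^ n * (real n + 1) / \<mu>"
  have k: "k > 0" using \<mu> by (simp add: k_def add_nonneg_pos)
  have "approximable (nat \<lfloor>\<mu>\<rfloor>) (smooth_class r {1, P} :: (real ^ 'n \<Rightarrow> complex) set) (haar_layer n)
    (2 * (D * E * k powr (1 / P)))"
  proof (cases "\<mu> < 1")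
    case True
    then have 0: "nat \<lfloor>\<mu>\<rfloor> = 0" using \<mu> by simp
    show ?thesis unfolding 0
    proof (rule approximable_0)
      fix f x assume "f \<in> (smooth_class r {1, P} :: (real ^ 'n \<Rightarrow> complex) set)"
      then have f: "mixed_smooth r 1 f" "mixed_smooth r P f" by auto
      let ?b = "B * 2 powr (- r * real n) * 2 powr (real n / P)"
      have "norm (haar_layer n f x) \<le> (\<Sum>s\<in>(level n :: ('n \<Rightarrow> nat) set). ?b)"
        unfolding haar_layer_def haar_block_def B_def
        by (rule sum_norm_le) (use P in \<open>intro norm_haar_coef_le_powr[OF f _ r] cell_of_in_cells, auto\<close>)
      also have "\<dots> = real (card (level n :: ('n \<Rightarrow> nat) set)) * ?b" by simp
      also have "\<dots> \<le> (real n + 1) powr (real CARD('n) - 1) * ?b"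
        using B by (intro mult_right_mono card_level_le_powr) auto
      also have "\<dots> = D * B * (2 ^ n) powr (1 / P)" by (simp add: D_def powr_realpow[symmetric] powr_powr)
      also have "\<dots> \<le> D * E * k powr (1 / P)"
      proof (intro mult_mono powr_mono2)
        have "2 ^ n * 1 \<le> 2 ^ n * ((real n + 1) / \<mu>)" using True \<mu> by (intro mult_left_mono) auto
        then show "2 ^ n \<le> k" by (simp add: k_def)
      qed (use D E B P in auto)
      also have "\<dots> \<le> 2 * (D * E * k powr (1 / P))" using D E by simp
      finally show "norm (haar_layer n f x) \<le> 2 * (D * E * k powr (1 / P))" .
    qed
  next
    case False
    define m where "m = nat \<lfloor>\<mu>\<rfloor>"
    have "1 \<le> \<lfloor>\<mu>\<rfloor>" using False by simp
    then have m: "m > 0" "real m \<ge> \<mu> / 2"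
      unfolding m_def by (auto, linarith)
    have "approximable m (smooth_class r {1, P} :: (real ^ 'n \<Rightarrow> complex) set) (haar_layer n)
      (D * E * (2 ^ n * (real n + 1) / real m) powr (1 / P))"
      using haar_layer_approximable_nat[OF P r m(1), of n, where 'n = 'n] by (simp add: D_def E_def B_def)
    moreover have "D * E * (2 ^ n * (real n + 1) / real m) powr (1 / P) \<le> 2 * (D * E * k powr (1 / P))"
    proof -
      have "2 ^ n * (real n + 1) / real m \<le> 2 ^ n * (real n + 1) / (\<mu> / 2)"
        using m \<mu> by (intro divide_left_mono) auto
      also have "\<dots> = 2 * k" by (simp add: k_def)
      finally have "(2 ^ n * (real n + 1) / real m) powr (1 / P) \<le> (2 * k) powr (1 / P)"
        using P by (intro powr_mono2) auto
      also have "\<dots> = 2 powr (1 / P) * k powr (1 / P)" using k by (simp add: powr_mult)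
      also have "\<dots> \<le> 2 powr 1 * k powr (1 / P)" using P by (intro mult_right_mono powr_mono) auto
      finally have "D * E * (2 ^ n * (real n + 1) / real m) powr (1 / P) \<le> D * E * (2 * k powr (1 / P))"
        using D E by (intro mult_left_mono) auto
      then show ?thesis by simp
    qed
    ultimately show ?thesis unfolding m_def by (rule approximable_mono[OF _ order_refl])
  qed
  then show ?thesis by (simp only: layer_const_def D_def E_def B_def k_def mult_ac)
qed

section \<open>The width\<close>

lemma approximable_subset:
  "approximable m A F \<epsilon> \<Longrightarrow> B \<subseteq> A \<Longrightarrow> approximable m B F \<epsilon>"
  unfolding approximable_def by blast

lemma kolmogorov_width_le:
  fixes A :: "(real ^ 'n \<Rightarrow> complex) set"
  assumes G: "approximable m A G \<epsilon>" and A: "A \<subseteq> borel_measurable borel"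
    and rest: "\<And>f. f \<in> A \<Longrightarrow> AE x in torus_measure. norm (f x - G f x) \<le> \<tau>"
  shows "kolmogorov_width (Lp_space \<infinity>) (Lp_norm \<infinity>) m A \<le> ennreal (\<epsilon> + \<tau>)"
proof -
  obtain u where u: "\<forall>i<m. u i \<in> Lp_space \<infinity>"
    "\<forall>f\<in>A. \<exists>c :: nat \<Rightarrow> complex. \<forall>x. norm (G f x - (\<Sum>i<m. c i * u i x)) \<le> \<epsilon>"
    using G by (auto simp: approximable_def)
  have um: "u i \<in> borel_measurable borel" if "i < m" for i using u(1) that by (simp add: Lp_space_def)
  have "(SUP f\<in>A. INF c :: nat \<Rightarrow> complex. Lp_norm \<infinity> (\<lambda>x. f x - (\<Sum>i<m. c i * u i x))) \<le> ennreal (\<epsilon> + \<tau>)"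
  proof (rule SUP_least)
    fix f assume f: "f \<in> A"
    then obtain c :: "nat \<Rightarrow> complex" where c: "\<And>x. norm (G f x - (\<Sum>i<m. c i * u i x)) \<le> \<epsilon>" using u(2) by blast
    have [measurable]: "f \<in> borel_measurable borel" using f A by auto
    define g where "g x = f x - (\<Sum>i<m. c i * u i x)" for x
    have "(\<lambda>x. c i * u i x) \<in> borel_measurable borel" if "i < m" for i
      by (intro borel_measurable_times um that) simp
    then have "(\<lambda>x. \<Sum>i<m. c i * u i x) \<in> borel_measurable borel"
      by (intro borel_measurable_sum) (simp only: lessThan_iff)
    then have [measurable]: "g \<in> borel_measurable borel"
      unfolding g_def[abs_def] by (rule borel_measurable_diff[rotated]) fact
    have "Lp_norm \<infinity> g = esssup torus_measure (\<lambda>x. ennreal (norm (g x)))"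
      by (simp add: Lp_norm_def)
    also have "\<dots> \<le> ennreal (\<epsilon> + \<tau>)"
    proof (rule esssup_I)
      show "(\<lambda>x. ennreal (norm (g x))) \<in> borel_measurable torus_measure" by measurable
      show "AE x in torus_measure. ennreal (norm (g x)) \<le> ennreal (\<epsilon> + \<tau>)"
        using rest[OF f]
      proof eventually_elim
        case (elim x)
        have "norm (g x) = norm ((f x - G f x) + (G f x - (\<Sum>i<m. c i * u i x)))" by (simp add: g_def)
        also have "\<dots> \<le> \<tau> + \<epsilon>" by (intro norm_triangle_le add_mono elim c)
        finally show ?case by (intro ennreal_leI) simp
      qed
    qed
    finally have le: "Lp_norm \<infinity> (\<lambda>x. f x - (\<Sum>i<m. c i * u i x)) \<le> ennreal (\<epsilon> + \<tau>)"
      by (simp only: g_def[abs_def])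
    show "(INF c :: nat \<Rightarrow> complex. Lp_norm \<infinity> (\<lambda>x. f x - (\<Sum>i<m. c i * u i x))) \<le> ennreal (\<epsilon> + \<tau>)"
      by (rule INF_lower2[where f = "\<lambda>c. Lp_norm \<infinity> (\<lambda>x. f x - (\<Sum>i<m. c i * u i x))" and i = c, OF UNIV_I le])
  qed
  then show ?thesis
    unfolding kolmogorov_width_def
    by (rule INF_lower2[where f = "\<lambda>u. SUP f\<in>A. INF c :: nat \<Rightarrow> complex. Lp_norm \<infinity> (\<lambda>x. f x - (\<Sum>i<m. c i * u i x))" and i = u, rotated])
      (use u(1) in simp)
qed

section \<open>Distribution of the dimension over the layers\<close>

lemma sum_two_sided_le:
  fixes w :: "nat \<Rightarrow> real"
  assumes w: "summable w" "\<And>k. 0 \<le> w k"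
  shows "(\<Sum>n\<le>N. w (if n \<le> n0 then n0 - n else n - n0)) \<le> 2 * suminf w"
proof -
  let ?d = "\<lambda>n. if n \<le> n0 then n0 - n else n - n0"
  have "(\<Sum>n\<le>N. w (?d n)) = (\<Sum>n\<in>{..N} \<inter> {..n0}. w (?d n)) + (\<Sum>n\<in>{..N} - {..n0}. w (?d n))"
    by (subst sum.union_disjoint[symmetric]) (auto intro!: sum.cong)
  also have "(\<Sum>n\<in>{..N} \<inter> {..n0}. w (?d n)) = sum w (?d ` ({..N} \<inter> {..n0}))"
    by (subst sum.reindex) (auto simp: inj_on_def)
  also have "\<dots> \<le> suminf w" by (intro sum_le_suminf w) auto
  also have "(\<Sum>n\<in>{..N} - {..n0}. w (?d n)) = sum w (?d ` ({..N} - {..n0}))"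
    by (subst sum.reindex) (auto simp: inj_on_def)
  also have "\<dots> \<le> suminf w" by (intro sum_le_suminf w) auto
  finally show ?thesis by simp
qed

text \<open>
  The level \<open>n0\<close> at which the number of degrees of freedom of a single block, times the logarithm
  of the number of cells, matches \<open>m\<close>.
\<close>

lemma ex_critical_level:
  assumes m: "2 \<le> m"
  obtains n0 :: nat where "2 ^ n0 * (real n0 + 1) \<le> real m"
    and "real n0 + 1 \<le> 3 * ln (real m)"
    and "\<And>r. 0 < r \<Longrightarrow> r < 1 \<Longrightarrow> 2 powr (- r * real n0) \<le> 4 * (real n0 + 1) powr r * real m powr (- r)"
proof -
  define S where "S = {n :: nat. 2 ^ n * (n + 1) \<le> m}"
  have bound: "n \<le> m" if "n \<in> S" for n
  proof -
    have "1 * (n + 1) \<le> 2 ^ n * (n + 1)" by (intro mult_le_mono) auto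
    then show ?thesis using that by (simp add: S_def)
  qed
  then have fin: "finite S" by (meson finite_nat_set_iff_bounded_le)
  have "0 \<in> S" using m by (simp add: S_def)
  define n0 where "n0 = Max S"
  have n0: "n0 \<in> S" unfolding n0_def using fin \<open>0 \<in> S\<close> by (intro Max_in) auto
  have "Suc n0 \<notin> S" using Max_ge[OF fin, of "Suc n0"] by (auto simp: n0_def)
  then have up: "m < 2 ^ Suc n0 * (Suc n0 + 1)" by (simp add: S_def)
  have lo: "2 ^ n0 * (real n0 + 1) \<le> real m"
  proof -
    have "real (2 ^ n0 * (n0 + 1)) \<le> real m" using n0 by (simp only: of_nat_le_iff S_def mem_Collect_eq)
    then show ?thesis by (simp add: algebra_simps)
  qed
  have ln2: "2 / 3 \<le> ln (2 :: real)" by (rule ln2_ge_two_thirds)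
  have lnm: "ln 2 \<le> ln (real m)" using m by simp
  \<comment> \<open>From n0 ln 2 \<le> ln m and ln 2 \<ge> 2/3, each of n0 and 1 is at most (3/2) ln
    m.\<close>
  have n0l: "real n0 + 1 \<le> 3 * ln (real m)"
  proof -
    have "(2 :: real) ^ n0 * 1 \<le> 2 ^ n0 * (real n0 + 1)" by (intro mult_left_mono) auto
    then have "2 ^ n0 \<le> real m" using lo by linarith
    then have "ln (2 ^ n0) \<le> ln (real m)" using m by (subst ln_le_cancel_iff) auto
    then have "real n0 * ln 2 \<le> ln (real m)" by (simp add: ln_realpow)
    moreover have "real n0 * (2 / 3) \<le> real n0 * ln 2" using ln2 by (intro mult_left_mono) auto
    ultimately show ?thesis using ln2 lnm by linarith
  qed
  \<comment> \<open>By maximality level n0 + 1 is too large for m, and passing from n0 + 1 to n0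
    costs at most the factor 4. Since r < 1, its r-th power is again at most 4.\<close>
  have pw: "2 powr (- r * real n0) \<le> 4 * (real n0 + 1) powr r * real m powr (- r)" if r: "0 < r" "r < 1" for r
  proof -
    have "real m \<le> real (2 ^ Suc n0 * (Suc n0 + 1))" using up by (simp only: of_nat_le_iff less_imp_le)
    also have "\<dots> \<le> 2 ^ n0 * (4 * (real n0 + 1))" by (simp add: algebra_simps)
    finally have "real m powr r \<le> (2 ^ n0 * (4 * (real n0 + 1))) powr r" using r by (intro powr_mono2) auto
    also have "\<dots> = 2 powr (r * real n0) * (4 powr r * (real n0 + 1) powr r)"
    proof -
      have "(2 ^ n0 * (4 * N)) powr r = 2 powr (r * real n0) * (4 powr r * N powr r)" if "N \<ge> 0" for N
        using that by (simp add: powr_mult powr_realpow[symmetric] powr_powr mult.commute)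
      from this[of "real n0 + 1"] show ?thesis by (simp only: of_nat_0_le_iff add_nonneg_nonneg zero_le_one)
    qed
    also have "4 powr r \<le> 4 powr (1 :: real)" using r by (intro powr_mono) auto
    finally have "real m powr r \<le> 2 powr (r * real n0) * (4 * (real n0 + 1) powr r)"
      by (simp add: mult_left_mono mult_right_mono)
    then have "(2 powr (- r * real n0) * real m powr (- r)) * real m powr r \<le>
      (2 powr (- r * real n0) * real m powr (- r)) * (2 powr (r * real n0) * (4 * (real n0 + 1) powr r))"
      by (intro mult_left_mono) auto
    moreover have 1: "real m powr (- r) * real m powr r = 1" using m by (simp add: powr_add[symmetric])
    moreover have 2: "2 powr (- r * real n0) * 2 powr (r * real n0) = 1" by (simp add: powr_add[symmetric])
    moreover have "X \<le> 4 * N * M'" if "(X * M') * M \<le> (X * M') * (Y * (4 * N))" "M' * M = 1" "X * Y = 1" for X Y M M' N :: real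
    proof -
      have e1: "(X * M') * M = X" using that(2) by (simp add: mult.assoc)
      have e2: "(X * M') * (Y * (4 * N)) = (X * Y) * (4 * N * M')" by (simp add: mult_ac)
      show ?thesis using that(1) unfolding e1 e2 that(3) by simp
    qed
    ultimately show ?thesis by blast
  qed
  show thesis by (rule that[OF lo n0l pw])
qed

text \<open>Going k levels down, 2^(-r n) grows by 2^(r k), while the square root gains 2^(-(1 - e)
  k / 2), where e is the rate at which the budgets shrink. For r < 1/2 and small e the gain
  wins.\<close>

lemma layer_error_below:
  fixes r :: real
  assumes c: "0 < c" "c \<le> 1" and e: "e < 1" and r: "0 < r" and d: "0 \<le> d"
    and m: "2 ^ n0 * (real n0 + 1) \<le> m" "0 < m" and n: "n \<le> n0"
  shows "(real n + 1) powr d * 2 powr (- r * real n) *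
      (2 ^ n * (real n + 1) / (c * m * 2 powr (- e * real (n0 - n)))) powr (1 / 2)
    \<le> (real n0 + 1) powr d * 2 powr (- r * real n0) / c * 2 powr (- ((1 - e) / 2 - r) * real (n0 - n))"
proof -
  define k where "k = n0 - n"
  have nk: "real n = real n0 - real k" using n by (simp add: k_def of_nat_diff)
  have "2 ^ n * (real n + 1) \<le> 2 powr (- real k) * (2 ^ n0 * (real n0 + 1))"
  proof -
    have "2 ^ n = 2 powr (- real k) * (2 :: real) ^ n0"
      by (simp add: powr_realpow[symmetric] powr_add[symmetric] nk)
    moreover have "real n + 1 \<le> real n0 + 1" using n by simp
    ultimately show ?thesis by (simp add: mult_left_mono)
  qed
  also have "\<dots> \<le> 2 powr (- real k) * m" using m by (intro mult_left_mono) auto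
  finally have "2 ^ n * (real n + 1) / (c * m * 2 powr (- e * real k)) \<le> 2 powr (- real k) * m / (c * m * 2 powr (- e * real k))"
    using c m by (intro divide_right_mono) auto
  also have "\<dots> = 2 powr (- (1 - e) * real k) / c"
    using c m by (simp add: powr_diff[symmetric] field_simps powr_minus powr_add[symmetric])
  finally have "(2 ^ n * (real n + 1) / (c * m * 2 powr (- e * real k))) powr (1 / 2) \<le> (2 powr (- (1 - e) * real k) / c) powr (1 / 2)"
    using c m by (intro powr_mono2) auto
  also have "\<dots> = 2 powr (- (1 - e) * real k / 2) / c powr (1 / 2)"
    using c by (simp add: powr_divide powr_powr)
  also have "\<dots> \<le> 2 powr (- (1 - e) * real k / 2) / c"
  proof -
    have "c powr 1 \<le> c powr (1 / 2)" using c by (intro powr_mono') auto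
    then show ?thesis using c by (intro divide_left_mono) auto
  qed
  finally have 1: "(2 ^ n * (real n + 1) / (c * m * 2 powr (- e * real k))) powr (1 / 2) \<le> 2 powr (- (1 - e) * real k / 2) / c" .
  have "(real n + 1) powr d \<le> (real n0 + 1) powr d" using n d by (intro powr_mono2) auto
  then have "(real n + 1) powr d * 2 powr (- r * real n) * (2 ^ n * (real n + 1) / (c * m * 2 powr (- e * real k))) powr (1 / 2)
    \<le> (real n0 + 1) powr d * 2 powr (- r * real n) * (2 powr (- (1 - e) * real k / 2) / c)"
    using 1 by (intro mult_mono) auto
  also have "\<dots> = (real n0 + 1) powr d / c * (2 powr (- r * real n) * 2 powr (- (1 - e) * real k / 2))" by simp
  also have "2 powr (- r * real n) * 2 powr (- (1 - e) * real k / 2) = 2 powr (- r * real n0) * 2 powr (- ((1 - e) / 2 - r) * real k)"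
    unfolding nk powr_add[symmetric] by (simp add: field_simps)
  finally show ?thesis by (simp add: k_def)
qed

text \<open>Going k levels up, 2^(-r n) gains 2^(-r k), while the root loses 2^((1 + e) k / Q). For
  1/Q < r and small e the gain wins, up to powers of k + 1.\<close>

lemma layer_error_above:
  fixes r :: real
  assumes c: "0 < c" "c \<le> 1" and e: "0 < e" and r: "0 < r" and d: "0 \<le> d" and Q: "1 \<le> Q"
    and m: "2 ^ n0 * (real n0 + 1) \<le> m" "0 < m" and n: "n0 \<le> n"
  shows "(real n + 1) powr d * 2 powr (- r * real n) *
      (2 ^ n * (real n + 1) / (c * m * 2 powr (- e * real (n - n0)))) powr (1 / Q)
    \<le> (real n0 + 1) powr d * 2 powr (- r * real n0) / c *
      ((real (n - n0) + 1) powr (d + 1) * 2 powr (- (r - (1 + e) / Q) * real (n - n0)))"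
proof -
  define k where "k = n - n0"
  have nk: "real n = real n0 + real k" using n by (simp add: k_def of_nat_diff)
  \<comment> \<open>This moves the growth of n into the distance k, where exponential decay absorbs
    it; the power of n0 + 1 is unchanged and no extra logarithm arises.\<close>
  have n1: "real n + 1 \<le> (real n0 + 1) * (real k + 1)" by (simp add: nk algebra_simps)
  have "2 ^ n * (real n + 1) \<le> 2 powr real k * 2 ^ n0 * ((real n0 + 1) * (real k + 1))"
  proof (rule mult_mono[OF _ n1])
    show "2 ^ n \<le> 2 powr real k * (2 :: real) ^ n0" by (simp add: powr_realpow[symmetric] powr_add[symmetric] nk add.commute)
  qed auto
  also have "\<dots> = 2 powr real k * (real k + 1) * (2 ^ n0 * (real n0 + 1))" by simp
  also have "\<dots> \<le> 2 powr real k * (real k + 1) * m" using m by (intro mult_left_mono) auto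
  finally have "2 ^ n * (real n + 1) / (c * m * 2 powr (- e * real k)) \<le> 2 powr real k * (real k + 1) * m / (c * m * 2 powr (- e * real k))"
    using c m by (intro divide_right_mono) auto
  also have "\<dots> = 2 powr ((1 + e) * real k) * (real k + 1) / c"
    using c m by (simp add: field_simps powr_minus powr_add[symmetric])
  finally have "(2 ^ n * (real n + 1) / (c * m * 2 powr (- e * real k))) powr (1 / Q) \<le> (2 powr ((1 + e) * real k) * (real k + 1) / c) powr (1 / Q)"
    using c m Q by (intro powr_mono2) auto
  also have "\<dots> = 2 powr ((1 + e) * real k / Q) * (real k + 1) powr (1 / Q) / c powr (1 / Q)"
    using c by (simp add: powr_divide powr_mult powr_powr)
  also have "\<dots> \<le> 2 powr ((1 + e) * real k / Q) * (real k + 1) powr 1 / c powr 1"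
    using c Q by (intro frac_le mult_left_mono powr_mono powr_mono') auto
  finally have 1: "(2 ^ n * (real n + 1) / (c * m * 2 powr (- e * real k))) powr (1 / Q) \<le> 2 powr ((1 + e) * real k / Q) * (real k + 1) powr 1 / c"
    using c by simp
  have "(real n + 1) powr d \<le> ((real n0 + 1) * (real k + 1)) powr d" using n1 d by (intro powr_mono2) auto
  also have "\<dots> = (real n0 + 1) powr d * (real k + 1) powr d" by (simp add: powr_mult)
  finally have "(real n + 1) powr d * 2 powr (- r * real n) * (2 ^ n * (real n + 1) / (c * m * 2 powr (- e * real k))) powr (1 / Q)
    \<le> (real n0 + 1) powr d * (real k + 1) powr d * 2 powr (- r * real n) * (2 powr ((1 + e) * real k / Q) * (real k + 1) powr 1 / c)"
    using 1 by (intro mult_mono) auto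
  also have "\<dots> = (real n0 + 1) powr d / c * ((real k + 1) powr d * (real k + 1) powr 1) * (2 powr (- r * real n) * 2 powr ((1 + e) * real k / Q))"
    by simp
  also have "(real k + 1) powr d * (real k + 1) powr 1 = (real k + 1) powr (d + 1)" by (rule powr_add[symmetric])
  also have "2 powr (- r * real n) * 2 powr ((1 + e) * real k / Q) = 2 powr (- r * real n0) * 2 powr (- (r - (1 + e) / Q) * real k)"
    unfolding nk powr_add[symmetric] by (simp add: algebra_simps)
  finally show ?thesis by (simp add: k_def mult_ac)
qed

text \<open>Budgets peak at \<open>n0\<close> and decay on both sides, with exponent 1/2 used up to
  \<open>n0\<close> and 1/Q beyond. The constant is uniform in \<open>N\<close>, which leaves
  \<open>N\<close> free to be chosen for each m.\<close>

lemma haar_layers_approximable: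
  fixes r Q :: real
  assumes r: "0 < r" "r < 1 / 2" and Q: "2 \<le> Q" "1 / Q < r"
  shows "\<exists>C>0. \<forall>m n0 N. 0 < m \<longrightarrow> 2 ^ n0 * (real n0 + 1) \<le> real m \<longrightarrow>
    approximable m
      (smooth_class r {1, 2, Q} :: (real ^ 'n \<Rightarrow> complex) set)
      (\<lambda>f x. \<Sum>n\<le>N. haar_layer n f x)
      (C * ((real n0 + 1) powr (real CARD('n) - 1) * 2 powr (- r * real n0)))"
proof -
  \<comment> \<open>Half of the smaller of the slacks r Q - 1 and 1 - 2 r. Positivity of
    \<open>d2\<close> and \<open>d1\<close> means that e stays below the first and the second,
    respectively.\<close>
  define e where "e = min ((r * Q - 1) / 2) ((1 - 2 * r) / 2)"
  have rQ: "r * Q > 1" using Q by (simp add: field_simps)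
  have e0: "0 < e" "e < 1" using rQ r by (auto simp: e_def min_def)
  define d1 where "d1 = (1 - e) / 2 - r"
  define d2 where "d2 = r - (1 + e) / Q"
  have d1: "d1 > 0"
  proof -
    have "e \<le> (1 - 2 * r) / 2" unfolding e_def by (rule min.cobounded2)
    then show ?thesis using r by (simp add: d1_def)
  qed
  have d2: "d2 > 0"
  proof -
    have "e \<le> (r * Q - 1) / 2" unfolding e_def by (rule min.cobounded1)
    then have "1 + e < r * Q" using rQ by simp
    then show ?thesis using Q by (simp add: d2_def field_simps)
  qed
  define \<delta> where "\<delta> = min d1 d2"
  have \<delta>: "\<delta> > 0" "\<delta> \<le> d1" "\<delta> \<le> d2" using d1 d2 by (auto simp: \<delta>_def)
  define D where "D = real CARD('n) - 1"
  have D: "D \<ge> 0" by (simp add: D_def Suc_leI)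
  define w where "w k = (real k + 1) powr (D + 1) * 2 powr (- \<delta> * real k)" for k
  have "summable w"
    unfolding w_def[abs_def] using D \<delta> by (intro poly_exp_summable) auto
  moreover have "\<And>k. 0 \<le> w k" by (simp add: w_def)
  ultimately have w: "summable w" "\<And>k. 0 \<le> w k" by auto
  define x where "x = (2 :: real) powr (- e)"
  have x: "0 < x" "x < 1" using e0 by (auto simp: x_def powr_less_one)
  \<comment> \<open>Two geometric series bound the sum of all budgets by 2 c m / (1 - x), which this
    choice makes equal to m.\<close>
  define c where "c = (1 - x) / 2"
  have c: "0 < c" "c \<le> 1" using x by (auto simp: c_def)
  have xs: "summable (\<lambda>k. x ^ k)" "suminf (\<lambda>k. x ^ k) = 1 / (1 - x)"
    using x by (auto intro!: summable_geometric suminf_geometric)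
  define LC where "LC = layer_const TYPE('n)"
  have LC: "LC > 0" by (simp add: LC_def layer_const_pos)
  define C where "C = LC / c * (2 * suminf w) + 1"
  have sw: "0 \<le> suminf w" by (intro suminf_nonneg w)
  have C: "C > 0" using LC c sw by (simp add: C_def add_nonneg_pos)
  show ?thesis
  proof (intro exI[of _ C] conjI C allI impI)
    fix m n0 N :: nat
    assume m: "0 < m" and n0: "2 ^ n0 * (real n0 + 1) \<le> real m"
    define dist where "dist n = (if n \<le> n0 then n0 - n else n - n0)" for n
    define \<mu> where "\<mu> n = c * real m * 2 powr (- e * real (dist n))" for n
    have \<mu>: "\<mu> n > 0" for n using c m by (simp add: \<mu>_def)
    define R where "R = (real n0 + 1) powr D * 2 powr (- r * real n0)"
    have R: "R \<ge> 0" by (simp add: R_def)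
    let ?A = "(smooth_class r {1, 2, Q} :: (real ^ 'n \<Rightarrow> complex) set)"
    have layer: "approximable (nat \<lfloor>\<mu> n\<rfloor>) ?A (haar_layer n) (LC / c * R * w (dist n))" for n
    proof (cases "n \<le> n0")
      case True
      have "approximable (nat \<lfloor>\<mu> n\<rfloor>) ?A (haar_layer n)
        (LC * (real n + 1) powr D * 2 powr (- r * real n) * (2 ^ n * (real n + 1) / \<mu> n) powr (1 / 2))"
      proof (rule approximable_subset)
        show "approximable (nat \<lfloor>\<mu> n\<rfloor>) (smooth_class r {1, 2} :: (real ^ 'n \<Rightarrow> complex) set) (haar_layer n)
          (LC * (real n + 1) powr D * 2 powr (- r * real n) * (2 ^ n * (real n + 1) / \<mu> n) powr (1 / 2))"
          unfolding LC_def D_def by (rule haar_layer_approximable) (use r \<mu> in simp_all)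
      qed blast
      moreover have "LC * (real n + 1) powr D * 2 powr (- r * real n) * (2 ^ n * (real n + 1) / \<mu> n) powr (1 / 2) \<le> LC / c * R * w (dist n)"
      proof -
        have "(real n + 1) powr D * 2 powr (- r * real n) * (2 ^ n * (real n + 1) / \<mu> n) powr (1 / 2)
          \<le> R / c * 2 powr (- d1 * real (dist n))"
          using layer_error_below[OF c e0(2) r(1) D n0 _ True] m True
          by (simp add: \<mu>_def dist_def R_def d1_def)
        also have "\<dots> \<le> R / c * w (dist n)"
        proof (rule mult_left_mono)
          have "1 * 2 powr (- d1 * real (dist n)) \<le> (real (dist n) + 1) powr (D + 1) * 2 powr (- \<delta> * real (dist n))"
          proof (rule mult_mono)
            show "1 \<le> (real (dist n) + 1) powr (D + 1)" using D by (intro ge_one_powr_ge_zero) auto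
            show "2 powr (- d1 * real (dist n)) \<le> 2 powr (- \<delta> * real (dist n))"
              using \<delta> by (intro powr_mono mult_right_mono) auto
          qed auto
          then show "2 powr (- d1 * real (dist n)) \<le> w (dist n)" by (simp add: w_def)
        qed (use R c in simp)
        finally have "LC * ((real n + 1) powr D * 2 powr (- r * real n) * (2 ^ n * (real n + 1) / \<mu> n) powr (1 / 2)) \<le> LC * (R / c * w (dist n))"
          using LC by (intro mult_left_mono) auto
        then show ?thesis by (simp add: mult_ac)
      qed
      ultimately show ?thesis by (rule approximable_mono[OF _ order_refl])
    next
      case False
      have "approximable (nat \<lfloor>\<mu> n\<rfloor>) ?A (haar_layer n)
        (LC * (real n + 1) powr D * 2 powr (- r * real n) * (2 ^ n * (real n + 1) / \<mu> n) powr (1 / Q))"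
      proof (rule approximable_subset)
        show "approximable (nat \<lfloor>\<mu> n\<rfloor>) (smooth_class r {1, Q} :: (real ^ 'n \<Rightarrow> complex) set) (haar_layer n)
          (LC * (real n + 1) powr D * 2 powr (- r * real n) * (2 ^ n * (real n + 1) / \<mu> n) powr (1 / Q))"
          unfolding LC_def D_def by (rule haar_layer_approximable) (use r \<mu> Q in simp_all)
      qed blast
      moreover have "LC * (real n + 1) powr D * 2 powr (- r * real n) * (2 ^ n * (real n + 1) / \<mu> n) powr (1 / Q) \<le> LC / c * R * w (dist n)"
      proof -
        have "(real n + 1) powr D * 2 powr (- r * real n) * (2 ^ n * (real n + 1) / \<mu> n) powr (1 / Q)
          \<le> R / c * ((real (dist n) + 1) powr (D + 1) * 2 powr (- d2 * real (dist n)))"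
          using layer_error_above[OF c e0(1) r(1) D _ n0, of Q n] m False Q
          by (simp add: \<mu>_def dist_def R_def d2_def)
        also have "\<dots> \<le> R / c * w (dist n)"
        proof -
          have "2 powr (- d2 * real (dist n)) \<le> 2 powr (- \<delta> * real (dist n))"
            using \<delta> by (intro powr_mono mult_right_mono) auto
          then show ?thesis unfolding w_def using R c by (intro mult_left_mono) auto
        qed
        finally have "LC * ((real n + 1) powr D * 2 powr (- r * real n) * (2 ^ n * (real n + 1) / \<mu> n) powr (1 / Q)) \<le> LC * (R / c * w (dist n))"
          using LC by (intro mult_left_mono) auto
        then show ?thesis by (simp add: mult_ac)
      qed
      ultimately show ?thesis by (rule approximable_mono[OF _ order_refl])
    qed
    have sum: "approximable (\<Sum>n\<le>N. nat \<lfloor>\<mu> n\<rfloor>) ?A (\<lambda>f x. \<Sum>n\<le>N. haar_layer n f x) (\<Sum>n\<le>N. LC / c * R * w (dist n))"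
      by (rule approximable_sum[OF layer])
    have dims: "(\<Sum>n\<le>N. nat \<lfloor>\<mu> n\<rfloor>) \<le> m"
    proof -
      have "real (\<Sum>n\<le>N. nat \<lfloor>\<mu> n\<rfloor>) = (\<Sum>n\<le>N. real (nat \<lfloor>\<mu> n\<rfloor>))" by simp
      also have "\<dots> \<le> (\<Sum>n\<le>N. \<mu> n)" using \<mu> by (intro sum_mono) (simp add: less_imp_le)
      also have "\<dots> = c * real m * (\<Sum>n\<le>N. x ^ dist n)"
        by (simp add: \<mu>_def sum_distrib_left x_def powr_realpow[symmetric] powr_powr)
      also have "\<dots> \<le> c * real m * (2 * (1 / (1 - x)))"
        unfolding dist_def xs(2)[symmetric] using c x xs(1) by (intro mult_left_mono sum_two_sided_le) auto
      also have "\<dots> = real m" using x by (simp add: c_def)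
      finally show ?thesis by (simp only: of_nat_le_iff)
    qed
    have err: "(\<Sum>n\<le>N. LC / c * R * w (dist n)) \<le> C * ((real n0 + 1) powr (real CARD('n) - 1) * 2 powr (- r * real n0))"
    proof -
      have "(\<Sum>n\<le>N. LC / c * R * w (dist n)) = LC / c * R * (\<Sum>n\<le>N. w (dist n))" by (simp only: sum_distrib_left)
      also have "\<dots> \<le> LC / c * R * (2 * suminf w)"
        unfolding dist_def using LC c R by (intro mult_left_mono sum_two_sided_le w) auto
      also have "\<dots> \<le> C * R" using R by (simp add: C_def algebra_simps)
      finally show ?thesis by (simp only: R_def D_def)
    qed
    show "approximable m ?A (\<lambda>f x. \<Sum>n\<le>N. haar_layer n f x) (C * ((real n0 + 1) powr (real CARD('n) - 1) * 2 powr (- r * real n0)))"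
      by (rule approximable_mono[OF sum dims err])
  qed
qed

theorem theorem3p3:
  fixes p :: ereal and r :: real
  assumes "CARD('n::finite) \<ge> 2"
    and "2 < p"
    and "1 / p < ereal r" and "r < 1 / 2"
  shows "\<exists>C::real. C > 0 \<and> (\<forall>m::nat. m \<ge> 2 \<longrightarrow>
    kolmogorov_width (Lp_space \<infinity>) (Lp_norm \<infinity>) m (class_H r p :: (real ^ 'n \<Rightarrow> complex) set)
      \<le> ennreal (C * real m powr (- r) * ln (real m) powr (real CARD('n) - 1 + r)))"
proof -
  have real_p: "2 < q" "1 / q < r" if "p = ereal q" for q
  proof -
    show q: "2 < q" using assms(2) that by simp
    then have "1 / p = ereal (1 / q)" using that by (simp add: one_ereal_def)
    then show "1 / q < r" using assms(3) by simp
  qed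
  have r0: "0 < r"
  proof (cases p)
    case (real q)
    have "0 < 1 / q" using real_p(1)[OF real] by simp
    then show ?thesis using real_p(2)[OF real] by linarith
  next
    case PInf
    then show ?thesis using assms(3) by simp
  qed (use assms(2) in auto)
  obtain Q where Q: "2 \<le> Q" "1 / Q < r" "ereal Q \<le> p"
  proof (cases p)
    case (real q)
    then show ?thesis using real_p[OF real] that[of q] by auto
  next
    case PInf
    \<comment> \<open>For p = \<infinity> a finite exponent is enough, provided that it is at least
      2 and its reciprocal is below r; 2 / r has reciprocal r / 2.\<close>
    have "2 \<le> 2 / r" using assms(4) r0 by (simp add: field_simps)
    moreover have "1 / (2 / r) < r" using r0 by simp
    ultimately show ?thesis using PInf by (intro that[of "2 / r"]) auto
  qed (use assms(2) in auto)
  have r1: "r < 1" using assms(4) by simp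
  obtain C where C: "C > 0" "\<And>m n0 N. 0 < m \<Longrightarrow> 2 ^ n0 * (real n0 + 1) \<le> real m \<Longrightarrow>
    approximable m
      (smooth_class r {1, 2, Q} :: (real ^ 'n \<Rightarrow> complex) set)
      (\<lambda>f x. \<Sum>n\<le>N. haar_layer n f x)
      (C * ((real n0 + 1) powr (real CARD('n) - 1) * 2 powr (- r * real n0)))"
    using haar_layers_approximable[OF r0 assms(4) Q(1,2), where 'n = 'n] by blast
  \<comment> \<open>Exponent 1 provides integrability, 2 serves the layers up to n0, and Q the
    higher layers and the tail.\<close>
  have sub: "class_H r p \<subseteq> (smooth_class r {1, 2, Q} :: (real ^ 'n \<Rightarrow> complex) set)"
  proof
    fix f :: "real ^ 'n \<Rightarrow> complex" assume f: "f \<in> class_H r p"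
    have "ereal 1 \<le> p" "ereal 2 \<le> p" using Q by (auto intro: order_trans[OF _ Q(3)])
    then show "f \<in> smooth_class r {1, 2, Q}"
      using class_H_imp_mixed_smooth[OF f _ _ r0 r1] Q by auto
  qed
  define t where "t n = (real n + 1) powr (real CARD('n) - 1) * (block_bound TYPE('n) * 2 powr (- (r - 1 / Q) * real n))" for n
  have t: "summable t"
  proof -
    have "summable (\<lambda>n. block_bound TYPE('n) * ((real n + 1) powr (real CARD('n) - 1) * 2 powr (- (r - 1 / Q) * real n)))"
      by (intro summable_mult poly_exp_summable) (use Q in \<open>auto simp: Suc_leI\<close>)
    then show ?thesis by (simp add: t_def[abs_def] mult_ac)
  qed
  \<comment> \<open>C + 1 covers the layers and the tail. The 4 and the power of 3 come from
    \<open>ex_critical_level\<close>, which converts n0 into m and ln m.\<close>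
  define K where "K = (C + 1) * 4 * 3 powr (real CARD('n) - 1 + r)"
  have K: "K > 0" using C by (simp add: K_def)
  show ?thesis
  proof (intro exI[of _ K] conjI K allI impI)
    fix m :: nat assume m: "2 \<le> m"
    obtain n0 where n0: "2 ^ n0 * (real n0 + 1) \<le> real m" "real n0 + 1 \<le> 3 * ln (real m)"
      "2 powr (- r * real n0) \<le> 4 * (real n0 + 1) powr r * real m powr (- r)"
      using ex_critical_level[OF m] r0 r1 by metis
    define D where "D = real CARD('n) - 1"
    have D: "D \<ge> 0" by (simp add: D_def Suc_leI)
    define R where "R = (real n0 + 1) powr D * 2 powr (- r * real n0)"
    have R: "R > 0" by (simp add: R_def)
    \<comment> \<open>\<open>N\<close> may depend on m, because the bound for the layers up to
      \<open>N\<close> does not involve it. It only has to push the tail below the main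
      term.\<close>
    obtain N where N: "(\<Sum>n. t (n + Suc N)) \<le> R"
    proof -
      obtain N0 where N0: "\<forall>n\<ge>N0. norm (\<Sum>i. t (i + n)) < R" using suminf_exist_split[OF R t] by blast
      have "norm (\<Sum>i. t (i + Suc N0)) < R" by (rule N0[rule_format]) simp
      then have "(\<Sum>i. t (i + Suc N0)) \<le> R" unfolding real_norm_def by linarith
      then show ?thesis by (rule that)
    qed
    have approx: "approximable m (class_H r p :: (real ^ 'n \<Rightarrow> complex) set) (\<lambda>f x. \<Sum>n\<le>N. haar_layer n f x) (C * R)"
    proof (rule approximable_subset[OF _ sub])
      show "approximable m (smooth_class r {1, 2, Q} :: (real ^ 'n \<Rightarrow> complex) set)
        (\<lambda>f x. \<Sum>n\<le>N. haar_layer n f x) (C * R)"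
        unfolding R_def D_def using m n0(1) by (intro C(2)) simp_all
    qed
    have "kolmogorov_width (Lp_space \<infinity>) (Lp_norm \<infinity>) m (class_H r p :: (real ^ 'n \<Rightarrow> complex) set) \<le> ennreal (C * R + R)"
    proof (rule kolmogorov_width_le[OF approx])
      show "class_H r p \<subseteq> borel_measurable (borel :: (real ^ 'n) measure)" by (auto simp: class_H_def Lp_space_def)
      fix f :: "real ^ 'n \<Rightarrow> complex" assume "f \<in> class_H r p"
      then have f: "mixed_smooth r 1 f" "mixed_smooth r Q f" using sub by auto
      have "AE x in torus_measure. norm (f x - (\<Sum>n\<le>N. \<Sum>s\<in>level n. haar_block f s x)) \<le> (\<Sum>n. t (n + Suc N))"
        unfolding t_def by (rule haar_tail[OF f _ r0 r1]) (use Q t in \<open>auto simp: t_def[abs_def]\<close>)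
      then show "AE x in torus_measure. norm (f x - (\<Sum>n\<le>N. haar_layer n f x)) \<le> R"
        by eventually_elim (use N in \<open>auto simp: haar_layer_def intro: order_trans\<close>)
    qed
    also have "\<dots> \<le> ennreal (K * real m powr (- r) * ln (real m) powr (real CARD('n) - 1 + r))"
    proof (rule ennreal_leI)
      have "R \<le> (real n0 + 1) powr D * (4 * (real n0 + 1) powr r * real m powr (- r))"
        unfolding R_def using n0(3) by (intro mult_left_mono) auto
      also have "\<dots> = 4 * real m powr (- r) * (real n0 + 1) powr (D + r)" by (simp add: powr_add)
      also have "\<dots> \<le> 4 * real m powr (- r) * (3 * ln (real m)) powr (D + r)"
        using n0(2) D r0 by (intro mult_left_mono powr_mono2) auto
      also have "\<dots> = 4 * real m powr (- r) * (3 powr (D + r) * ln (real m) powr (D + r))"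
        using m by (simp add: powr_mult)
      finally have "(C + 1) * R \<le> (C + 1) * (4 * real m powr (- r) * (3 powr (D + r) * ln (real m) powr (D + r)))"
        using C by (intro mult_left_mono) auto
      then have le: "(C + 1) * R \<le> (C + 1) * (4 * real m powr (- r) * (3 powr (D + r) * ln (real m) powr (D + r)))" .
      show "C * R + R \<le> K * real m powr (- r) * ln (real m) powr (real CARD('n) - 1 + r)"
      proof -
        have "(C + 1) * R = C * R + R" by (simp add: distrib_right)
        moreover have "(C + 1) * (4 * a * (3 powr (D + r) * b)) = K * a * b" for a b
          by (simp only: K_def D_def mult_ac)
        ultimately show ?thesis using le by (simp only: D_def)
      qed
    qed
    finally show "kolmogorov_width (Lp_space \<infinity>) (Lp_norm \<infinity>) m (class_H r p :: (real ^ 'n \<Rightarrow> complex) set)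
      \<le> ennreal (K * real m powr (- r) * ln (real m) powr (real CARD('n) - 1 + r))" .
  qed
qed

end
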